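(* The algebras $A(k)$, $A'(k)$ and $A''(k)$ are wild for any $k\geq2$, while $A(1)$ is tame.
   Context: Ground field $\mathbb C$. $C(k)$, $k\ge1$, is the quiver whose vertices are the vertices of the $k$-dimensional cube, each edge giving two arrows with opposite orientation. The arrows are colored by $k$ colors, two arrows having the same color iff the corresponding edges are parallel. To each path corresponds its sequence of colors. Two paths are equivalent if they have the same beginning and end and the color sequence of one is a permutation of that of the other. $A(k)$ is the quotient of the path algebra $\mathbb C[C(k)]$ by the relations identifying all equivalent paths. For $k\ge2$, $C'(k)$ is obtained from $C(k)$ by removing one vertex (and its arrows) and attaching a loop to each vertex adjacent to the removed one. To the loop at $v$ one associates the color sequence $(c,c)$, with $c$ the color of the edge joining $v$ to the removed vertex. $A'(k)$ is the quotient of $\mathbb C[C'(k)]$ identifying all paths with the same beginning and end whose color sequences are permutations of each other. For $k\ge3$, $C''(k)$ and $A''(k)$ are defined in the same way, removing two opposite vertices and attaching loops to all vertices adjacent to the removed ones. For $k=2$, $C''(2)$ has two vertices $v,w$, loops $\alpha,\beta$ at $v$, loops $\varepsilon,\phi$ at $w$, arrows $\gamma:v\to w$, $\delta:w\to v$, and $A''(2)$ is the quotient of its path algebra by $\alpha\beta=\beta\alpha=\delta\gamma$, $\varepsilon\phi=\phi\varepsilon=\gamma\delta$. Tame and wild have the standard meaning for finite-dimensional modules: tame means that in each dimension all but finitely many indecomposables fall, up to isomorphism, into finitely many one-parameter families; wild means that the classification of finite-dimensional modules contains that of finite-dimensional modules over the free algebra $\mathbb C\langle x,y\rangle$. *)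

theory Defs
  imports
    "HOL-Algebra.QuotRing"
    "HOL-Algebra.Module"
    "HOL-Computational_Algebra.Polynomial"
    "HOL-Library.Poly_Mapping"
    "HOL-Library.Multiset"
    "Graph_Theory.Arc_Walk"
    "Jordan_Normal_Form.Matrix"
begin

section \<open>Complex algebras\<close>

text \<open>
  An associative unital complex algebra, not necessarily commutative, is a
  \<^typ>\<open>(complex, 'a) module\<close> record, with both its ring operations and its scalar
  multiplication used. (The locale \<^locale>\<open>algebra\<close> covers commutative algebras only.)
\<close>

type_synonym 'a calgebra = "(complex, 'a) module"

definition alg_hom :: "'a calgebra \<Rightarrow> 'b calgebra \<Rightarrow> ('a \<Rightarrow> 'b) set" where
  "alg_hom A B = {h \<in> Ring.ring_hom A B. \<forall>c. \<forall>a \<in> carrier A. h (c \<odot>\<^bsub>A\<^esub> a) = c \<odot>\<^bsub>B\<^esub> h a}"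

definition alg_quot :: "'a calgebra \<Rightarrow> 'a set \<Rightarrow> 'a set calgebra" where
  "alg_quot A I =
     \<lparr>carrier = carrier (A Quot I), monoid.mult = monoid.mult (A Quot I), one = one (A Quot I),
      zero = zero (A Quot I), add = add (A Quot I),
      smult = (\<lambda>c X. \<Union>x\<in>X. I +>\<^bsub>A\<^esub> (c \<odot>\<^bsub>A\<^esub> x))\<rparr>"

text \<open>Here \<open>s\<close> is the scalar multiplication of the complex algebra \<^typ>\<open>'b\<close>.\<close>

definition type_alg :: "(complex \<Rightarrow> 'b \<Rightarrow> 'b) \<Rightarrow> 'b::ring_1 calgebra" where
  "type_alg s = \<lparr>carrier = UNIV, monoid.mult = (*), one = 1, zero = 0, add = (+), smult = s\<rparr>"

definition mat_alg :: "(complex \<Rightarrow> 'b \<Rightarrow> 'b) \<Rightarrow> nat \<Rightarrow> 'b::ring_1 mat calgebra" where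
  "mat_alg s n =
     \<lparr>carrier = carrier_mat n n, monoid.mult = (*), one = 1\<^sub>m n, zero = 0\<^sub>m n n, add = (+),
      smult = (\<lambda>c. map_mat (s c))\<rparr>"


section \<open>Path algebras of quivers\<close>

text \<open>
  A quiver is a directed multigraph (loops allowed). A path is a triple of its start, its
  arrows in the order in which they are traversed, and its end.
\<close>

type_synonym ('v, 'e) path = "'v \<times> 'e list \<times> 'v"

definition paths :: "('v, 'e) pre_digraph \<Rightarrow> ('v, 'e) path set" where
  "paths Q = {(u, p, v). pre_digraph.awalk Q u p v}"

text \<open>Products are written like compositions of maps: in \<open>x y\<close> the path \<open>y\<close> comes first.\<close>

fun path_mult :: "('v, 'e) path \<Rightarrow> ('v, 'e) path \<Rightarrow> ('v, 'e) path \<Rightarrow>\<^sub>0 complex" where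
  "path_mult (u, p, v) (u', p', v') =
     (if v' = u then Poly_Mapping.single (u', p' @ p, v) 1 else 0)"

definition pm_scale :: "complex \<Rightarrow> ('p \<Rightarrow>\<^sub>0 complex) \<Rightarrow> ('p \<Rightarrow>\<^sub>0 complex)" where
  "pm_scale c f = Poly_Mapping.map (\<lambda>z. c * z) f"

definition path_algebra :: "('v, 'e) pre_digraph \<Rightarrow> (('v, 'e) path \<Rightarrow>\<^sub>0 complex) calgebra" where
  "path_algebra Q =
     \<lparr>carrier = {f. Poly_Mapping.keys f \<subseteq> paths Q},
      monoid.mult = (\<lambda>f g. \<Sum>x \<in> Poly_Mapping.keys f. \<Sum>y \<in> Poly_Mapping.keys g.
                pm_scale (Poly_Mapping.lookup f x * Poly_Mapping.lookup g y) (path_mult x y)),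
      one = (\<Sum>v \<in> verts Q. Poly_Mapping.single (v, [], v) 1),
      zero = 0, add = (+), smult = pm_scale\<rparr>"

definition path_algebra_mod ::
  "('v, 'e) pre_digraph \<Rightarrow> (('v, 'e) path \<times> ('v, 'e) path) set \<Rightarrow>
     (('v, 'e) path \<Rightarrow>\<^sub>0 complex) set calgebra" where
  "path_algebra_mod Q R =
     alg_quot (path_algebra Q)
       (genideal (path_algebra Q)
          {Poly_Mapping.single x 1 - Poly_Mapping.single y 1 | x y. (x, y) \<in> R})"


section \<open>The quivers and algebras\<close>

text \<open>
  Vertices of the \<open>k\<close>-dimensional cube are the subsets of \<open>{..<k}\<close>; the edge of color
  \<open>c < k\<close> at \<open>S\<close> joins \<open>S\<close> and \<open>flip c S\<close>.
\<close>

definition cube_verts :: "nat \<Rightarrow> nat set set" where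
  "cube_verts k = Pow {..<k}"

definition flip :: "nat \<Rightarrow> nat set \<Rightarrow> nat set" where
  "flip c S = (if c \<in> S then S - {c} else insert c S)"

definition opposite :: "nat \<Rightarrow> nat set \<Rightarrow> nat set" where
  "opposite k S = {..<k} - S"

text \<open>
  \<open>Edge S c\<close> is the arrow from \<open>S\<close> to \<open>flip c S\<close>; \<open>Loop S c\<close> is the loop attached at \<open>S\<close> on
  account of the removed neighbor \<open>flip c S\<close>.
\<close>

datatype cube_arrow = Edge "nat set" nat | Loop "nat set" nat

fun cube_tail :: "cube_arrow \<Rightarrow> nat set" where
  "cube_tail (Edge S c) = S"
| "cube_tail (Loop S c) = S"

fun cube_head :: "cube_arrow \<Rightarrow> nat set" where
  "cube_head (Edge S c) = flip c S"
| "cube_head (Loop S c) = S"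

fun arrow_colors :: "cube_arrow \<Rightarrow> nat list" where
  "arrow_colors (Edge S c) = [c]"
| "arrow_colors (Loop S c) = [c, c]"

definition cube_quiver :: "nat \<Rightarrow> nat set set \<Rightarrow> (nat set, cube_arrow) pre_digraph" where
  "cube_quiver k X =
     \<lparr>verts = cube_verts k - X,
      arcs = {Edge S c | S c. c < k \<and> S \<in> cube_verts k - X \<and> flip c S \<in> cube_verts k - X}
           \<union> {Loop S c | S c. c < k \<and> S \<in> cube_verts k - X \<and> flip c S \<in> X},
      tail = cube_tail, head = cube_head\<rparr>"

definition color_seq :: "cube_arrow list \<Rightarrow> nat list" where
  "color_seq p = concat (map arrow_colors p)"

definition path_equiv ::
  "(nat set, cube_arrow) pre_digraph \<Rightarrow>
     ((nat set, cube_arrow) path \<times> (nat set, cube_arrow) path) set" where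
  "path_equiv Q =
     {((u, p, v), (u', p', v')). (u, p, v) \<in> paths Q \<and> (u', p', v') \<in> paths Q \<and>
        u = u' \<and> v = v' \<and> mset (color_seq p) = mset (color_seq p')}"

abbreviation cube_algebra ::
  "nat \<Rightarrow> nat set set \<Rightarrow> ((nat set, cube_arrow) path \<Rightarrow>\<^sub>0 complex) set calgebra" where
  "cube_algebra k X \<equiv> path_algebra_mod (cube_quiver k X) (path_equiv (cube_quiver k X))"

definition "alg_A k = cube_algebra k {}"

definition "alg_A' k r = cube_algebra k {r}"

definition "alg_A'' k r = cube_algebra k {r, opposite k r}"

datatype vertex2 = Vv | Vw

datatype arrow2 = Alpha | Beta | Gamma | Delta | Epsilon | Phi

fun tail2 :: "arrow2 \<Rightarrow> vertex2" where
  "tail2 Alpha = Vv" | "tail2 Beta = Vv" | "tail2 Gamma = Vv"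
| "tail2 Delta = Vw" | "tail2 Epsilon = Vw" | "tail2 Phi = Vw"

fun head2 :: "arrow2 \<Rightarrow> vertex2" where
  "head2 Alpha = Vv" | "head2 Beta = Vv" | "head2 Gamma = Vw"
| "head2 Delta = Vv" | "head2 Epsilon = Vw" | "head2 Phi = Vw"

definition quiver2 :: "(vertex2, arrow2) pre_digraph" where
  "quiver2 = \<lparr>verts = UNIV, arcs = UNIV, tail = tail2, head = head2\<rparr>"

text \<open>
  The relations \<open>\<alpha>\<beta> = \<beta>\<alpha> = \<delta>\<gamma>\<close> and \<open>\<epsilon>\<phi> = \<phi>\<epsilon> = \<gamma>\<delta>\<close>; a product is the reverse of the list of
  arrows traversed.
\<close>

definition relations2 :: "((vertex2, arrow2) path \<times> (vertex2, arrow2) path) set" where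
  "relations2 =
     {((Vv, [Beta, Alpha], Vv), (Vv, [Alpha, Beta], Vv)),
      ((Vv, [Alpha, Beta], Vv), (Vv, [Gamma, Delta], Vv)),
      ((Vw, [Phi, Epsilon], Vw), (Vw, [Epsilon, Phi], Vw)),
      ((Vw, [Epsilon, Phi], Vw), (Vw, [Delta, Gamma], Vw))}"

definition "alg_A''2 = path_algebra_mod quiver2 relations2"


section \<open>Finite-dimensional modules\<close>

text \<open>
  \<open>(n, \<phi>)\<close> with \<open>\<phi>\<close> an algebra homomorphism from \<open>A\<close> to the \<open>n \<times> n\<close> matrices over \<^typ>\<open>'b\<close>
  is a left \<open>A\<close>-module structure on the column vectors of length \<open>n\<close> over \<^typ>\<open>'b\<close> that
  commutes with right multiplication by \<^typ>\<open>'b\<close>, that is, an \<open>A\<close>-\<^typ>\<open>'b\<close>-bimodule which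
  is free of rank \<open>n\<close> as a right module. For complex matrices this is an \<open>n\<close>-dimensional
  left \<open>A\<close>-module.
\<close>

type_synonym ('a, 'b) matrix_rep = "nat \<times> ('a \<Rightarrow> 'b mat)"

definition free_bimodule ::
  "'a calgebra \<Rightarrow> (complex \<Rightarrow> 'b \<Rightarrow> 'b) \<Rightarrow> ('a, 'b::ring_1) matrix_rep \<Rightarrow> bool" where
  "free_bimodule A s M \<longleftrightarrow> snd M \<in> alg_hom A (mat_alg s (fst M))"

definition fd_module :: "'a calgebra \<Rightarrow> ('a, complex) matrix_rep \<Rightarrow> bool" where
  "fd_module A M \<longleftrightarrow> free_bimodule A (*) M"

definition mod_iso ::
  "'a calgebra \<Rightarrow> ('a, complex) matrix_rep \<Rightarrow> ('a, complex) matrix_rep \<Rightarrow> bool" where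
  "mod_iso A M N \<longleftrightarrow> fst M = fst N \<and>
     (\<exists>P \<in> carrier_mat (fst M) (fst M). invertible_mat P \<and>
        (\<forall>a \<in> carrier A. P * snd M a = snd N a * P))"

definition mod_sum ::
  "('a, complex) matrix_rep \<Rightarrow> ('a, complex) matrix_rep \<Rightarrow> ('a, complex) matrix_rep" where
  "mod_sum M N = (fst M + fst N,
     \<lambda>a. four_block_mat (snd M a) (0\<^sub>m (fst M) (fst N)) (0\<^sub>m (fst N) (fst M)) (snd N a))"

definition indecomposable :: "'a calgebra \<Rightarrow> ('a, complex) matrix_rep \<Rightarrow> bool" where
  "indecomposable A M \<longleftrightarrow> fd_module A M \<and> fst M > 0 \<and>
     (\<forall>M1 M2. fd_module A M1 \<and> fd_module A M2 \<and> mod_iso A M (mod_sum M1 M2) \<longrightarrow>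
        fst M1 = 0 \<or> fst M2 = 0)"

text \<open>
  The tensor product over \<open>B\<close> of the bimodule \<open>B\<^sup>n\<close> given by \<open>M\<close> and the \<open>B\<close>-module
  given by \<open>N\<close>, as the direct sum of \<open>n\<close> copies of the latter: \<open>a\<close> acts by the block matrix
  whose \<open>(i, j)\<close> block is the action on \<open>N\<close> of the \<open>(i, j)\<close> entry of the matrix of \<open>a\<close>.
\<close>

definition tensor_mod ::
  "('a, 'b) matrix_rep \<Rightarrow> ('b, complex) matrix_rep \<Rightarrow> ('a, complex) matrix_rep" where
  "tensor_mod M N = (let n = fst M; d = fst N in
     (n * d, \<lambda>a. mat (n * d) (n * d)
        (\<lambda>(i, j). snd N (snd M a $$ (i div d, j div d)) $$ (i mod d, j mod d))))"


section \<open>Tame and wild algebras\<close>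

text \<open>The simple module of dimension 1 over the polynomial ring on which the variable acts by \<open>l\<close>.\<close>

definition point_module :: "complex \<Rightarrow> (complex poly, complex) matrix_rep" where
  "point_module l = (1, \<lambda>p. mat 1 1 (\<lambda>_. poly p l))"

text \<open>
  A one-parameter family is, as usual, given by a bimodule \<open>M\<close> that is free of finite rank over
  the polynomial ring: its members are the tensor products of \<open>M\<close> with the modules
  \<^const>\<open>point_module\<close>.
\<close>

definition tame :: "'a calgebra \<Rightarrow> bool" where
  "tame A \<longleftrightarrow> (\<forall>d. \<exists>E F. finite E \<and> finite F \<and>
     (\<forall>N \<in> E. fd_module A N) \<and> (\<forall>M \<in> F. free_bimodule A Polynomial.smult M) \<and>
     (\<forall>N. indecomposable A N \<and> fst N = d \<longrightarrow>
        (\<exists>N' \<in> E. mod_iso A N N') \<or>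
        (\<exists>M \<in> F. \<exists>l. mod_iso A N (tensor_mod M (point_module l)))))"

text \<open>
  The free algebra on two generators is the monoid algebra of the free monoid on two letters
  (here \<^typ>\<open>bool\<close>).
\<close>

datatype 'a free_monoid = Word "'a list"

instantiation free_monoid :: (type) monoid_add
begin

fun plus_free_monoid :: "'a free_monoid \<Rightarrow> 'a free_monoid \<Rightarrow> 'a free_monoid" where
  "Word xs + Word ys = Word (xs @ ys)"

definition zero_free_monoid :: "'a free_monoid" where
  "0 = Word []"

instance
proof
  fix a b c :: "'a free_monoid"
  show "a + b + c = a + (b + c)"
    by (cases a; cases b; cases c) simp
  show "0 + a = a" "a + 0 = a"
    by (cases a; simp add: zero_free_monoid_def)+
qed

end

type_synonym free_algebra = "bool free_monoid \<Rightarrow>\<^sub>0 complex"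

definition free_alg :: "free_algebra calgebra" where
  "free_alg = type_alg pm_scale"

text \<open>
  Drozd's definition: some bimodule over the free algebra, free of finite rank, induces a
  functor on finite-dimensional modules that preserves indecomposability and reflects
  isomorphism.
\<close>

definition wild :: "'a calgebra \<Rightarrow> bool" where
  "wild A \<longleftrightarrow> (\<exists>M :: ('a, free_algebra) matrix_rep. free_bimodule A pm_scale M \<and>
     (\<forall>N. indecomposable free_alg N \<longrightarrow> indecomposable A (tensor_mod M N)) \<and>
     (\<forall>N N'. fd_module free_alg N \<and> fd_module free_alg N' \<and>
        mod_iso A (tensor_mod M N) (tensor_mod M N') \<longrightarrow> mod_iso free_alg N N'))"

end

(*
Wildness. Let X, Y be the commuting 4 x 4 matrices over C<x, y> with
  X e0 = e1, X e1 = e3, X e2 = x e3,   Y e0 = e2, Y e1 = x e3, Y e2 = y e3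
(all other products vanish). Substituting a module N over C<x, y> gives a C[X, Y]-module on N^4 that
is generated by e0 in degree 0; its homomorphisms are block triangular with equal diagonal blocks f,
and X e1 = e3, Y e1 = x e3, Y e2 = y e3 force f to commute with x and y. Hence idempotents and
isomorphisms of N^4 are governed by f. For the cube algebras put N^4 at every vertex, let the arrows
that add an element to a vertex act by the identity, and let the opposite arrows and the loops of
color c act by X (c = 0), Y (c = 1) or 1 (c > 1). The relations hold because the endpoints and the
colors of a path determine its descents, and a homomorphism acts in the same way at all vertices
because they are connected by arrows acting by the identity. A''(2) is treated in the same way, with
alpha = epsilon = X, beta = phi = Y, gamma = 1, delta = XY.

Tameness of A(1). A module is an idempotent e with an operator z exchanging its image and kernel.
The operator z^2 is central, so on an indecomposable module it is nilpotent or invertible. A cyclic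
vector is found by writing down a sum of rank one endomorphisms whose image is spanned by a string
of vectors; the projection onto that span is then an endomorphism, hence the identity. In the nilpotent
case this leaves two modules per dimension, in the invertible case one Jordan block, with its eigenvalue
as parameter.
*)
theory Submission
  imports Defs "Jordan_Normal_Form.Spectral_Radius"
begin

section \<open>Matrices as elements of a ring\<close>

text \<open>The pair X, Y comes from the free C[X, Y]-module on e0, cut off above degree 2. Its
  degree 2 part has the basis X^2 e0, XY e0, Y^2 e0; dividing out XY e0 = x X^2 e0 and Y^2 e0 = y
  X^2 e0 leaves a single copy of N there. The reference X^2 e0 = e3 ties the block of a homomorphism
  on e3 to the block on e0; otherwise x and y would matter only up to independent base changes in
  source and target. The functor is not full: blocks that raise the degree need not vanish. They are
  nilpotent, so an idempotent with f = 0 is zero, and f = 1 is treated by passing to the complement.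
  In the tame case, C[z]/(z^m) is a Frobenius algebra with dual bases z^k and z^(m-1-k), so the
  transfer D -> sum of z^k D z^(m-1-k) turns every linear map into a C[z]-linear one. For D of rank
  one the image is spanned by z^k v, where v spans the image of D, and D z^(m-1) D = D makes the
  matrix of pairings between vectors and functionals triangular. Indecomposability then enters only
  through idempotent endomorphisms, and no classification of modules over C[z] is used.\<close>

text \<open>
  Matrices of variable size do not form a ring type. Embedding them, of all sizes at once, into the ring
  of additive endomorphisms of the complex sequences makes the algebraic type classes available.
  The identity matrix becomes an idempotent, not the unit.
\<close>

typedef op = "{f :: (nat \<Rightarrow> complex) \<Rightarrow> nat \<Rightarrow> complex. \<forall>v w. f (\<lambda>i. v i + w i) = (\<lambda>i. f v i + f w i)}"
  morphisms app Op
  by (rule exI[of _ "\<lambda>v. v"]) simp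

setup_lifting type_definition_op

instantiation op :: ring_1
begin
lift_definition zero_op :: op is "\<lambda>v i. 0" by simp
lift_definition one_op :: op is "\<lambda>v. v" by simp
lift_definition plus_op :: "op \<Rightarrow> op \<Rightarrow> op" is "\<lambda>f g v i. f v i + g v i" by (simp add: algebra_simps)
lift_definition uminus_op :: "op \<Rightarrow> op" is "\<lambda>f v i. - f v i" by (simp add: algebra_simps)
lift_definition minus_op :: "op \<Rightarrow> op \<Rightarrow> op" is "\<lambda>f g v i. f v i - g v i" by (simp add: algebra_simps)
lift_definition times_op :: "op \<Rightarrow> op \<Rightarrow> op" is "\<lambda>f g v. f (g v)" by simp
instance
proof
  fix a b c :: op
  show "a * b * c = a * (b * c)" by transfer simp
  show "1 * a = a" by transfer simp
  show "a * 1 = a" by transfer simp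
  show "a + b + c = a + (b + c)" by transfer (simp add: algebra_simps)
  show "a + b = b + a" by transfer (simp add: algebra_simps)
  show "0 + a = a" by transfer simp
  show "- a + a = 0" by transfer simp
  show "a - b = a + - b" by transfer simp
  show "(a + b) * c = a * c + b * c" by transfer simp
  show "a * (b + c) = a * b + a * c" by transfer simp
  show "(0::op) \<noteq> 1" by transfer (auto simp: fun_eq_iff intro: exI[of _ "\<lambda>_. 1"])
qed
end

text \<open>Coordinates beyond the size of the matrix are ignored in the argument and zero in the
  value. The size itself is forgotten: all zero matrices become \<open>0\<close>. Every return from
  \<open>op\<close> to matrices therefore has to supply equal dimensions.\<close>

lift_definition opm :: "complex mat \<Rightarrow> op" is
  "\<lambda>A v i. if i < dim_row A then \<Sum>j<dim_col A. A $$ (i, j) * v j else 0"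
  by (auto simp: fun_eq_iff algebra_simps sum.distrib)

lemma opm_inject:
  assumes "opm A = opm B" "dim_row A = dim_row B" "dim_col A = dim_col B"
  shows "A = B"
proof (rule eq_matI)
  fix i j assume ij: "i < dim_row B" "j < dim_col B"
  have "app (opm A) (\<lambda>k. if k = j then 1 else 0) i = app (opm B) (\<lambda>k. if k = j then 1 else 0) i"
    using assms by simp
  then show "A $$ (i, j) = B $$ (i, j)"
    using ij assms(2,3) by (simp add: opm.rep_eq if_distrib cong: if_cong)
qed (use assms in auto)

lemma opm_inject_carrier:
  assumes "opm A = opm B" "A \<in> carrier_mat n m" "B \<in> carrier_mat n m"
  shows "A = B"
  using assms by (intro opm_inject) auto

lemma opm_mult:
  assumes "dim_col A = dim_row B"
  shows "opm (A * B) = opm A * opm B"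
proof -
  have "(\<Sum>j<dim_col B. (A * B) $$ (i, j) * v j)
      = (\<Sum>k<dim_row B. A $$ (i, k) * (\<Sum>j<dim_col B. B $$ (k, j) * v j))"
    if "i < dim_row A" for v :: "nat \<Rightarrow> complex" and i
  proof -
    have "(\<Sum>j<dim_col B. (A * B) $$ (i, j) * v j)
        = (\<Sum>j<dim_col B. \<Sum>k<dim_row B. A $$ (i, k) * (B $$ (k, j) * v j))"
      using that assms
      by (intro sum.cong) (auto simp: scalar_prod_def sum_distrib_right atLeast0LessThan mult.assoc)
    also have "\<dots> = (\<Sum>k<dim_row B. \<Sum>j<dim_col B. A $$ (i, k) * (B $$ (k, j) * v j))"
      by (rule sum.swap)
    finally show ?thesis by (simp add: sum_distrib_left)
  qed
  then have "app (opm (A * B)) v i = app (opm A * opm B) v i" for v i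
    using assms unfolding opm.rep_eq times_op.rep_eq by simp
  then show ?thesis
    by (auto simp flip: app_inject simp: fun_eq_iff)
qed

lemma opm_add:
  assumes "dim_row A = dim_row B" "dim_col A = dim_col B"
  shows "opm (A + B) = opm A + opm B"
  using assms
  by (auto simp flip: app_inject simp: fun_eq_iff opm.rep_eq plus_op.rep_eq algebra_simps sum.distrib)

lemma opm_minus:
  assumes "dim_row A = dim_row B" "dim_col A = dim_col B"
  shows "opm (A - B) = opm A - opm B"
  using assms
  by (auto simp flip: app_inject simp: fun_eq_iff opm.rep_eq minus_op.rep_eq algebra_simps sum_subtractf)

lemma opm_zero [simp]: "opm (0\<^sub>m n m) = 0"
  by (auto simp flip: app_inject simp: fun_eq_iff opm.rep_eq zero_op.rep_eq)

lemma opm_one_left: "dim_row A = n \<Longrightarrow> opm (1\<^sub>m n) * opm A = opm A"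
  by (subst opm_mult[symmetric]) (auto intro!: arg_cong[where f = opm] left_mult_one_mat)

lemma opm_one_right: "dim_col A = n \<Longrightarrow> opm A * opm (1\<^sub>m n) = opm A"
  by (subst opm_mult[symmetric]) (auto intro!: arg_cong[where f = opm] right_mult_one_mat)

section \<open>Idempotent endomorphisms\<close>

text \<open>Splitting off a rank one idempotent through a nonzero entry makes the row of that entry vanish.\<close>

lemma split_idempotent_fun:
  fixes P :: "nat \<Rightarrow> nat \<Rightarrow> complex"
  assumes "\<And>i j. i < d \<Longrightarrow> j < d \<Longrightarrow> (\<Sum>k<d. P i k * P k j) = P i j"
  shows "\<exists>(r::nat) b c. (\<forall>i<d. \<forall>j<d. P i j = (\<Sum>k<r. b i k * c k j)) \<and>
    (\<forall>k<r. \<forall>l<r. (\<Sum>i<d. c k i * b i l) = (if k = l then 1 else (0::complex)))"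
  using assms
proof (induction "card {i \<in> {..<d}. \<exists>j<d. P i j \<noteq> 0}" arbitrary: P rule: less_induct)
  case less
  show ?case
  proof (cases "\<exists>i<d. \<exists>j<d. P i j \<noteq> 0")
    case False
    then show ?thesis by (intro exI[of _ 0]) auto
  next
    case True
    then obtain a e where ae: "a < d" "e < d" "P a e \<noteq> 0" by auto
    \<comment> \<open>\<open>P\<close> fixes its column \<open>e\<close> from the left and its row
      \<open>a\<close> from the right. Dividing by the pivot \<open>P a e\<close> makes
      \<open>u\<close> and \<open>v\<close> dual to each other, so \<open>v u\<close> is a rank one
      idempotent absorbed by \<open>P\<close> on both sides.\<close>
    define v where "v i = P i e" for i
    define u where "u j = P a j / P a e" for j
    define P' where "P' i j = P i j - v i * u j" for i j
    have uv: "(\<Sum>i<d. u i * v i) = 1"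
      using less.prems[of a e] ae by (simp add: u_def v_def flip: sum_divide_distrib)
    have Pv: "(\<Sum>k<d. P i k * v k) = v i" if "i < d" for i
      using less.prems[of i e] ae that by (simp add: v_def)
    have uP: "(\<Sum>k<d. u k * P k j) = u j" if "j < d" for j
      using less.prems[of a j] ae that by (simp add: u_def flip: sum_divide_distrib)
    have P'v: "(\<Sum>k<d. P' i k * v k) = 0" if "i < d" for i
    proof -
      have "(\<Sum>k<d. P' i k * v k) = (\<Sum>k<d. P i k * v k) - v i * (\<Sum>k<d. u k * v k)"
        by (simp add: P'_def algebra_simps sum_subtractf sum_distrib_left)
      then show ?thesis using Pv[OF that] uv by simp
    qed
    have uP': "(\<Sum>k<d. u k * P' k j) = 0" if "j < d" for j
    proof -
      have "(\<Sum>k<d. u k * P' k j) = (\<Sum>k<d. u k * P k j) - (\<Sum>k<d. u k * v k) * u j"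
        by (simp add: P'_def algebra_simps sum_subtractf sum_distrib_left sum_distrib_right)
      then show ?thesis using uP[OF that] uv by simp
    qed
    have idem: "(\<Sum>k<d. P' i k * P' k j) = P' i j" if ij: "i < d" "j < d" for i j
    proof -
      have "(\<Sum>k<d. P' i k * P' k j) = (\<Sum>k<d. P' i k * P k j) - (\<Sum>k<d. P' i k * v k) * u j"
        by (simp add: P'_def[of _ j] algebra_simps sum_subtractf sum_distrib_left sum_distrib_right)
      also have "\<dots> = (\<Sum>k<d. P' i k * P k j)"
        using P'v[OF ij(1)] by simp
      also have "\<dots> = (\<Sum>k<d. P i k * P k j) - v i * (\<Sum>k<d. u k * P k j)"
        by (simp add: P'_def algebra_simps sum_subtractf sum_distrib_left)
      finally show ?thesis using less.prems[OF ij] uP[OF ij(2)] by (simp add: P'_def)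
    qed
    have "{i \<in> {..<d}. \<exists>j<d. P' i j \<noteq> 0} \<subseteq> {i \<in> {..<d}. \<exists>j<d. P i j \<noteq> 0} - {a}"
    proof (intro subsetI)
      fix i assume "i \<in> {i \<in> {..<d}. \<exists>j<d. P' i j \<noteq> 0}"
      then obtain j where ij: "i < d" "j < d" "P' i j \<noteq> 0" by auto
      then have "P i j \<noteq> 0 \<or> P i e \<noteq> 0" by (auto simp: P'_def v_def)
      moreover have "i \<noteq> a" using ij ae by (auto simp: P'_def v_def u_def)
      ultimately show "i \<in> {i \<in> {..<d}. \<exists>j<d. P i j \<noteq> 0} - {a}" using ij ae by auto
    qed
    also have "\<dots> \<subset> {i \<in> {..<d}. \<exists>j<d. P i j \<noteq> 0}"
      using ae by auto
    finally have "card {i \<in> {..<d}. \<exists>j<d. P' i j \<noteq> 0} < card {i \<in> {..<d}. \<exists>j<d. P i j \<noteq> 0}"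
      by (intro psubset_card_mono) auto
    then have "\<exists>(r::nat) b c. (\<forall>i<d. \<forall>j<d. P' i j = (\<Sum>k<r. b i k * c k j)) \<and>
      (\<forall>k<r. \<forall>l<r. (\<Sum>i<d. c k i * b i l) = (if k = l then 1 else 0))"
      by (rule less.hyps) (rule idem)
    then obtain r :: nat and b c where
      bc: "(\<forall>i<d. \<forall>j<d. P' i j = (\<Sum>k<r. b i k * c k j)) \<and>
        (\<forall>k<r. \<forall>l<r. (\<Sum>i<d. c k i * b i l) = (if k = l then 1 else 0))"
      by (elim exE)
    have P'eq: "P' i j = (\<Sum>k<r. b i k * c k j)" if "i < d" "j < d" for i j
      using bc that by blast
    have cb: "(\<Sum>i<d. c k i * b i l) = (if k = l then 1 else 0)" if "k < r" "l < r" for k l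
      using bc that by blast
    \<comment> \<open>Adjoining \<open>v\<close> and \<open>u\<close> to the factorization of
      \<open>P'\<close> requires \<open>c v = 0\<close> and \<open>u b = 0\<close>. These follow
      from \<open>P' v = 0\<close> and \<open>u P' = 0\<close>, once \<open>c = c P'\<close> and
      \<open>b = P' b\<close> are known.\<close>
    have cP': "(\<Sum>j<d. c k j * P' j i) = c k i" if "k < r" "i < d" for k i
    proof -
      have "(\<Sum>j<d. c k j * P' j i) = (\<Sum>j<d. \<Sum>l<r. c k j * b j l * c l i)"
        using that by (intro sum.cong) (auto simp: P'eq sum_distrib_left mult.assoc)
      also have "\<dots> = (\<Sum>l<r. (\<Sum>j<d. c k j * b j l) * c l i)"
        by (subst sum.swap) (simp add: sum_distrib_right)
      also have "\<dots> = (\<Sum>l<r. if k = l then c l i else 0)"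
        using that by (intro sum.cong) (auto simp: cb)
      finally show ?thesis using that by simp
    qed
    have P'b: "(\<Sum>j<d. P' i j * b j l) = b i l" if "l < r" "i < d" for l i
    proof -
      have "(\<Sum>j<d. P' i j * b j l) = (\<Sum>j<d. \<Sum>k<r. b i k * (c k j * b j l))"
        using that by (intro sum.cong) (auto simp: P'eq sum_distrib_right mult.assoc)
      also have "\<dots> = (\<Sum>k<r. b i k * (\<Sum>j<d. c k j * b j l))"
        by (subst sum.swap) (simp add: sum_distrib_left)
      also have "\<dots> = (\<Sum>k<r. if k = l then b i k else 0)"
        using that by (intro sum.cong) (auto simp: cb)
      finally show ?thesis using that by simp
    qed
    have cv: "(\<Sum>i<d. c k i * v i) = 0" if "k < r" for k
    proof -
      have "(\<Sum>i<d. c k i * v i) = (\<Sum>i<d. \<Sum>j<d. c k j * (P' j i * v i))"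
      proof (rule sum.cong[OF refl])
        fix i assume "i \<in> {..<d}"
        then have "c k i = (\<Sum>j<d. c k j * P' j i)" using cP'[OF that, of i] by simp
        then show "c k i * v i = (\<Sum>j<d. c k j * (P' j i * v i))"
          by (metis (no_types, lifting) mult.assoc sum.cong sum_distrib_right)
      qed
      also have "\<dots> = (\<Sum>j<d. c k j * (\<Sum>i<d. P' j i * v i))"
        by (subst sum.swap) (simp add: sum_distrib_left)
      finally show ?thesis by (simp add: P'v)
    qed
    have ub: "(\<Sum>i<d. u i * b i l) = 0" if "l < r" for l
    proof -
      have "(\<Sum>i<d. u i * b i l) = (\<Sum>i<d. \<Sum>j<d. u i * P' i j * b j l)"
      proof (rule sum.cong[OF refl])
        fix i assume "i \<in> {..<d}"
        then have "b i l = (\<Sum>j<d. P' i j * b j l)" using P'b[OF that, of i] by simp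
        then show "u i * b i l = (\<Sum>j<d. u i * P' i j * b j l)"
          by (metis (no_types, lifting) mult.assoc sum.cong sum_distrib_left)
      qed
      also have "\<dots> = (\<Sum>j<d. (\<Sum>i<d. u i * P' i j) * b j l)"
        by (subst sum.swap) (simp add: sum_distrib_right)
      finally show ?thesis by (simp add: uP')
    qed
    let ?b = "\<lambda>i k. if k < r then b i k else v i" and ?c = "\<lambda>k j. if k < r then c k j else u j"
    have A: "P i j = (\<Sum>k<Suc r. ?b i k * ?c k j)" if "i < d" "j < d" for i j
      using P'eq[OF that] by (simp add: P'_def algebra_simps)
    have B: "(\<Sum>i<d. ?c k i * ?b i l) = (if k = l then 1 else 0)" if kl: "k < Suc r" "l < Suc r" for k l
    proof -
      consider "k < r" "l < r" | "k < r" "l = r" | "k = r" "l < r" | "k = r" "l = r"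
        using kl by linarith
      then show ?thesis by cases (simp_all add: cb cv ub uv)
    qed
    show ?thesis
      by (rule exI[of _ "Suc r"], rule exI[of _ ?b], rule exI[of _ ?c], intro conjI allI impI)
        (rule A B; assumption)+
  qed
qed

text \<open>The image of an idempotent as a space of its own: \<open>B\<close> is the inclusion,
  \<open>C\<close> the retraction.\<close>

lemma split_idempotent:
  fixes P :: "complex mat"
  assumes P: "P \<in> carrier_mat d d" "P * P = P"
  obtains r B C where "B \<in> carrier_mat d r" "C \<in> carrier_mat r d" "B * C = P" "C * B = 1\<^sub>m r"
proof -
  have "(\<Sum>k<d. P $$ (i, k) * P $$ (k, j)) = P $$ (i, j)" if "i < d" "j < d" for i j
  proof -
    have "(P * P) $$ (i, j) = (\<Sum>k<d. P $$ (i, k) * P $$ (k, j))"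
      using P(1) that by (auto simp: scalar_prod_def atLeast0LessThan)
    then show ?thesis using P(2) by simp
  qed
  then have "\<exists>(r::nat) b c. (\<forall>i<d. \<forall>j<d. P $$ (i, j) = (\<Sum>k<r. b i k * c k j)) \<and>
    (\<forall>k<r. \<forall>l<r. (\<Sum>i<d. c k i * b i l) = (if k = l then 1 else 0))"
    by (rule split_idempotent_fun)
  then obtain r :: nat and b c where
    bc: "(\<forall>i<d. \<forall>j<d. P $$ (i, j) = (\<Sum>k<r. b i k * c k j)) \<and>
      (\<forall>k<r. \<forall>l<r. (\<Sum>i<d. c k i * b i l) = (if k = l then 1 else 0))"
    by (elim exE)
  let ?B = "mat d r (\<lambda>(i, k). b i k)" and ?C = "mat r d (\<lambda>(k, j). c k j)"
  have "?B * ?C = P"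
    using P(1) by (intro eq_matI) (use bc in \<open>auto simp: scalar_prod_def atLeast0LessThan\<close>)
  moreover have "?C * ?B = 1\<^sub>m r"
    by (intro eq_matI) (use bc in \<open>auto simp: scalar_prod_def atLeast0LessThan\<close>)
  ultimately show ?thesis using that[of ?B r ?C] by simp
qed

lemma trace_swap:
  fixes B C :: "complex mat"
  assumes "B \<in> carrier_mat d r" "C \<in> carrier_mat r d"
  shows "(\<Sum>i<d. (B * C) $$ (i, i)) = (\<Sum>k<r. (C * B) $$ (k, k))"
proof -
  have "(\<Sum>i<d. (B * C) $$ (i, i)) = (\<Sum>i<d. \<Sum>k<r. B $$ (i, k) * C $$ (k, i))"
    using assms by (auto simp: scalar_prod_def atLeast0LessThan intro!: sum.cong)
  also have "\<dots> = (\<Sum>k<r. \<Sum>i<d. C $$ (k, i) * B $$ (i, k))"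
    by (subst sum.swap) (simp add: mult.commute)
  also have "\<dots> = (\<Sum>k<r. (C * B) $$ (k, k))"
    using assms by (auto simp: scalar_prod_def atLeast0LessThan intro!: sum.cong)
  finally show ?thesis .
qed

text \<open>Both products have the same trace, and the trace of a complex identity matrix is its
  size.\<close>

lemma two_sided_inverse_square:
  fixes B C :: "complex mat"
  assumes "B \<in> carrier_mat d r" "C \<in> carrier_mat r d" "B * C = 1\<^sub>m d" "C * B = 1\<^sub>m r"
  shows "d = r"
  using trace_swap[OF assms(1,2)] assms(3,4) by simp

lemma opm_eq_iff: "A \<in> carrier_mat n m \<Longrightarrow> B \<in> carrier_mat n m \<Longrightarrow> A = B \<longleftrightarrow> opm A = opm B"
  using opm_inject_carrier by blast

section \<open>Direct summands and idempotent endomorphisms\<close>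

lemma free_bimodule_iff:
  "free_bimodule A s M \<longleftrightarrow>
    (\<forall>a\<in>carrier A. snd M a \<in> carrier_mat (fst M) (fst M)) \<and>
    (\<forall>a\<in>carrier A. \<forall>b\<in>carrier A. snd M (a \<otimes>\<^bsub>A\<^esub> b) = snd M a * snd M b) \<and>
    (\<forall>a\<in>carrier A. \<forall>b\<in>carrier A. snd M (a \<oplus>\<^bsub>A\<^esub> b) = snd M a + snd M b) \<and>
    snd M \<one>\<^bsub>A\<^esub> = 1\<^sub>m (fst M) \<and>
    (\<forall>c. \<forall>a\<in>carrier A. snd M (c \<odot>\<^bsub>A\<^esub> a) = map_mat (s c) (snd M a))"
  unfolding free_bimodule_def alg_hom_def Ring.ring_hom_def mat_alg_def
  by (auto simp: Pi_iff)

lemmas fd_module_iff = free_bimodule_iff[where s = "(*)", folded fd_module_def]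

lemma map_mat_times_mult:
  fixes A :: "complex mat"
  assumes "A \<in> carrier_mat n m" "B \<in> carrier_mat m k"
  shows "map_mat ((*) c) A * B = map_mat ((*) c) (A * B)" "A * map_mat ((*) c) B = map_mat ((*) c) (A * B)"
  using assms by (auto simp: scalar_prod_def sum_distrib_left algebra_simps intro!: eq_matI)

text \<open>In the product of two compressed actions the middle factor \<open>B * C\<close> moves
  past the second action and is absorbed by the final \<open>B\<close>, because \<open>C * B\<close>
  is the identity.\<close>

lemma compressed_module:
  assumes M: "fd_module A M" and B: "B \<in> carrier_mat (fst M) r" and C: "C \<in> carrier_mat r (fst M)"
    and CB: "C * B = 1\<^sub>m r"
    and comm: "\<And>a. a \<in> carrier A \<Longrightarrow> B * C * snd M a = snd M a * (B * C)"
  shows "fd_module A (r, \<lambda>a. C * snd M a * B)"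
proof -
  let ?n = "fst M"
  have c: "snd M a \<in> carrier_mat ?n ?n" if "a \<in> carrier A" for a
    using M that by (simp add: fd_module_iff)
  have mult: "C * snd M (a \<otimes>\<^bsub>A\<^esub> b) * B = (C * snd M a * B) * (C * snd M b * B)"
    if ab: "a \<in> carrier A" "b \<in> carrier A" for a b
  proof -
    note ca = c[OF ab(1)] and cb = c[OF ab(2)]
    have 1: "opm C * opm B = opm (1\<^sub>m r)"
      using B C by (simp flip: CB opm_mult)
    have 2: "opm (1\<^sub>m r) * opm C = opm C" using C by (intro opm_one_left) auto
    have 3: "opm (snd M b) * (opm B * opm C) = opm B * opm C * opm (snd M b)"
      using comm[OF ab(2)] B C cb by (simp flip: opm_mult)
    have 4: "opm (snd M b) * (opm B * (opm C * x)) = opm B * (opm C * (opm (snd M b) * x))" for x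
      using 3 by (metis mult.assoc)
    have 5: "opm C * (opm B * x) = opm (1\<^sub>m r) * x" for x
      using 1 by (metis mult.assoc)
    have 6: "opm B * opm (1\<^sub>m r) = opm B" using B by (intro opm_one_right) auto
    have "(opm C * opm (snd M a) * opm B) * (opm C * opm (snd M b) * opm B)
        = opm C * opm (snd M a) * (opm (snd M b) * (opm B * (opm C * opm B)))"
      unfolding 4 by (simp add: mult.assoc)
    also have "\<dots> = opm C * (opm (snd M a) * opm (snd M b)) * opm B"
      by (simp add: 1 6 mult.assoc)
    finally have "opm (C * (snd M a * snd M b) * B) = opm ((C * snd M a * B) * (C * snd M b * B))"
      using B C ca cb by (simp add: opm_mult mult.assoc)
    moreover have "snd M (a \<otimes>\<^bsub>A\<^esub> b) = snd M a * snd M b"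
      using M ab by (simp add: fd_module_iff)
    moreover have "C * (snd M a * snd M b) * B \<in> carrier_mat r r"
      "(C * snd M a * B) * (C * snd M b * B) \<in> carrier_mat r r"
      using B C ca cb by auto
    ultimately show ?thesis
      using opm_inject_carrier by metis
  qed
  have "C * snd M (a \<oplus>\<^bsub>A\<^esub> b) * B = C * snd M a * B + C * snd M b * B"
    if ab: "a \<in> carrier A" "b \<in> carrier A" for a b
  proof -
    note ca = c[OF ab(1)] and cb = c[OF ab(2)]
    have "C * snd M (a \<oplus>\<^bsub>A\<^esub> b) = C * snd M a + C * snd M b"
      using M ab by (simp add: fd_module_iff mult_add_distrib_mat[OF C ca cb])
    then show ?thesis
      using add_mult_distrib_mat[of "C * snd M a" r ?n "C * snd M b" B r] B C ca cb by simp
  qed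
  moreover have "C * snd M (c \<odot>\<^bsub>A\<^esub> a) * B = map_mat ((*) c) (C * snd M a * B)"
    if a: "a \<in> carrier A" for c a
    using M a B C c[OF a]
    by (simp add: fd_module_iff map_mat_times_mult[of _ r ?n _ ?n] map_mat_times_mult[of _ r ?n _ r])
  moreover have "C * snd M \<one>\<^bsub>A\<^esub> * B = 1\<^sub>m r"
    using M CB C by (simp add: fd_module_iff)
  moreover have "C * snd M a * B \<in> carrier_mat r r" if "a \<in> carrier A" for a
    using c[OF that] B C by auto
  ultimately show ?thesis
    using mult by (simp add: fd_module_iff)
qed

lemma opm_section:
  assumes "B \<in> carrier_mat n r" "C \<in> carrier_mat r n" "C * B = 1\<^sub>m r"
  shows "opm C * (opm B * opm C) = opm C" "opm B * opm C * opm B = opm B"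
proof -
  have "opm C * opm B = opm (1\<^sub>m r)" using assms by (simp flip: opm_mult)
  then show "opm C * (opm B * opm C) = opm C" "opm B * opm C * opm B = opm B"
    using assms by (simp_all add: opm_one_left opm_one_right mult.assoc) (simp add: opm_one_left flip: mult.assoc)
qed

text \<open>An idempotent endomorphism splits the module into its image and the image of the
  complementary idempotent. The factorizations of the two idempotents, put together, form the change
  of basis.\<close>

lemma indecomposable_idempotent:
  assumes M: "indecomposable A M" and P: "P \<in> carrier_mat (fst M) (fst M)" "P * P = P"
    and comm: "\<And>a. a \<in> carrier A \<Longrightarrow> P * snd M a = snd M a * P"
  shows "P = 0\<^sub>m (fst M) (fst M) \<or> P = 1\<^sub>m (fst M)"
proof -
  define n where "n = fst M"
  have fd: "fd_module A M" using M by (simp add: indecomposable_def)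
  have c: "snd M a \<in> carrier_mat n n" if "a \<in> carrier A" for a
    using fd that by (simp add: fd_module_iff n_def)
  have P1: "P \<in> carrier_mat n n" using P by (simp add: n_def)
  define Q where "Q = 1\<^sub>m n - P"
  have Q1: "Q \<in> carrier_mat n n" using P1 by (simp add: Q_def minus_carrier_mat)
  define p where "p = opm P"
  define e where "e = opm (1\<^sub>m n)"
  have pp: "p * p = p" using P P1 by (simp add: p_def flip: opm_mult)
  have ep: "e * p = p" "p * e = p" "e * e = e"
    using P1 by (auto simp: p_def e_def opm_one_left opm_one_right)
  have oQ: "opm Q = e - p" using P1 by (simp add: Q_def p_def e_def opm_minus)
  have "opm (Q * Q) = opm Q"
    using Q1 by (simp add: opm_mult oQ algebra_simps pp ep)
  then have QQ: "Q * Q = Q" using Q1 by (subst opm_eq_iff[of _ n n]) auto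
  have commQ: "Q * snd M a = snd M a * Q" if a: "a \<in> carrier A" for a
  proof -
    have "e * opm (snd M a) = opm (snd M a)" "opm (snd M a) * e = opm (snd M a)"
      using c[OF a] by (auto simp: e_def opm_one_left opm_one_right)
    moreover have "p * opm (snd M a) = opm (snd M a) * p"
      using comm[OF a] c[OF a] P1 by (simp add: p_def flip: opm_mult)
    ultimately have "opm (Q * snd M a) = opm (snd M a * Q)"
      using Q1 c[OF a] by (simp add: opm_mult oQ algebra_simps)
    then show ?thesis using Q1 c[OF a] by (subst opm_eq_iff[of _ n n]) auto
  qed
  obtain r B C where BC: "B \<in> carrier_mat n r" "C \<in> carrier_mat r n" "B * C = P" "C * B = 1\<^sub>m r"
    using split_idempotent[OF P1 P(2)] .
  obtain s B' C' where BC': "B' \<in> carrier_mat n s" "C' \<in> carrier_mat s n" "B' * C' = Q" "C' * B' = 1\<^sub>m s"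
    using split_idempotent[OF Q1 QQ] .
  have pq: "p * (e - p) = 0" "(e - p) * p = 0" by (simp_all add: algebra_simps pp ep)
  have o: "opm B * opm C = p" "opm B' * opm C' = e - p" "opm C * opm B = opm (1\<^sub>m r)"
    "opm C' * opm B' = opm (1\<^sub>m s)"
    using BC BC' oQ by (simp_all add: p_def flip: opm_mult)
  have oC: "opm C * p = opm C" "p * opm B = opm B" "opm C' * (e - p) = opm C'" "(e - p) * opm B' = opm B'"
    using opm_section[OF BC(1,2,4)] opm_section[OF BC'(1,2,4)] by (simp_all add: o)
  have "opm (C * B') = opm C * p * ((e - p) * opm B')"
    using BC BC' by (simp add: opm_mult oC)
  also have "\<dots> = opm C * (p * (e - p)) * opm B'" by (simp only: mult.assoc)
  finally have "opm (C * B') = opm (0\<^sub>m r s)" by (simp add: pq)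
  then have CB': "C * B' = 0\<^sub>m r s" using BC BC' by (subst opm_eq_iff[of _ r s]) auto
  have "opm (C' * B) = opm C' * (e - p) * (p * opm B)"
    using BC BC' by (simp add: opm_mult oC)
  also have "\<dots> = opm C' * ((e - p) * p) * opm B" by (simp only: mult.assoc)
  finally have "opm (C' * B) = opm (0\<^sub>m s r)" by (simp add: pq)
  then have C'B: "C' * B = 0\<^sub>m s r" using BC BC' by (subst opm_eq_iff[of _ s r]) auto
  let ?M1 = "(r, \<lambda>a. C * snd M a * B)" and ?M2 = "(s, \<lambda>a. C' * snd M a * B')"
  have "fd_module A ?M1"
    using compressed_module[OF fd] BC comm by (simp add: n_def)
  moreover have "fd_module A ?M2"
    using compressed_module[OF fd] BC' commQ by (simp add: n_def)
  moreover have "mod_iso A M (mod_sum ?M1 ?M2)"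
  proof -
    \<comment> \<open>\<open>W\<close> stacks \<open>C\<close> on \<open>C'\<close>, and
      \<open>V\<close> puts \<open>B\<close> beside \<open>B'\<close>; blocks of width or height 0
      complete the two-by-two format.\<close>
    define W where "W = four_block_mat C (0\<^sub>m r 0) C' (0\<^sub>m s 0)"
    define V where "V = four_block_mat B B' (0\<^sub>m 0 r) (0\<^sub>m 0 s)"
    have W: "W \<in> carrier_mat (r + s) n" and V: "V \<in> carrier_mat n (r + s)"
      using BC BC' four_block_carrier_mat[of C r n "0\<^sub>m s 0" s 0]
        four_block_carrier_mat[of B n r "0\<^sub>m 0 s" 0 s] by (simp_all add: W_def V_def)
    have "W * V = four_block_mat (C * B) (C * B') (C' * B) (C' * B')"
      unfolding W_def V_def
      by (subst mult_four_block_mat[of _ r n _ 0 _ s _ _ r _ s]) (use BC BC' in \<open>auto simp: CB' C'B\<close>)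
    then have WV: "W * V = 1\<^sub>m (r + s)" by (auto simp: BC BC' CB' C'B intro!: eq_matI)
    have "V * W = four_block_mat (B * C + B' * C') (0\<^sub>m n 0) (0\<^sub>m 0 n) (0\<^sub>m 0 0)"
      unfolding W_def V_def
      by (subst mult_four_block_mat[of _ n r _ s _ 0 _ _ n _ 0]) (use BC BC' in auto)
    also have "\<dots> = 1\<^sub>m n"
      using P1 by (auto simp: BC BC' Q_def intro!: eq_matI)
    finally have VW: "V * W = 1\<^sub>m n" .
    have n: "n = r + s" using two_sided_inverse_square[OF V W VW WV] .
    have "W * snd M a = four_block_mat (C * snd M a * B) (0\<^sub>m r s) (0\<^sub>m s r) (C' * snd M a * B') * W"
      if a: "a \<in> carrier A" for a
    proof -
      have pa: "p * opm (snd M a) = opm (snd M a) * p"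
        using comm[OF a] c[OF a] P1 by (simp add: p_def flip: opm_mult)
      have qa: "(e - p) * opm (snd M a) = opm (snd M a) * (e - p)"
        using commQ[OF a] c[OF a] Q1 by (simp flip: opm_mult oQ)
      have "opm (C * snd M a * B * C) = opm C * (opm (snd M a) * p)"
        using BC c[OF a] by (simp add: opm_mult mult.assoc flip: o)
      also have "\<dots> = opm (C * snd M a)"
        using BC c[OF a] by (simp add: opm_mult oC flip: pa mult.assoc)
      finally have 1: "C * snd M a * B * C = C * snd M a"
        using BC c[OF a] by (subst opm_eq_iff[of _ r n]) auto
      have "opm (C' * snd M a * B' * C') = opm C' * (opm (snd M a) * (e - p))"
        using BC'(1,2) c[OF a] by (simp add: opm_mult mult.assoc o(2))
      also have "\<dots> = opm (C' * snd M a)"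
        unfolding qa[symmetric] using BC' c[OF a] by (simp add: opm_mult oC flip: mult.assoc)
      finally have 2: "C' * snd M a * B' * C' = C' * snd M a"
        using BC' c[OF a] by (subst opm_eq_iff[of _ s n]) auto
      have "snd M a = four_block_mat (snd M a) (0\<^sub>m n 0) (0\<^sub>m 0 n) (0\<^sub>m 0 0)"
        using c[OF a] by (auto intro!: eq_matI)
      then have "W * snd M a = W * \<dots>" by simp
      also have "\<dots> = four_block_mat (C * snd M a) (0\<^sub>m r 0) (C' * snd M a) (0\<^sub>m s 0)"
        unfolding W_def
        by (subst mult_four_block_mat[of _ r n _ 0 _ s _ _ n _ 0]) (use BC BC' c[OF a] in auto)
      also have "\<dots> = four_block_mat (C * snd M a * B) (0\<^sub>m r s) (0\<^sub>m s r) (C' * snd M a * B') * W"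
      proof -
        define X Y where XY: "X = C * snd M a * B" "Y = C' * snd M a * B'"
        have XYc: "X \<in> carrier_mat r r" "Y \<in> carrier_mat s s" "C * snd M a \<in> carrier_mat r n"
          "C' * snd M a \<in> carrier_mat s n"
          using BC BC' c[OF a] by (auto simp: XY)
        have "X * C = C * snd M a" "Y * C' = C' * snd M a" using 1 2 by (simp_all add: XY)
        then show ?thesis
          unfolding W_def XY[symmetric]
          by (subst mult_four_block_mat[of _ r r _ s _ s _ _ n _ 0])
            (use BC(1,2) BC'(1,2) XYc in auto)
      qed
      finally show ?thesis .
    qed
    moreover have "invertible_mat W"
      using W V WV VW by (auto simp: invertible_mat_def inverts_mat_def n intro!: exI[of _ V])
    ultimately show ?thesis
      using W by (auto simp: mod_iso_def mod_sum_def n_def[symmetric] n intro!: bexI[of _ W])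
  qed
  ultimately have "r = 0 \<or> s = 0"
    using M by (auto simp: indecomposable_def)
  then show ?thesis
  proof
    assume "r = 0"
    then have "P = 0\<^sub>m n n"
      unfolding BC(3)[symmetric] using BC(1,2) by (intro eq_matI) (auto simp: scalar_prod_def)
    then show ?thesis by (simp add: n_def)
  next
    assume "s = 0"
    then have "Q = 0\<^sub>m n n"
      unfolding BC'(3)[symmetric] using BC'(1,2) by (intro eq_matI) (auto simp: scalar_prod_def)
    then have "opm P = opm (1\<^sub>m n)" using oQ by (simp add: e_def p_def)
    then have "P = 1\<^sub>m n" using P1 by (subst opm_eq_iff[of _ n n]) auto
    then show ?thesis by (simp add: n_def)
  qed
qed

text \<open>The projection onto the first summand of a decomposition, transported to
  \<open>M\<close>, is an idempotent endomorphism. If it is trivial, one of the summands has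
  dimension 0.\<close>

lemma indecomposableI:
  assumes M: "fd_module A M" "fst M > 0"
    and triv: "\<And>P. P \<in> carrier_mat (fst M) (fst M) \<Longrightarrow> P * P = P \<Longrightarrow>
      (\<And>a. a \<in> carrier A \<Longrightarrow> P * snd M a = snd M a * P) \<Longrightarrow>
      P = 0\<^sub>m (fst M) (fst M) \<or> P = 1\<^sub>m (fst M)"
  shows "indecomposable A M"
proof -
  have "fst M1 = 0 \<or> fst M2 = 0"
    if M12: "fd_module A M1" "fd_module A M2" and iso: "mod_iso A M (mod_sum M1 M2)" for M1 M2
  proof -
    define r s n where "r = fst M1" "s = fst M2" "n = fst M"
    obtain W where W: "W \<in> carrier_mat n n" "invertible_mat W" and n: "n = r + s"
      and Wa: "\<And>a. a \<in> carrier A \<Longrightarrow> W * snd M a = snd (mod_sum M1 M2) a * W"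
      using iso by (auto simp: mod_iso_def mod_sum_def r_s_n_def)
    obtain V where WV: "W * V = 1\<^sub>m n" and VW: "V * W = 1\<^sub>m (dim_row V)"
      using W by (auto simp: invertible_mat_def inverts_mat_def)
    have V: "V \<in> carrier_mat n n"
      using arg_cong[OF WV, of dim_col] arg_cong[OF VW, of dim_col] W by auto
    then have VW: "V * W = 1\<^sub>m n" using VW by simp
    define D :: "complex mat" where "D = four_block_mat (1\<^sub>m r) (0\<^sub>m r s) (0\<^sub>m s r) (0\<^sub>m s s)"
    have D: "D \<in> carrier_mat n n" by (simp add: D_def n)
    have DD: "D * D = D"
      unfolding D_def by (subst mult_four_block_mat[of _ r r _ s _ s _ _ r _ s]) auto
    have c: "snd M a \<in> carrier_mat n n" "snd M1 a \<in> carrier_mat r r" "snd M2 a \<in> carrier_mat s s"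
      if "a \<in> carrier A" for a
      using M M12 that by (simp_all add: fd_module_iff r_s_n_def)
    have S: "snd (mod_sum M1 M2) a = four_block_mat (snd M1 a) (0\<^sub>m r s) (0\<^sub>m s r) (snd M2 a)" for a
      by (simp add: mod_sum_def r_s_n_def)
    have cS: "snd (mod_sum M1 M2) a \<in> carrier_mat n n" if "a \<in> carrier A" for a
      using c[OF that] by (simp add: S n)
    have DS: "D * snd (mod_sum M1 M2) a = snd (mod_sum M1 M2) a * D" if a: "a \<in> carrier A" for a
      unfolding D_def S using c[OF a]
      by (simp add: mult_four_block_mat[of _ r r _ s _ s _ _ r _ s])
    define P where "P = V * D * W"
    have P: "P \<in> carrier_mat n n" using V D W by (simp add: P_def)
    define v d w e where "v = opm V" "d = opm D" "w = opm W" "e = opm (1\<^sub>m n)"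
    have p: "opm P = v * d * w" using V D W by (simp add: P_def v_d_w_e_def opm_mult mult.assoc)
    have o: "w * v = e" "v * w = e" "d * d = d"
      using V D W WV VW DD by (simp_all add: v_d_w_e_def flip: opm_mult)
    have o1: "e * v = v" "v * e = v" "e * w = w" "w * e = w" "e * d = d" "d * e = d"
      using V D W by (simp_all add: v_d_w_e_def opm_one_left opm_one_right)
    have "opm (P * P) = v * (d * ((w * v) * d)) * w"
      using P by (simp add: opm_mult p mult.assoc)
    then have "opm (P * P) = opm P" by (simp add: p o o1)
    then have PP: "P * P = P" using P by (subst opm_eq_iff[of _ n n]) auto
    have Pa: "P * snd M a = snd M a * P" if a: "a \<in> carrier A" for a
    proof -
      let ?a = "opm (snd M a)" and ?b = "opm (snd (mod_sum M1 M2) a)"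
      have wa: "w * ?a = ?b * w"
        using Wa[OF a] W c[OF a] cS[OF a] by (simp add: v_d_w_e_def flip: opm_mult)
      have db: "d * ?b = ?b * d"
        using DS[OF a] D cS[OF a] by (simp add: v_d_w_e_def flip: opm_mult)
      have ea: "e * ?a = ?a" "?a * e = ?a" "?b * e = ?b"
        using c[OF a] cS[OF a] by (simp_all add: v_d_w_e_def opm_one_left opm_one_right)
      have av: "?a * v = v * ?b"
      proof -
        have "?a * v = v * (w * ?a) * v" by (simp add: o ea flip: mult.assoc)
        also have "\<dots> = v * ?b * (w * v)" by (simp add: wa mult.assoc)
        also have "\<dots> = v * ?b" by (simp add: o ea mult.assoc)
        finally show ?thesis .
      qed
      have "v * d * w * ?a = v * (d * ?b) * w" by (simp add: wa mult.assoc)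
      also have "\<dots> = (v * ?b) * d * w" by (simp add: db mult.assoc)
      also have "\<dots> = ?a * (v * d * w)" by (simp add: mult.assoc flip: av)
      finally have "opm (P * snd M a) = opm (snd M a * P)"
        using P c[OF a] by (simp add: opm_mult p)
      then show ?thesis using P c[OF a] by (subst opm_eq_iff[of _ n n]) auto
    qed
    have dp: "d = w * opm P * v"
    proof -
      have "w * (v * d * w) * v = (w * v) * d * (w * v)" by (simp only: mult.assoc)
      then show ?thesis by (simp add: p o o1)
    qed
    from triv[of P] P PP Pa have "P = 0\<^sub>m n n \<or> P = 1\<^sub>m n" by (simp add: r_s_n_def(3)[symmetric])
    then have "D = 0\<^sub>m n n \<or> D = 1\<^sub>m n"
    proof
      assume "P = 0\<^sub>m n n"
      then have "d = opm (0\<^sub>m n n)" using dp by simp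
      then show ?thesis using D unfolding v_d_w_e_def by (subst opm_eq_iff[of _ n n]) auto
    next
      assume "P = 1\<^sub>m n"
      then have "d = opm (1\<^sub>m n)" using dp by (simp add: o o1 flip: v_d_w_e_def(4))
      then show ?thesis using D unfolding v_d_w_e_def by (subst (2) opm_eq_iff[of _ n n]) auto
    qed
    then show ?thesis
    proof
      assume "D = 0\<^sub>m n n"
      \<comment> \<open>The diagonal of \<open>D\<close> separates the cases: it is 1 at position 0
        unless \<open>r = 0\<close>, and 0 at position \<open>r\<close> unless
        \<open>s = 0\<close>.\<close>
      then have "r > 0 \<Longrightarrow> D $$ (0, 0) = 0" using n by simp
      then show ?thesis by (cases "r = 0") (auto simp: D_def r_s_n_def)
    next
      assume "D = 1\<^sub>m n"
      then have "s > 0 \<Longrightarrow> D $$ (r, r) = 1" using n by simp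
      then show ?thesis by (cases "s = 0") (auto simp: D_def r_s_n_def)
    qed
  qed
  then show ?thesis using M by (auto simp: indecomposable_def)
qed

section \<open>Tensor products with bimodules\<close>

lemma sum_div_mod:
  fixes h :: "nat \<Rightarrow> nat \<Rightarrow> 'a::comm_monoid_add"
  shows "(\<Sum>k<n * d. h (k div d) (k mod d)) = (\<Sum>i<n. \<Sum>q<d. h i q)"
proof (cases "d = 0")
  case False
  have "(\<Sum>k<n * d. h (k div d) (k mod d)) = (\<Sum>(i, q)\<in>{..<n} \<times> {..<d}. h i q)"
  proof (rule sum.reindex_bij_witness[where j = "\<lambda>k. (k div d, k mod d)" and i = "\<lambda>(i, q). i * d + q"])
    fix b assume b: "b \<in> {..<n} \<times> {..<d}"
    obtain i q where iq: "b = (i, q)" "i < n" "q < d" using b by auto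
    have "i * d + q < (i + 1) * d" using iq by simp
    also have "\<dots> \<le> n * d" using iq by (intro mult_le_mono1) simp
    finally show "(case b of (i, q) \<Rightarrow> i * d + q) \<in> {..<n * d}" by (simp add: iq)
    show "((case b of (i, q) \<Rightarrow> i * d + q) div d, (case b of (i, q) \<Rightarrow> i * d + q) mod d) = b"
      using iq by simp
  qed (use False in \<open>auto simp: less_mult_imp_div_less\<close>)
  then show ?thesis by (simp add: sum.cartesian_product)
qed simp

lemma block_index_less: "i < n \<Longrightarrow> p < d \<Longrightarrow> i * d + p < n * (d::nat)"
proof -
  assume "i < n" "p < d"
  then have "i * d + p < (i + 1) * d" by simp
  also have "\<dots> \<le> n * d" using \<open>i < n\<close> by (intro mult_le_mono1) simp
  finally show ?thesis .
qed

lemma fd_module_type_alg: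
  assumes "fd_module (type_alg s) N"
  shows "snd N a \<in> carrier_mat (fst N) (fst N)"
    and "snd N (a * b) = snd N a * snd N b"
    and "snd N (a + b) = snd N a + snd N b"
    and "snd N 1 = 1\<^sub>m (fst N)"
    and "snd N (s c a) = map_mat ((*) c) (snd N a)"
  using assms by (auto simp: fd_module_iff type_alg_def)

lemma fd_module_type_alg_zero:
  assumes "fd_module (type_alg s) N"
  shows "snd N 0 = 0\<^sub>m (fst N) (fst N)"
proof -
  have "opm (snd N 0) = opm (snd N 0) + opm (snd N 0)"
    using fd_module_type_alg[OF assms] by (metis add.right_neutral carrier_matD opm_add)
  then have "opm (snd N 0) = opm (0\<^sub>m (fst N) (fst N))" by simp
  then show ?thesis
    using opm_inject_carrier fd_module_type_alg(1)[OF assms] by (metis zero_carrier_mat)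
qed

lemma fd_module_type_alg_sum:
  assumes "fd_module (type_alg s) N" "finite K" "p < fst N" "q < fst N"
  shows "snd N (\<Sum>k\<in>K. f k) $$ (p, q) = (\<Sum>k\<in>K. snd N (f k) $$ (p, q))"
  using assms(2)
proof (induction K rule: finite_induct)
  case empty
  then show ?case using assms by (simp add: fd_module_type_alg_zero)
next
  case (insert x F)
  then show ?case
    using assms carrier_matD[OF fd_module_type_alg(1)[OF assms(1)]]
    by (simp add: fd_module_type_alg(3)[OF assms(1)])
qed

text \<open>Replacing the entries of a matrix by their images under a representation is an algebra
  homomorphism into block matrices, and composing it with \<open>snd M\<close> gives the
  action.\<close>

lemma fd_module_tensor:
  assumes M: "free_bimodule A s M" and N: "fd_module (type_alg s) N"
  shows "fd_module A (tensor_mod M N)"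
proof -
  let ?n = "fst M" and ?d = "fst N"
  let ?T = "\<lambda>a. mat (?n * ?d) (?n * ?d)
    (\<lambda>(i, j). snd N (snd M a $$ (i div ?d, j div ?d)) $$ (i mod ?d, j mod ?d))"
  have T: "tensor_mod M N = (?n * ?d, ?T)"
    by (simp add: tensor_mod_def Let_def)
  note cN = fd_module_type_alg(1)[OF N]
  have cM: "snd M a \<in> carrier_mat ?n ?n" if "a \<in> carrier A" for a
    using M that by (simp add: free_bimodule_iff)
  have d0: "?d \<noteq> 0 \<and> i div ?d < ?n \<and> i mod ?d < ?d" if "i < ?n * ?d" for i
    using that by (cases "?d = 0") (auto simp: less_mult_imp_div_less)
  have mult: "?T (a \<otimes>\<^bsub>A\<^esub> b) = ?T a * ?T b" if ab: "a \<in> carrier A" "b \<in> carrier A" for a b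
  proof (rule eq_matI)
    fix i j assume "i < dim_row (?T a * ?T b)" "j < dim_col (?T a * ?T b)"
    then have ij: "i < ?n * ?d" "j < ?n * ?d" by simp_all
    have "snd M (a \<otimes>\<^bsub>A\<^esub> b) $$ (i div ?d, j div ?d)
        = (\<Sum>k<?n. snd M a $$ (i div ?d, k) * snd M b $$ (k, j div ?d))"
      using M ab carrier_matD[OF cM[OF ab(1)]] carrier_matD[OF cM[OF ab(2)]] d0[OF ij(1)] d0[OF ij(2)]
      by (simp add: free_bimodule_iff scalar_prod_def atLeast0LessThan)
    then have "?T (a \<otimes>\<^bsub>A\<^esub> b) $$ (i, j) =
       (\<Sum>k<?n. \<Sum>q<?d. snd N (snd M a $$ (i div ?d, k)) $$ (i mod ?d, q) *
          snd N (snd M b $$ (k, j div ?d)) $$ (q, j mod ?d))"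
      using d0[OF ij(1)] d0[OF ij(2)] ij carrier_matD[OF cN]
      by (simp add: fd_module_type_alg_sum[OF N] fd_module_type_alg(2)[OF N] scalar_prod_def
          atLeast0LessThan)
    also have "\<dots> = (\<Sum>k<?n * ?d. ?T a $$ (i, k) * ?T b $$ (k, j))"
      using ij by (simp flip: sum_div_mod)
    also have "\<dots> = (?T a * ?T b) $$ (i, j)"
      using ij by (simp add: scalar_prod_def atLeast0LessThan)
    finally show "?T (a \<otimes>\<^bsub>A\<^esub> b) $$ (i, j) = (?T a * ?T b) $$ (i, j)" .
  qed auto
  have add: "?T (a \<oplus>\<^bsub>A\<^esub> b) = ?T a + ?T b" if ab: "a \<in> carrier A" "b \<in> carrier A" for a b
  proof (rule eq_matI)
    fix i j assume "i < dim_row (?T a + ?T b)" "j < dim_col (?T a + ?T b)"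
    then have ij: "i < ?n * ?d" "j < ?n * ?d" by simp_all
    show "?T (a \<oplus>\<^bsub>A\<^esub> b) $$ (i, j) = (?T a + ?T b) $$ (i, j)"
      using M ab carrier_matD[OF cM[OF ab(1)]] carrier_matD[OF cM[OF ab(2)]] d0[OF ij(1)] d0[OF ij(2)] ij carrier_matD[OF cN]
      by (simp add: free_bimodule_iff fd_module_type_alg(3)[OF N])
  qed auto
  have smult: "?T (c \<odot>\<^bsub>A\<^esub> a) = map_mat ((*) c) (?T a)" if a: "a \<in> carrier A" for a c
  proof (rule eq_matI)
    fix i j assume "i < dim_row (map_mat ((*) c) (?T a))" "j < dim_col (map_mat ((*) c) (?T a))"
    then have ij: "i < ?n * ?d" "j < ?n * ?d" by simp_all
    show "?T (c \<odot>\<^bsub>A\<^esub> a) $$ (i, j) = map_mat ((*) c) (?T a) $$ (i, j)"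
      using M a carrier_matD[OF cM[OF a]] d0[OF ij(1)] d0[OF ij(2)] ij carrier_matD[OF cN]
      by (simp add: free_bimodule_iff fd_module_type_alg(5)[OF N])
  qed auto
  have one: "?T \<one>\<^bsub>A\<^esub> = 1\<^sub>m (?n * ?d)"
  proof (rule eq_matI)
    fix i j assume "i < dim_row (1\<^sub>m (?n * ?d))" "j < dim_col (1\<^sub>m (?n * ?d))"
    then have ij: "i < ?n * ?d" "j < ?n * ?d" by simp_all
    have "i = j \<longleftrightarrow> i div ?d = j div ?d \<and> i mod ?d = j mod ?d"
      by (metis div_mult_mod_eq)
    then show "?T \<one>\<^bsub>A\<^esub> $$ (i, j) = 1\<^sub>m (?n * ?d) $$ (i, j)"
      using M d0[OF ij(1)] d0[OF ij(2)] ij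
      by (auto simp: free_bimodule_iff fd_module_type_alg(4)[OF N] fd_module_type_alg_zero[OF N])
  qed auto
  show ?thesis
    using mult add smult one by (simp add: T fd_module_iff)
qed

text \<open>Blocks are taken in the ring \<open>op\<close>, so that block equations can be solved by
  ring arithmetic and a block can be compared with \<open>0\<close>.\<close>

definition blk :: "nat \<Rightarrow> complex mat \<Rightarrow> nat \<Rightarrow> nat \<Rightarrow> op" where
  "blk d \<Phi> i j = opm (mat d d (\<lambda>(p, q). \<Phi> $$ (i * d + p, j * d + q)))"

lemma opm_sum:
  assumes "finite K" "\<And>k. k \<in> K \<Longrightarrow> F k \<in> carrier_mat n m"
  shows "(\<Sum>k\<in>K. opm (F k)) = opm (mat n m (\<lambda>a. \<Sum>k\<in>K. F k $$ a))"
  using assms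
proof (induction K rule: finite_induct)
  case empty
  have "mat n m (\<lambda>_. 0) = (0\<^sub>m n m :: complex mat)" by (rule eq_matI) auto
  then show ?case by simp
next
  case (insert x K)
  have "mat n m (\<lambda>a. \<Sum>k\<in>insert x K. F k $$ a)
      = F x + mat n m (\<lambda>a. \<Sum>k\<in>K. F k $$ a)"
    using insert by (intro eq_matI) auto
  moreover have "dim_row (F x) = n" "dim_col (F x) = m" using insert.prems[of x] by auto
  ultimately show ?case using insert by (simp add: opm_add)
qed

lemma blk_mult:
  assumes "\<Phi> \<in> carrier_mat (n * d) (n * d)" "\<Psi> \<in> carrier_mat (n * d) (n * d)" "i < n" "j < n"
  shows "blk d (\<Phi> * \<Psi>) i j = (\<Sum>k<n. blk d \<Phi> i k * blk d \<Psi> k j)"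
proof -
  let ?B = "\<lambda>\<Phi> i j. mat d d (\<lambda>(p, q). \<Phi> $$ (i * d + p, j * d + q))"
  have "(\<Sum>k<n. blk d \<Phi> i k * blk d \<Psi> k j) = (\<Sum>k<n. opm (?B \<Phi> i k * ?B \<Psi> k j))"
    by (simp add: blk_def opm_mult)
  also have "\<dots> = opm (mat d d (\<lambda>a. \<Sum>k<n. (?B \<Phi> i k * ?B \<Psi> k j) $$ a))"
    by (rule opm_sum) auto
  also have "mat d d (\<lambda>a. \<Sum>k<n. (?B \<Phi> i k * ?B \<Psi> k j) $$ a) = ?B (\<Phi> * \<Psi>) i j"
  proof (rule eq_matI)
    fix p q assume "p < dim_row (?B (\<Phi> * \<Psi>) i j)" "q < dim_col (?B (\<Phi> * \<Psi>) i j)"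
    then have pq: "p < d" "q < d" by simp_all
    have "(\<Phi> * \<Psi>) $$ (i * d + p, j * d + q)
        = (\<Sum>k<n * d. \<Phi> $$ (i * d + p, (k div d) * d + k mod d) * \<Psi> $$ ((k div d) * d + k mod d, j * d + q))"
      using assms block_index_less[OF assms(3) pq(1)] block_index_less[OF assms(4) pq(2)]
      by (simp add: scalar_prod_def atLeast0LessThan)
    also have "\<dots> = (\<Sum>k<n. \<Sum>r<d. \<Phi> $$ (i * d + p, k * d + r) * \<Psi> $$ (k * d + r, j * d + q))"
      by (rule sum_div_mod[of "\<lambda>k r. \<Phi> $$ (i * d + p, k * d + r) * \<Psi> $$ (k * d + r, j * d + q)"])
    finally show "mat d d (\<lambda>a. \<Sum>k<n. (?B \<Phi> i k * ?B \<Psi> k j) $$ a) $$ (p, q)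
        = ?B (\<Phi> * \<Psi>) i j $$ (p, q)"
      using pq by (simp add: scalar_prod_def atLeast0LessThan)
  qed auto
  finally show ?thesis by (simp add: blk_def)
qed

lemma blk_eqI:
  assumes "\<Phi> \<in> carrier_mat (n * d) (n * d)" "\<Psi> \<in> carrier_mat (n * d) (n * d)"
    and "\<And>i j. i < n \<Longrightarrow> j < n \<Longrightarrow> blk d \<Phi> i j = blk d \<Psi> i j"
  shows "\<Phi> = \<Psi>"
proof (rule eq_matI)
  fix i j assume "i < dim_row \<Psi>" "j < dim_col \<Psi>"
  then have ij: "i < n * d" "j < n * d" using assms by auto
  then have d: "d > 0" by (cases d) auto
  have "mat d d (\<lambda>(p, q). \<Phi> $$ (i div d * d + p, j div d * d + q))
      = mat d d (\<lambda>(p, q). \<Psi> $$ (i div d * d + p, j div d * d + q))"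
    using assms(3)[of "i div d" "j div d"] ij unfolding blk_def
    by (intro opm_inject) (auto simp: less_mult_imp_div_less)
  then have "mat d d (\<lambda>(p, q). \<Phi> $$ (i div d * d + p, j div d * d + q)) $$ (i mod d, j mod d)
      = mat d d (\<lambda>(p, q). \<Psi> $$ (i div d * d + p, j div d * d + q)) $$ (i mod d, j mod d)"
    by simp
  then show "\<Phi> $$ (i, j) = \<Psi> $$ (i, j)" using d by simp
qed (use assms in auto)

lemma blk_tensor:
  assumes "fd_module (type_alg s) N" "i < fst M" "j < fst M"
  shows "blk (fst N) (snd (tensor_mod M N) a) i j = opm (snd N (snd M a $$ (i, j)))"
proof -
  have "mat (fst N) (fst N) (\<lambda>(p, q). snd (tensor_mod M N) a $$ (i * fst N + p, j * fst N + q))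
      = snd N (snd M a $$ (i, j))"
    using fd_module_type_alg(1)[OF assms(1), of "snd M a $$ (i, j)"] assms(2,3)
    by (intro eq_matI) (auto simp: tensor_mod_def Let_def block_index_less)
  then show ?thesis by (simp add: blk_def)
qed

lemma blk_one:
  assumes "i < n" "j < n"
  shows "blk d (1\<^sub>m (n * d)) i j = (if i = j then opm (1\<^sub>m d) else 0)"
proof -
  have "mat d d (\<lambda>(p, q). 1\<^sub>m (n * d) $$ (i * d + p, j * d + q))
      = (if i = j then 1\<^sub>m d else (0\<^sub>m d d :: complex mat))"
  proof (rule eq_matI, goal_cases)
    case (1 p q)
    then have pq: "p < d" "q < d" by (simp_all split: if_splits)
    then have "i * d + p = j * d + q \<longleftrightarrow> i = j \<and> p = q"
      by (metis add.commute div_mult_self1 div_less add.right_neutral add_left_cancel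
          less_nat_zero_code mult_eq_0_iff div_mult_self3 add_0 not_less_zero)
    then show ?case using pq assms by (simp add: block_index_less)
  qed auto
  then show ?thesis by (simp add: blk_def)
qed

section \<open>Representations of path algebras with relations\<close>

lemma lookup_pm_scale [simp]: "Poly_Mapping.lookup (pm_scale c f) x = c * Poly_Mapping.lookup f x"
  unfolding pm_scale_def by (simp add: Poly_Mapping.map.rep_eq when_def)

lemma pm_scale_simps:
  "pm_scale c (f + g) = pm_scale c f + pm_scale c g"
  "pm_scale (c + d) f = pm_scale c f + pm_scale d f"
  "pm_scale c (pm_scale d f) = pm_scale (c * d) f"
  "pm_scale 1 f = f" "pm_scale 0 f = 0" "pm_scale c 0 = 0"
  "pm_scale c (Poly_Mapping.single x a) = Poly_Mapping.single x (c * a)"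
  by (rule poly_mapping_eqI; simp add: lookup_add algebra_simps lookup_single when_def)+

lemma keys_pm_scale: "Poly_Mapping.keys (pm_scale c f) \<subseteq> Poly_Mapping.keys f"
  by (auto simp: in_keys_iff)

lemma keys_sum_subset:
  "(\<And>k. k \<in> K \<Longrightarrow> Poly_Mapping.keys (f k) \<subseteq> S) \<Longrightarrow> Poly_Mapping.keys (sum f K) \<subseteq> S"
  using keys_sum[of f K] by blast

lemma poly_mapping_sum_single:
  fixes f :: "'a \<Rightarrow>\<^sub>0 'b::comm_monoid_add"
  shows "f = (\<Sum>x\<in>Poly_Mapping.keys f. Poly_Mapping.single x (Poly_Mapping.lookup f x))"
  by (rule poly_mapping_eqI) (simp add: lookup_sum lookup_single when_def in_keys_iff)

text \<open>The case \<open>single\<close> ranges over the terms of the given \<open>f\<close> only,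
  so that a bound on its support, such as membership in the path algebra, is still at hand
  there.\<close>

lemma poly_mapping_additive_induct [case_names zero add single]:
  fixes f :: "'a \<Rightarrow>\<^sub>0 'b::comm_monoid_add"
  assumes "P 0" "\<And>f g. P f \<Longrightarrow> P g \<Longrightarrow> P (f + g)"
    "\<And>x. x \<in> Poly_Mapping.keys f \<Longrightarrow> P (Poly_Mapping.single x (Poly_Mapping.lookup f x))"
  shows "P f"
proof -
  have "P (\<Sum>x\<in>K. Poly_Mapping.single x (Poly_Mapping.lookup f x))"
    if "finite K" "K \<subseteq> Poly_Mapping.keys f" for K
    using that assms by (induction K rule: finite_induct) auto
  from this[OF finite_keys subset_refl] show ?thesis
    by (simp flip: poly_mapping_sum_single)
qed

text \<open>The product of \<open>path_algebra\<close> freed from the quiver: it is bilinear and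
  associative on all combinations of triples, whether or not these are paths.\<close>

definition pmul :: "(('v, 'e) path \<Rightarrow>\<^sub>0 complex) \<Rightarrow> (('v, 'e) path \<Rightarrow>\<^sub>0 complex) \<Rightarrow> ('v, 'e) path \<Rightarrow>\<^sub>0 complex"
  where "pmul f g = (\<Sum>x \<in> Poly_Mapping.keys f. \<Sum>y \<in> Poly_Mapping.keys g.
    pm_scale (Poly_Mapping.lookup f x * Poly_Mapping.lookup g y) (path_mult x y))"

lemma pmul_superset:
  assumes "finite X" "finite Y" "Poly_Mapping.keys f \<subseteq> X" "Poly_Mapping.keys g \<subseteq> Y"
  shows "pmul f g = (\<Sum>x\<in>X. \<Sum>y\<in>Y.
    pm_scale (Poly_Mapping.lookup f x * Poly_Mapping.lookup g y) (path_mult x y))"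
proof -
  have "(\<Sum>y \<in> Poly_Mapping.keys g. pm_scale (Poly_Mapping.lookup f x * Poly_Mapping.lookup g y) (path_mult x y))
      = (\<Sum>y\<in>Y. pm_scale (Poly_Mapping.lookup f x * Poly_Mapping.lookup g y) (path_mult x y))" for x
    using assms by (intro sum.mono_neutral_left) (auto simp: in_keys_iff pm_scale_simps)
  then have "pmul f g = (\<Sum>x \<in> Poly_Mapping.keys f. \<Sum>y\<in>Y.
      pm_scale (Poly_Mapping.lookup f x * Poly_Mapping.lookup g y) (path_mult x y))"
    by (simp add: pmul_def)
  also have "\<dots> = (\<Sum>x\<in>X. \<Sum>y\<in>Y.
      pm_scale (Poly_Mapping.lookup f x * Poly_Mapping.lookup g y) (path_mult x y))"
    using assms by (intro sum.mono_neutral_left) (auto simp: in_keys_iff pm_scale_simps)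
  finally show ?thesis .
qed

lemma pmul_add_left: "pmul (f + g) h = pmul f h + pmul g h"
proof -
  let ?X = "Poly_Mapping.keys f \<union> Poly_Mapping.keys g" and ?Y = "Poly_Mapping.keys h"
  have "Poly_Mapping.keys (f + g) \<subseteq> ?X" by (rule keys_add)
  then have "pmul (f + g) h = (\<Sum>x\<in>?X. \<Sum>y\<in>?Y.
      pm_scale (Poly_Mapping.lookup (f + g) x * Poly_Mapping.lookup h y) (path_mult x y))"
    by (intro pmul_superset) auto
  also have "\<dots> = pmul f h + pmul g h"
    by (subst (1 2) pmul_superset[where X = ?X and Y = ?Y])
      (auto simp: lookup_add algebra_simps pm_scale_simps sum.distrib)
  finally show ?thesis .
qed

lemma pmul_add_right: "pmul h (f + g) = pmul h f + pmul h g"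
proof -
  let ?X = "Poly_Mapping.keys f \<union> Poly_Mapping.keys g" and ?Y = "Poly_Mapping.keys h"
  have "Poly_Mapping.keys (f + g) \<subseteq> ?X" by (rule keys_add)
  then have "pmul h (f + g) = (\<Sum>y\<in>?Y. \<Sum>x\<in>?X.
      pm_scale (Poly_Mapping.lookup h y * Poly_Mapping.lookup (f + g) x) (path_mult y x))"
    by (intro pmul_superset) auto
  also have "\<dots> = pmul h f + pmul h g"
    by (subst (1 2) pmul_superset[where X = ?Y and Y = ?X])
      (auto simp: lookup_add algebra_simps pm_scale_simps sum.distrib)
  finally show ?thesis .
qed

lemma pmul_zero [simp]: "pmul 0 f = 0" "pmul f 0 = 0"
  by (simp_all add: pmul_def)

lemma pmul_sum_left: "pmul (sum f K) h = (\<Sum>k\<in>K. pmul (f k) h)"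
  by (induction K rule: infinite_finite_induct) (simp_all add: pmul_add_left)

lemma pmul_sum_right: "pmul h (sum f K) = (\<Sum>k\<in>K. pmul h (f k))"
  by (induction K rule: infinite_finite_induct) (simp_all add: pmul_add_right)

lemma pmul_single: "pmul (Poly_Mapping.single x a) (Poly_Mapping.single y b) = pm_scale (a * b) (path_mult x y)"
  by (subst pmul_superset[where X = "{x}" and Y = "{y}"]) auto

lemma pmul_single':
  "pmul (Poly_Mapping.single (u, p, v) a) (Poly_Mapping.single (u', p', v') b)
    = (if v' = u then Poly_Mapping.single (u', p' @ p, v) (a * b) else 0)"
  by (simp add: pmul_single pm_scale_simps)

lemma pmul_assoc: "pmul (pmul f g) h = pmul f (pmul g h)"
proof (induction f rule: poly_mapping_additive_induct)
  case (single x)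
  show ?case
  proof (induction g rule: poly_mapping_additive_induct)
    case (single y)
    show ?case
    proof (induction h rule: poly_mapping_additive_induct)
      case (single z)
      show ?case
        by (cases x; cases y; cases z) (simp add: pmul_single' mult.assoc)
    qed (simp_all add: pmul_add_right)
  qed (simp_all add: pmul_add_right pmul_add_left)
qed (simp_all add: pmul_add_left)

lemma pmul_scale_left: "pmul (pm_scale c f) g = pm_scale c (pmul f g)"
proof (induction f rule: poly_mapping_additive_induct)
  case (single x)
  show ?case
  proof (induction g rule: poly_mapping_additive_induct)
    case (single y)
    show ?case by (simp add: pmul_single pm_scale_simps mult.assoc)
  qed (simp_all add: pmul_add_right pm_scale_simps)
qed (simp_all add: pmul_add_left pm_scale_simps)

section \<open>The path algebra as a ring\<close>

lemma path_algebra_simps: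
  "carrier (path_algebra Q) = {f. Poly_Mapping.keys f \<subseteq> paths Q}"
  "f \<otimes>\<^bsub>path_algebra Q\<^esub> g = pmul f g"
  "\<one>\<^bsub>path_algebra Q\<^esub> = (\<Sum>v \<in> verts Q. Poly_Mapping.single (v, [], v) 1)"
  "\<zero>\<^bsub>path_algebra Q\<^esub> = 0"
  "f \<oplus>\<^bsub>path_algebra Q\<^esub> g = f + g"
  "c \<odot>\<^bsub>path_algebra Q\<^esub> f = pm_scale c f"
  by (simp_all add: path_algebra_def pmul_def)

locale finite_quiver = wf_digraph Q for Q :: "('v, 'e) pre_digraph" +
  assumes finite_verts: "finite (verts Q)"
begin

lemma mem_paths: "(u, p, v) \<in> paths Q \<longleftrightarrow> awalk u p v"
  by (simp add: paths_def)

lemma paths_append: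
  assumes "(u, p, v) \<in> paths Q" "(v, q, w) \<in> paths Q"
  shows "(u, p @ q, w) \<in> paths Q"
  using assms by (auto simp: mem_paths)

lemma pmul_closed:
  assumes "f \<in> carrier (path_algebra Q)" "g \<in> carrier (path_algebra Q)"
  shows "pmul f g \<in> carrier (path_algebra Q)"
proof -
  have *: "Poly_Mapping.keys (pm_scale c (path_mult x y)) \<subseteq> paths Q"
    if "x \<in> paths Q" "y \<in> paths Q" for x y c
    using that by (cases x; cases y) (auto simp: pm_scale_simps mem_paths split: if_splits)
  show ?thesis
    using assms unfolding pmul_def path_algebra_simps
    by (intro CollectI keys_sum_subset *) auto
qed

lemma one_closed: "(\<Sum>v \<in> verts Q. Poly_Mapping.single (v, [], v) 1) \<in> carrier (path_algebra Q)"
  unfolding path_algebra_simps(1)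
  by (intro CollectI order_trans[OF keys_sum]) (auto simp: mem_paths awalk_Nil_iff)

lemma one_left:
  assumes "f \<in> carrier (path_algebra Q)"
  shows "pmul (\<Sum>v \<in> verts Q. Poly_Mapping.single (v, [], v) 1) f = f"
proof -
  have *: "pmul (\<Sum>v \<in> verts Q. Poly_Mapping.single (v, [], v) 1) (Poly_Mapping.single x a)
      = Poly_Mapping.single x a" if "x \<in> paths Q" for x a
  proof -
    obtain u p w where x: "x = (u, p, w)" by (cases x)
    have "w \<in> verts Q" using that by (auto simp: mem_paths x)
    then show ?thesis using finite_verts by (simp add: x pmul_sum_left pmul_single' eq_commute[of w])
  qed
  show ?thesis
  proof (induction f rule: poly_mapping_additive_induct)
    case (single x)
    then show ?case using assms by (intro *) (auto simp: path_algebra_simps)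
  qed (simp_all add: pmul_add_right)
qed

lemma one_right:
  assumes "f \<in> carrier (path_algebra Q)"
  shows "pmul f (\<Sum>v \<in> verts Q. Poly_Mapping.single (v, [], v) 1) = f"
proof -
  have *: "pmul (Poly_Mapping.single x a) (\<Sum>v \<in> verts Q. Poly_Mapping.single (v, [], v) 1)
      = Poly_Mapping.single x a" if "x \<in> paths Q" for x a
  proof -
    obtain u p w where x: "x = (u, p, w)" by (cases x)
    have "u \<in> verts Q" using that by (auto simp: mem_paths x)
    then show ?thesis using finite_verts by (simp add: x pmul_sum_right pmul_single')
  qed
  show ?thesis
  proof (induction f rule: poly_mapping_additive_induct)
    case (single x)
    then show ?case using assms by (intro *) (auto simp: path_algebra_simps)
  qed (simp_all add: pmul_add_left)
qed

lemma keys_add_carrier: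
  "f \<in> carrier (path_algebra Q) \<Longrightarrow> g \<in> carrier (path_algebra Q) \<Longrightarrow> f + g \<in> carrier (path_algebra Q)"
  using keys_add[of f g] by (auto simp: path_algebra_simps)

lemma keys_scale_carrier: "f \<in> carrier (path_algebra Q) \<Longrightarrow> pm_scale c f \<in> carrier (path_algebra Q)"
  using keys_pm_scale[of c f] by (auto simp: path_algebra_simps)

lemma ring_path_algebra: "ring (path_algebra Q)"
proof (rule ringI)
  show "abelian_group (path_algebra Q)"
  proof (rule abelian_groupI)
    fix f assume f: "f \<in> carrier (path_algebra Q)"
    show "\<exists>g\<in>carrier (path_algebra Q). g \<oplus>\<^bsub>path_algebra Q\<^esub> f = \<zero>\<^bsub>path_algebra Q\<^esub>"
    proof (rule bexI[of _ "pm_scale (-1) f"])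
      show "pm_scale (-1) f \<oplus>\<^bsub>path_algebra Q\<^esub> f = \<zero>\<^bsub>path_algebra Q\<^esub>"
        by (rule poly_mapping_eqI) (simp add: path_algebra_simps lookup_add)
    qed (rule keys_scale_carrier[OF f])
  qed (auto simp: path_algebra_simps(2-) keys_add_carrier add.assoc add.commute, simp add: path_algebra_simps)
  show "monoid (path_algebra Q)"
    by (rule monoidI)
      (simp_all add: path_algebra_simps(2-) pmul_closed one_closed pmul_assoc one_left one_right)
qed (simp_all add: path_algebra_simps pmul_add_left pmul_add_right)

end

text \<open>Keeping the parameter algebra abstract lets one construction of bimodules serve twice:
  over the free algebra for wildness and over the polynomial ring for the one-parameter
  family.\<close>

locale calg =
  fixes s :: "complex \<Rightarrow> 'b \<Rightarrow> 'b::ring_1"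
  assumes s_add: "s c (a + b) = s c a + s c b" "s (c + d) a = s c a + s d a"
    and s_s: "s c (s d a) = s (c * d) a" and s_one: "s 1 a = a"
    and s_mult: "s c a * b = s c (a * b)" "a * s c b = s c (a * b)"
begin

lemma s_zero: "s 0 a = 0" "s c 0 = 0"
  using s_add(2)[of 0 0 a] s_add(1)[of c 0 0] by simp_all

lemma s_sum: "s c (sum f K) = (\<Sum>k\<in>K. s c (f k))"
  by (induction K rule: infinite_finite_induct) (simp_all add: s_zero s_add)

end

section \<open>The quotient by relations\<close>

locale quiver_relations = finite_quiver Q for Q :: "('v, 'e) pre_digraph" +
  fixes R :: "(('v, 'e) path \<times> ('v, 'e) path) set"
  assumes relations: "R \<subseteq> paths Q \<times> paths Q"
begin

abbreviation "PA \<equiv> path_algebra Q"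
abbreviation "A \<equiv> path_algebra_mod Q R"

interpretation PA: ring PA
  by (rule ring_path_algebra)

abbreviation "gens \<equiv> {Poly_Mapping.single x 1 - Poly_Mapping.single y (1 :: complex) | x y. (x, y) \<in> R}"
definition "rel_ideal = genideal PA gens"

lemma gens_carrier: "gens \<subseteq> carrier PA"
proof
  fix f :: "('v, 'e) path \<Rightarrow>\<^sub>0 complex" assume "f \<in> gens"
  then obtain x y where f: "f = Poly_Mapping.single x 1 - Poly_Mapping.single y 1" "(x, y) \<in> R" by auto
  have "Poly_Mapping.keys f \<subseteq> {x, y}"
    unfolding f by (auto simp: in_keys_iff lookup_minus lookup_single when_def split: if_splits)
  then show "f \<in> carrier PA" using f(2) relations by (auto simp: path_algebra_simps)
qed

interpretation rel: ideal rel_ideal PA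
  unfolding rel_ideal_def by (rule PA.genideal_ideal[OF gens_carrier])

definition "cls f = rel_ideal +>\<^bsub>PA\<^esub> f"

text \<open>The ideal is generated in the sense of rings. It is a subspace because scaling is
  multiplication by a multiple of the unit.\<close>

lemma scale_rel_ideal: "i \<in> rel_ideal \<Longrightarrow> pm_scale c i \<in> rel_ideal"
proof -
  assume i: "i \<in> rel_ideal"
  let ?o = "(\<Sum>v \<in> verts Q. Poly_Mapping.single (v, [], v) 1) :: ('v, 'e) path \<Rightarrow>\<^sub>0 complex"
  have "pmul (pm_scale c ?o) i = pm_scale c i"
    using one_left[of i] rel.a_subset i by (auto simp: pmul_scale_left)
  then show ?thesis
    using rel.I_l_closed[OF i keys_scale_carrier[OF one_closed, of c]] by (simp add: path_algebra_simps)
qed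

lemma mem_cls: "g \<in> cls f \<longleftrightarrow> (\<exists>i\<in>rel_ideal. g = i + f)"
  by (auto simp: cls_def a_r_coset_def' path_algebra_simps)

lemma self_cls: "f \<in> carrier PA \<Longrightarrow> f \<in> cls f"
  unfolding cls_def by (rule rel.a_rcos_self)

lemma cls_eq: "g \<in> cls f \<Longrightarrow> f \<in> carrier PA \<Longrightarrow> cls g = cls f"
  unfolding cls_def by (rule rel.a_repr_independence'[symmetric])

lemma quot_simps:
  shows "carrier A = cls ` carrier PA"
    and "f \<in> carrier PA \<Longrightarrow> g \<in> carrier PA \<Longrightarrow> cls f \<otimes>\<^bsub>A\<^esub> cls g = cls (pmul f g)"
    and "f \<in> carrier PA \<Longrightarrow> g \<in> carrier PA \<Longrightarrow> cls f \<oplus>\<^bsub>A\<^esub> cls g = cls (f + g)"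
    and "\<one>\<^bsub>A\<^esub> = cls (\<Sum>v \<in> verts Q. Poly_Mapping.single (v, [], v) 1)"
    and "f \<in> carrier PA \<Longrightarrow> c \<odot>\<^bsub>A\<^esub> cls f = cls (pm_scale c f)"
proof -
  show "carrier A = cls ` carrier PA"
    by (auto simp: path_algebra_mod_def alg_quot_def FactRing_def A_RCOSETS_def' cls_def rel_ideal_def)
  show "\<one>\<^bsub>A\<^esub> = cls (\<Sum>v \<in> verts Q. Poly_Mapping.single (v, [], v) 1)"
    by (simp add: path_algebra_mod_def alg_quot_def FactRing_def cls_def rel_ideal_def path_algebra_simps)
next
  assume fg: "f \<in> carrier PA" "g \<in> carrier PA"
  show "cls f \<otimes>\<^bsub>A\<^esub> cls g = cls (pmul f g)"
    using ring_hom_mult[OF rel.rcos_ring_hom fg]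
    by (simp add: path_algebra_mod_def alg_quot_def cls_def rel_ideal_def path_algebra_simps)
  show "cls f \<oplus>\<^bsub>A\<^esub> cls g = cls (f + g)"
    using ring_hom_add[OF rel.rcos_ring_hom fg]
    by (simp add: path_algebra_mod_def alg_quot_def cls_def rel_ideal_def path_algebra_simps)
next
  assume f: "f \<in> carrier PA"
  have *: "cls (pm_scale c g) = cls (pm_scale c f)" if g: "g \<in> cls f" for g
  proof -
    obtain i where "i \<in> rel_ideal" "g = i + f" using g by (auto simp: mem_cls)
    then have "pm_scale c g \<in> cls (pm_scale c f)"
      by (auto simp: mem_cls pm_scale_simps intro: scale_rel_ideal)
    then show ?thesis by (rule cls_eq) (rule keys_scale_carrier[OF f])
  qed
  \<comment> \<open>The scalar multiplication of the quotient is a union over all representatives.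
    They all produce the same coset, so the union is that coset.\<close>
  have "(\<Union>x\<in>cls f. cls (pm_scale c x)) = cls (pm_scale c f)"
    by (rule UN_constant_eq[OF self_cls[OF f]]) (use * in blast)
  then show "c \<odot>\<^bsub>A\<^esub> cls f = cls (pm_scale c f)"
    by (simp add: path_algebra_mod_def alg_quot_def cls_def rel_ideal_def path_algebra_simps)
qed

lemma single_carrier: "x \<in> paths Q \<Longrightarrow> Poly_Mapping.single x a \<in> carrier PA"
  by (simp add: path_algebra_simps)

abbreviation "pcls x \<equiv> cls (Poly_Mapping.single x 1)"

lemma pcls_carrier: "x \<in> paths Q \<Longrightarrow> pcls x \<in> carrier A"
  by (auto simp: quot_simps single_carrier)

lemma pcls_mult:
  assumes "(u, p, v) \<in> paths Q" "(v, q, w) \<in> paths Q"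
  shows "pcls (v, q, w) \<otimes>\<^bsub>A\<^esub> pcls (u, p, v) = pcls (u, p @ q, w)"
  using assms by (simp add: quot_simps single_carrier pmul_single')

text \<open>The zero element enters as a multiple of the unit, so that a property closed under
  scaling needs checking only at the unit, which acts by the identity.\<close>

lemma cls_induct [consumes 1, case_names single add one]:
  assumes "a \<in> carrier A"
    and single: "\<And>x c. x \<in> paths Q \<Longrightarrow> P (c \<odot>\<^bsub>A\<^esub> pcls x)"
    and add: "\<And>a b. a \<in> carrier A \<Longrightarrow> b \<in> carrier A \<Longrightarrow> P a \<Longrightarrow> P b \<Longrightarrow> P (a \<oplus>\<^bsub>A\<^esub> b)"
    and one: "P (0 \<odot>\<^bsub>A\<^esub> \<one>\<^bsub>A\<^esub>)"
  shows "P a"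
proof -
  obtain f where f: "a = cls f" "f \<in> carrier PA" using assms(1) by (auto simp: quot_simps)
  have "f \<in> carrier PA \<and> P (cls f)"
  proof (induction f rule: poly_mapping_additive_induct)
    case zero
    have "P (cls 0)" using one one_closed by (simp add: quot_simps pm_scale_simps)
    then show ?case by (simp add: path_algebra_simps)
  next
    case (add f g)
    then show ?case
      using assms(3)[of "cls f" "cls g"] by (simp add: quot_simps keys_add_carrier)
  next
    case (single x)
    then have x: "x \<in> paths Q" using f(2) by (auto simp: path_algebra_simps)
    have "P (cls (Poly_Mapping.single x (Poly_Mapping.lookup f x)))"
      using assms(2)[OF x, of "Poly_Mapping.lookup f x"] x
      by (simp add: quot_simps single_carrier pm_scale_simps)
    then show ?case using x by (simp add: single_carrier)
  qed
  then show ?thesis using f by simp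
qed

text \<open>Commuting with \<open>P\<close> is stable under products, sums and multiples, and every
  path is a product of arrows or trivial. Hence vertices and arrows decide.\<close>

lemma intertwiner:
  assumes M: "fd_module A M" and N: "fd_module A N" and P: "P \<in> carrier_mat (fst N) (fst M)"
    and verts: "\<And>v. v \<in> verts Q \<Longrightarrow> P * snd M (pcls (v, [], v)) = snd N (pcls (v, [], v)) * P"
    and arcs: "\<And>e. e \<in> arcs Q \<Longrightarrow> P * snd M (pcls (tail Q e, [e], head Q e))
      = snd N (pcls (tail Q e, [e], head Q e)) * P"
    and a: "a \<in> carrier A"
  shows "P * snd M a = snd N a * P"
proof -
  have cM: "snd M a \<in> carrier_mat (fst M) (fst M)" if "a \<in> carrier A" for a
    using M that by (simp add: fd_module_iff)
  have cN: "snd N a \<in> carrier_mat (fst N) (fst N)" if "a \<in> carrier A" for a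
    using N that by (simp add: fd_module_iff)
  have mult: "P * snd M (a \<otimes>\<^bsub>A\<^esub> b) = snd N (a \<otimes>\<^bsub>A\<^esub> b) * P"
    if "a \<in> carrier A" "b \<in> carrier A" "P * snd M a = snd N a * P" "P * snd M b = snd N b * P" for a b
  proof -
    have "P * (snd M a * snd M b) = snd N a * snd N b * P"
      using assoc_mult_mat[OF P cM[OF that(1)] cM[OF that(2)]]
        assoc_mult_mat[OF cN[OF that(1)] P cM[OF that(2)]]
        assoc_mult_mat[OF cN[OF that(1)] cN[OF that(2)] P] that(3,4) by argo
    then show ?thesis using M N that(1,2) by (simp add: fd_module_iff)
  qed
  have scale: "P * snd M (c \<odot>\<^bsub>A\<^esub> a) = snd N (c \<odot>\<^bsub>A\<^esub> a) * P"
    if "a \<in> carrier A" "P * snd M a = snd N a * P" for a c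
    using M N that map_mat_times_mult(2)[OF P cM[OF that(1)]] map_mat_times_mult(1)[OF cN[OF that(1)] P]
    by (simp add: fd_module_iff)
  have path: "P * snd M (pcls (u, p, v)) = snd N (pcls (u, p, v)) * P" if "(u, p, v) \<in> paths Q" for u p v
    using that
  proof (induction p arbitrary: u)
    case Nil
    then show ?case using verts by (auto simp: mem_paths awalk_Nil_iff)
  next
    case (Cons e p)
    then have e: "e \<in> arcs Q" "u = tail Q e" and p: "(head Q e, p, v) \<in> paths Q"
      by (auto simp: mem_paths awalk_Cons_iff)
    have e': "(tail Q e, [e], head Q e) \<in> paths Q"
      using e by (auto simp: mem_paths arc_implies_awalk)
    show ?case
      using mult[OF pcls_carrier[OF p] pcls_carrier[OF e'] Cons.IH[OF p] arcs[OF e(1)]]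
      by (simp add: pcls_mult[OF e' p] e)
  qed
  show ?thesis
    using a
  proof (induction a rule: cls_induct)
    case (single x c)
    then show ?case by (cases x) (auto intro!: scale pcls_carrier path)
  next
    case (add a b)
    have "P * (snd M a + snd M b) = P * snd M a + P * snd M b"
      by (rule mult_add_distrib_mat[OF P cM[OF add(1)] cM[OF add(2)]])
    moreover have "(snd N a + snd N b) * P = snd N a * P + snd N b * P"
      by (rule add_mult_distrib_mat[OF cN[OF add(1)] cN[OF add(2)] P])
    ultimately show ?case using add M N by (simp add: fd_module_iff)
  next
    case one
    have 1: "\<one>\<^bsub>A\<^esub> \<in> carrier A" using one_closed by (auto simp: quot_simps)
    show ?case using P M N by (intro scale 1) (simp add: fd_module_iff)
  qed
qed

end

text \<open>The universal property of the quotient: matrices assigned to paths, multiplicative along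
  composition, zero on pairs that do not compose and equal on related paths, extend linearly to a
  representation.\<close>

locale quiver_rep = quiver_relations Q R + calg s
  for Q :: "('v, 'e) pre_digraph" and R and s :: "complex \<Rightarrow> 'b \<Rightarrow> 'b::ring_1" +
  fixes n :: nat and \<rho> :: "('v, 'e) path \<Rightarrow> 'b mat"
  assumes rho_carrier: "\<And>x. x \<in> paths Q \<Longrightarrow> \<rho> x \<in> carrier_mat n n"
    and rho_mult: "\<And>u p v u' q v'. (u, p, v) \<in> paths Q \<Longrightarrow> (u', q, v') \<in> paths Q \<Longrightarrow>
      \<rho> (u, p, v) * \<rho> (u', q, v') = (if v' = u then \<rho> (u', q @ p, v) else 0\<^sub>m n n)"
    and rho_one: "\<And>i j. i < n \<Longrightarrow> j < n \<Longrightarrow> (\<Sum>v\<in>verts Q. \<rho> (v, [], v) $$ (i, j)) = (if i = j then 1 else 0)"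
    and rho_rel: "\<And>x y. (x, y) \<in> R \<Longrightarrow> \<rho> x = \<rho> y"
begin

interpretation PA: ring PA
  by (rule ring_path_algebra)

definition "lin f = mat n n (\<lambda>ij. \<Sum>x\<in>Poly_Mapping.keys f. s (Poly_Mapping.lookup f x) (\<rho> x $$ ij))"

lemma lin_carrier [simp]: "lin f \<in> carrier_mat n n" "dim_row (lin f) = n" "dim_col (lin f) = n"
  by (simp_all add: lin_def)

lemma lin_superset:
  assumes "finite X" "Poly_Mapping.keys f \<subseteq> X"
  shows "lin f = mat n n (\<lambda>ij. \<Sum>x\<in>X. s (Poly_Mapping.lookup f x) (\<rho> x $$ ij))"
proof -
  have "(\<Sum>x\<in>Poly_Mapping.keys f. s (Poly_Mapping.lookup f x) (\<rho> x $$ ij))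
      = (\<Sum>x\<in>X. s (Poly_Mapping.lookup f x) (\<rho> x $$ ij))" for ij
    using assms by (intro sum.mono_neutral_left) (auto simp: in_keys_iff s_zero)
  then show ?thesis by (simp add: lin_def)
qed

lemma lin_add: "lin (f + g) = lin f + lin g"
proof -
  let ?X = "Poly_Mapping.keys f \<union> Poly_Mapping.keys g"
  have "Poly_Mapping.keys (f + g) \<subseteq> ?X" by (rule keys_add)
  then have "lin (f + g) = mat n n (\<lambda>ij. \<Sum>x\<in>?X. s (Poly_Mapping.lookup (f + g) x) (\<rho> x $$ ij))"
    by (intro lin_superset) auto
  also have "\<dots> = lin f + lin g"
    by (subst (1 2) lin_superset[where X = ?X])
      (auto simp: lookup_add s_add sum.distrib intro!: eq_matI)
  finally show ?thesis .
qed

lemma lin_zero: "lin 0 = 0\<^sub>m n n"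
  by (rule eq_matI) (auto simp: lin_def)

lemma lin_scale: "lin (pm_scale c f) = map_mat (s c) (lin f)"
  by (subst lin_superset[where X = "Poly_Mapping.keys f"])
    (auto simp: keys_pm_scale lin_def s_sum s_s intro!: eq_matI)

lemma lin_single: "x \<in> paths Q \<Longrightarrow> lin (Poly_Mapping.single x c) = map_mat (s c) (\<rho> x)"
  using rho_carrier[of x] by (subst lin_superset[where X = "{x}"]) (auto intro!: eq_matI)

lemma map_mat_one: "map_mat (s 1) M = M"
  by (rule eq_matI) (auto simp: s_one)

lemma lin_one: "lin (\<Sum>v \<in> verts Q. Poly_Mapping.single (v, [], v) 1) = 1\<^sub>m n"
proof -
  have "lin (\<Sum>v \<in> V. Poly_Mapping.single (v, [], v) 1) $$ (i, j) = (\<Sum>v\<in>V. \<rho> (v, [], v) $$ (i, j))"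
    if "finite V" "V \<subseteq> verts Q" "i < n" "j < n" for V i j
    using that
  proof (induction V rule: finite_induct)
    case empty
    then show ?case by (simp add: lin_zero)
  next
    case (insert v V)
    have v: "(v, [], v) \<in> paths Q" using insert by (auto simp: mem_paths awalk_Nil_iff)
    show ?case using insert rho_carrier[OF v] by (simp add: lin_add lin_single[OF v] map_mat_one)
  qed
  from this[OF finite_verts subset_refl] show ?thesis
    by (intro eq_matI) (simp_all add: rho_one)
qed

lemma map_mat_s_mult:
  assumes "X \<in> carrier_mat n n" "Y \<in> carrier_mat n n"
  shows "map_mat (s c) X * map_mat (s d) Y = map_mat (s (c * d)) (X * Y)"
  using assms
  by (intro eq_matI) (auto simp: scalar_prod_def s_sum s_mult s_s mult.commute intro!: sum.cong)

lemma lin_mult: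
  assumes "f \<in> carrier PA" "g \<in> carrier PA"
  shows "lin (pmul f g) = lin f * lin g"
proof (induction f rule: poly_mapping_additive_induct)
  case zero
  show ?case by (simp add: lin_zero)
next
  case (add f1 f2)
  then show ?case by (simp add: pmul_add_left lin_add add_mult_distrib_mat[of _ n n _ _ n])
next
  case (single x)
  then have x: "x \<in> paths Q" using assms by (auto simp: path_algebra_simps)
  show ?case
  proof (induction g rule: poly_mapping_additive_induct)
    case zero
    show ?case by (simp add: lin_zero)
  next
    case (add g1 g2)
    then show ?case by (simp add: pmul_add_right lin_add mult_add_distrib_mat[of _ n n _ n])
  next
    case (single y)
    then have y: "y \<in> paths Q" using assms by (auto simp: path_algebra_simps)
    obtain u p v u' q v' where xy: "x = (u, p, v)" "y = (u', q, v')" by (cases x; cases y)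
    show ?case
    proof (cases "v' = u")
      case True
      then have "(u', q @ p, v) \<in> paths Q" using x y unfolding xy by (auto intro: paths_append)
      then show ?thesis
        using True x y rho_mult[of u p v u' q v']
        by (simp add: lin_single xy pmul_single' map_mat_s_mult rho_carrier)
    next
      case False
      have "map_mat (s c) (0\<^sub>m n n) = 0\<^sub>m n n" for c
        by (rule eq_matI) (auto simp: s_zero)
      then show ?thesis
        using False x y rho_mult[of u p v u' q v']
        by (simp add: lin_single xy pmul_single' map_mat_s_mult rho_carrier lin_zero)
    qed
  qed
qed

text \<open>Minimality of the generated ideal is applied to this one: it contains the differences of
  related paths, hence all of \<open>rel_ideal\<close>.\<close>

lemma kernel_ideal: "ideal {f \<in> carrier PA. lin f = 0\<^sub>m n n} PA"
proof (rule idealI[OF ring_path_algebra])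
  have inv: "\<ominus>\<^bsub>PA\<^esub> f = pm_scale (-1) f" if "f \<in> carrier PA" for f
  proof (rule PA.minus_equality)
    show "pm_scale (- 1) f \<oplus>\<^bsub>PA\<^esub> f = \<zero>\<^bsub>PA\<^esub>"
      by (rule poly_mapping_eqI) (simp add: path_algebra_simps lookup_add)
  qed (use that in \<open>auto simp: keys_scale_carrier\<close>)
  show "subgroup {f \<in> carrier PA. lin f = 0\<^sub>m n n} (add_monoid PA)"
  proof (rule group.subgroupI)
    show "group (add_monoid PA)" by (rule PA.a_group)
    show "{f \<in> carrier PA. lin f = 0\<^sub>m n n} \<noteq> {}"
      by (auto simp: path_algebra_simps lin_zero intro!: exI[of _ 0])
    fix f assume f: "f \<in> {f \<in> carrier PA. lin f = 0\<^sub>m n n}"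
    have "map_mat (s (-1)) (0\<^sub>m n n) = 0\<^sub>m n n"
      by (rule eq_matI) (auto simp: s_zero)
    then show "inv\<^bsub>add_monoid PA\<^esub> f \<in> {f \<in> carrier PA. lin f = 0\<^sub>m n n}"
      using f inv[of f] by (auto simp: lin_scale keys_scale_carrier simp flip: a_inv_def)
  qed (auto simp: path_algebra_simps(5) keys_add_carrier lin_add)
next
  fix f g assume "f \<in> {f \<in> carrier PA. lin f = 0\<^sub>m n n}" "g \<in> carrier PA"
  then show "g \<otimes>\<^bsub>PA\<^esub> f \<in> {f \<in> carrier PA. lin f = 0\<^sub>m n n}"
    "f \<otimes>\<^bsub>PA\<^esub> g \<in> {f \<in> carrier PA. lin f = 0\<^sub>m n n}"
    by (auto simp: path_algebra_simps(2) pmul_closed lin_mult)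
qed

lemma rel_ideal_kernel: "f \<in> rel_ideal \<Longrightarrow> lin f = 0\<^sub>m n n"
proof -
  have "gens \<subseteq> {f \<in> carrier PA. lin f = 0\<^sub>m n n}"
  proof
    fix f :: "('v, 'e) path \<Rightarrow>\<^sub>0 complex" assume "f \<in> gens"
    then obtain x y where f: "f = Poly_Mapping.single x 1 - Poly_Mapping.single y 1" "(x, y) \<in> R" by auto
    have xy: "x \<in> paths Q" "y \<in> paths Q" using f relations by auto
    have "f = Poly_Mapping.single x 1 + Poly_Mapping.single y (-1)"
      by (simp add: f single_uminus)
    then have "lin f = \<rho> x + map_mat (s (-1)) (\<rho> x)"
      using xy rho_rel[OF f(2)] by (simp add: lin_add lin_single map_mat_one)
    also have "\<dots> = 0\<^sub>m n n"
      using rho_carrier[OF xy(1)] s_add(2)[of 1 "-1"]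
      by (intro eq_matI) (auto simp: s_one s_zero)
    finally show "f \<in> {f \<in> carrier PA. lin f = 0\<^sub>m n n}"
      using subsetD[OF gens_carrier \<open>f \<in> gens\<close>] by blast
  qed
  then show "f \<in> rel_ideal \<Longrightarrow> lin f = 0\<^sub>m n n"
    unfolding rel_ideal_def using PA.genideal_minimal[OF kernel_ideal] by blast
qed

text \<open>Any representative serves, since \<open>lin\<close> vanishes on
  \<open>rel_ideal\<close>.\<close>

definition "rep C = lin (SOME f. f \<in> C)"

lemma rep_cls:
  assumes "f \<in> carrier PA"
  shows "rep (cls f) = lin f"
proof -
  have "(SOME g. g \<in> cls f) \<in> cls f" by (rule someI[of _ f]) (rule self_cls[OF assms])
  then obtain i where "i \<in> rel_ideal" "(SOME g. g \<in> cls f) = i + f" by (auto simp: mem_cls)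
  then show ?thesis by (simp add: rep_def lin_add rel_ideal_kernel)
qed

lemma rep_pcls: "x \<in> paths Q \<Longrightarrow> rep (pcls x) = \<rho> x"
  by (simp add: rep_cls single_carrier lin_single map_mat_one)

lemma free_bimodule_rep: "free_bimodule A s (n, rep)"
  unfolding free_bimodule_iff
  by (auto simp: quot_simps rep_cls pmul_closed keys_add_carrier keys_scale_carrier one_closed
      lin_mult lin_add lin_one lin_scale)

end

section \<open>A criterion for wildness\<close>

text \<open>
  Every vertex carries a free module of rank \<open>m\<close>, and an arrow \<open>e\<close> acts by \<open>X ^ wa e * Y ^ wb e\<close>.
\<close>

locale weighted_quiver = quiver_relations Q R + calg s
  for Q :: "('v, 'e) pre_digraph" and R and s :: "complex \<Rightarrow> 'b \<Rightarrow> 'b::ring_1" +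
  fixes wa wb :: "'e \<Rightarrow> nat" and ix :: "'v \<Rightarrow> nat" and m :: nat and X Y :: "'b mat"
  assumes ix: "bij_betw ix (verts Q) {..<card (verts Q)}"
    and XY: "X \<in> carrier_mat m m" "Y \<in> carrier_mat m m" "X * Y = Y * X"
    and homogeneous: "\<And>u p v u' p' v'. ((u, p, v), (u', p', v')) \<in> R \<Longrightarrow> u = u' \<and> v = v' \<and>
      sum_list (map wa p) = sum_list (map wa p') \<and> sum_list (map wb p) = sum_list (map wb p')"
begin

abbreviation "K \<equiv> card (verts Q)"

text \<open>The tensor product of a matrix unit with \<open>Z\<close>. The row belongs to the end
  \<open>v\<close> and the column to the start \<open>u\<close>, in agreement with products written
  as compositions.\<close>

definition "blockunit v u Z = mat (K * m) (K * m)
  (\<lambda>(i, j). if i div m = ix v \<and> j div m = ix u then Z $$ (i mod m, j mod m) else 0)"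

definition "xypow a b = X ^\<^sub>m a * Y ^\<^sub>m b"

lemma xypow_carrier [simp]: "xypow a b \<in> carrier_mat m m"
  using XY by (auto simp: xypow_def intro!: mult_carrier_mat pow_carrier_mat)

lemma pow_commute:
  assumes "U \<in> carrier_mat m m" "V \<in> carrier_mat m m" "U * V = V * U"
  shows "U * V ^\<^sub>m b = V ^\<^sub>m b * U"
proof (induction b)
  case 0
  then show ?case using assms by simp
next
  case (Suc b)
  have c: "V ^\<^sub>m b \<in> carrier_mat m m" using assms by simp
  show ?case
    using assoc_mult_mat[OF assms(1) c assms(2)] assoc_mult_mat[OF c assms(1) assms(2)]
      assoc_mult_mat[OF c assms(2) assms(1)] assms(3) Suc.IH by simp
qed

lemma pow_add: "U \<in> carrier_mat m m \<Longrightarrow> U ^\<^sub>m (a + b) = U ^\<^sub>m a * U ^\<^sub>m b" for U :: "'b mat"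
proof (induction b)
  case (Suc b)
  then show ?case
    using assoc_mult_mat[of "U ^\<^sub>m a" m m "U ^\<^sub>m b" m U m] by simp
qed simp

lemma xypow_mult: "xypow a b * xypow a' b' = xypow (a + a') (b + b')"
proof -
  let ?p = "X ^\<^sub>m a" and ?q = "Y ^\<^sub>m b" and ?p' = "X ^\<^sub>m a'" and ?q' = "Y ^\<^sub>m b'"
  have c: "?p \<in> carrier_mat m m" "?q \<in> carrier_mat m m" "?p' \<in> carrier_mat m m" "?q' \<in> carrier_mat m m"
    using XY by simp_all
  have "X * ?q = ?q * X" using XY by (intro pow_commute) auto
  then have "?q * ?p' = ?p' * ?q"
    using XY c by (intro pow_commute) auto
  then show ?thesis
    unfolding xypow_def pow_add[OF XY(1)] pow_add[OF XY(2)]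
    using assoc_mult_mat[OF c(1) c(2) mult_carrier_mat[OF c(3) c(4)]]
      assoc_mult_mat[OF c(2) c(3) c(4)] assoc_mult_mat[OF c(3) c(2) c(4)]
      assoc_mult_mat[OF c(1) c(3) mult_carrier_mat[OF c(2) c(4)]] by argo
qed

lemma ix_less: "v \<in> verts Q \<Longrightarrow> ix v < K"
  using ix by (auto simp: bij_betw_def)

lemma ix_inject: "u \<in> verts Q \<Longrightarrow> v \<in> verts Q \<Longrightarrow> ix u = ix v \<longleftrightarrow> u = v"
  using ix by (auto simp: bij_betw_def inj_on_def)

lemma ix_surj: "k < K \<Longrightarrow> \<exists>v\<in>verts Q. ix v = k"
  using bij_betw_imp_surj_on[OF ix] by (metis imageE lessThan_iff)

lemma blockunit_carrier [simp]: "blockunit v u Z \<in> carrier_mat (K * m) (K * m)"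
  by (simp add: blockunit_def)

lemma blockunit_mult:
  assumes "u \<in> verts Q" "v' \<in> verts Q" "Z \<in> carrier_mat m m" "Z' \<in> carrier_mat m m"
  shows "blockunit v u Z * blockunit v' u' Z'
    = (if u = v' then blockunit v u' (Z * Z') else 0\<^sub>m (K * m) (K * m))"
proof (rule eq_matI)
  fix i j assume "i < dim_row (if u = v' then blockunit v u' (Z * Z') else 0\<^sub>m (K * m) (K * m))"
    "j < dim_col (if u = v' then blockunit v u' (Z * Z') else 0\<^sub>m (K * m) (K * m))"
  then have ij: "i < K * m" "j < K * m" by (simp_all add: blockunit_def split: if_splits)
  then have m: "i mod m < m" "j mod m < m" by (cases m; simp)+
  let ?f = "\<lambda>k q. (if i div m = ix v \<and> k = ix u then Z $$ (i mod m, q) else 0) *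
    (if k = ix v' \<and> j div m = ix u' then Z' $$ (q, j mod m) else 0)"
  have "(blockunit v u Z * blockunit v' u' Z') $$ (i, j) = (\<Sum>k<K * m. ?f (k div m) (k mod m))"
    using ij by (simp add: blockunit_def scalar_prod_def atLeast0LessThan)
  also have "\<dots> = (\<Sum>k<K. \<Sum>q<m. ?f k q)" by (rule sum_div_mod)
  also have "\<dots> = (\<Sum>k<K. if k = ix u then \<Sum>q<m. ?f (ix u) q else 0)"
    by (intro sum.cong) auto
  also have "\<dots> = (\<Sum>q<m. ?f (ix u) q)"
    using ix_less[OF assms(1)] by simp
  also have "\<dots> = (if u = v' then blockunit v u' (Z * Z') else 0\<^sub>m (K * m) (K * m)) $$ (i, j)"
    using ij assms m
    by (cases "i div m = ix v"; cases "j div m = ix u'")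
      (simp_all add: ix_inject blockunit_def scalar_prod_def atLeast0LessThan)
  finally show "(blockunit v u Z * blockunit v' u' Z') $$ (i, j)
    = (if u = v' then blockunit v u' (Z * Z') else 0\<^sub>m (K * m) (K * m)) $$ (i, j)" .
qed (auto simp: blockunit_def)

fun wrep :: "('v, 'e) path \<Rightarrow> 'b mat" where
  "wrep (u, p, v) = blockunit v u (xypow (sum_list (map wa p)) (sum_list (map wb p)))"

text \<open>Paths that do not compose multiply to zero because their matrix units do. Since
  \<open>X\<close> and \<open>Y\<close> commute, a path acts through its total weights alone, and
  homogeneous relations preserve these.\<close>

sublocale quiver_rep Q R s "K * m" wrep
proof
  fix x assume "x \<in> paths Q"
  then show "wrep x \<in> carrier_mat (K * m) (K * m)" by (cases x) simp
next
  fix u p v u' q v'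
  assume x: "(u, p, v) \<in> paths Q" "(u', q, v') \<in> paths Q"
  then have "u \<in> verts Q" "v' \<in> verts Q" by (auto simp: mem_paths)
  then show "wrep (u, p, v) * wrep (u', q, v') = (if v' = u then wrep (u', q @ p, v) else 0\<^sub>m (K * m) (K * m))"
    by (simp add: blockunit_mult xypow_mult add.commute)
next
  fix i j assume ij: "i < K * m" "j < K * m"
  then have m: "i mod m < m" "j mod m < m" by (cases m; simp)+
  have d: "i div m < K" "j div m < K" using ij by (simp_all add: less_mult_imp_div_less)
  obtain w where w: "w \<in> verts Q" "ix w = i div m" using ix_surj[OF d(1)] by auto
  have "(\<Sum>v\<in>verts Q. wrep (v, [], v) $$ (i, j))
      = (\<Sum>v\<in>verts Q. if v = w then if j div m = ix w \<and> i mod m = j mod m then 1 else 0 else 0)"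
  proof (rule sum.cong[OF refl])
    fix v assume v: "v \<in> verts Q"
    have "xypow 0 0 = 1\<^sub>m m" using XY by (simp add: xypow_def)
    then show "wrep (v, [], v) $$ (i, j)
        = (if v = w then if j div m = ix w \<and> i mod m = j mod m then 1 else 0 else 0)"
      using ij m v w by (auto simp: blockunit_def ix_inject w(2)[symmetric])
  qed
  also have "\<dots> = (if j div m = i div m \<and> i mod m = j mod m then 1 else 0)"
    using w finite_verts by simp
  also have "j div m = i div m \<and> i mod m = j mod m \<longleftrightarrow> i = j"
    by (metis div_mult_mod_eq)
  finally show "(\<Sum>v\<in>verts Q. wrep (v, [], v) $$ (i, j)) = (if i = j then 1 else 0)" .
next
  fix x y assume "(x, y) \<in> R"
  moreover obtain u p v u' p' v' where xy: "x = (u, p, v)" "y = (u', p', v')" by (cases x; cases y)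
  ultimately show "wrep x = wrep y" using homogeneous[of u p v u' p' v'] by simp
qed

lemma rep_arc:
  assumes "e \<in> arcs Q"
  shows "rep (pcls (tail Q e, [e], head Q e)) = blockunit (head Q e) (tail Q e) (xypow (wa e) (wb e))"
  using assms by (subst rep_pcls) (auto simp: mem_paths arc_implies_awalk)

lemma rep_vert:
  assumes "v \<in> verts Q"
  shows "rep (pcls (v, [], v)) = blockunit v v (1\<^sub>m m)"
  using assms XY by (subst rep_pcls) (auto simp: mem_paths awalk_Nil_iff xypow_def)

end

section \<open>The parameter algebras\<close>

interpretation poly_calg: calg "Polynomial.smult :: complex \<Rightarrow> complex poly \<Rightarrow> complex poly"
  by standard (simp_all add: smult_add_right smult_add_left)

interpretation free_calg: calg "pm_scale :: complex \<Rightarrow> free_algebra \<Rightarrow> free_algebra"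
proof
  have pm: "pm_scale c f = Poly_Mapping.single 0 c * f" for c and f :: free_algebra
    unfolding pm_scale_def by (rule mult_map_scale_conv_mult)
  \<comment> \<open>Scalars are multiples of the empty word, which is neutral on both sides; hence
    they are central although the letters do not commute.\<close>
  have comm: "f * Poly_Mapping.single 0 c = Poly_Mapping.single 0 c * f" for c and f :: free_algebra
    by (induction f rule: poly_mapping_additive_induct) (simp_all add: algebra_simps mult_single)
  fix c :: complex and a b :: free_algebra
  show "pm_scale c a * b = pm_scale c (a * b)" by (simp add: pm mult.assoc)
  show "a * pm_scale c b = pm_scale c (a * b)"
    unfolding pm by (simp add: comm flip: mult.assoc)
qed (simp_all add: pm_scale_simps)

definition gx :: free_algebra where "gx = Poly_Mapping.single (Word [True]) 1"
definition gy :: free_algebra where "gy = Poly_Mapping.single (Word [False]) 1"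

lemma free_algebra_induct [case_names one scale add gx gy]:
  fixes a :: free_algebra
  assumes one: "P 1" and scale: "\<And>c a. P a \<Longrightarrow> P (pm_scale c a)"
    and add: "\<And>a b. P a \<Longrightarrow> P b \<Longrightarrow> P (a + b)"
    and gx: "\<And>a. P a \<Longrightarrow> P (gx * a)" and gy: "\<And>a. P a \<Longrightarrow> P (gy * a)"
  shows "P a"
proof (induction a rule: poly_mapping_additive_induct)
  case zero
  show ?case using scale[OF one, of 0] by (simp add: pm_scale_simps)
next
  case (single w)
  have "P (Poly_Mapping.single (Word l) 1)" for l :: "bool list"
  proof (induction l)
    case Nil
    show ?case using one by (simp flip: zero_free_monoid_def)
  next
    case (Cons b l)
    have "Poly_Mapping.single (Word (b # l)) 1 = (if b then gx else gy) * Poly_Mapping.single (Word l) 1"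
      by (simp add: gx_def gy_def mult_single)
    then show ?case using gx[OF Cons.IH] gy[OF Cons.IH] by (cases b) auto
  qed
  from scale[OF this, of "Poly_Mapping.lookup a w" "case w of Word l \<Rightarrow> l"] show ?case
    by (cases w) (simp add: pm_scale_simps)
qed (rule add)

lemma free_module_intertwiner:
  assumes N: "fd_module free_alg N" and N': "fd_module free_alg N'" "fst N' = fst N"
    and f: "f \<in> carrier_mat (fst N) (fst N)"
    and gen: "f * snd N gx = snd N' gx * f" "f * snd N gy = snd N' gy * f"
  shows "f * snd N a = snd N' a * f"
proof -
  let ?d = "fst N"
  note N = N[unfolded free_alg_def] and N' = N'(1)[unfolded free_alg_def]
  note n = fd_module_type_alg[OF N] and n' = fd_module_type_alg[OF N', unfolded assms(3)]
  have mult: "f * snd N (a * b) = snd N' (a * b) * f"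
    if "f * snd N a = snd N' a * f" "f * snd N b = snd N' b * f" for a b
    unfolding n n'
    using assoc_mult_mat[OF f n(1)[of a] n(1)[of b]] assoc_mult_mat[OF n'(1)[of a] f n(1)[of b]]
      assoc_mult_mat[OF n'(1)[of a] n'(1)[of b] f] that by argo
  show ?thesis
  proof (induction a rule: free_algebra_induct)
    case one
    show ?case using f by (simp add: n n')
  next
    case (scale c a)
    then show ?case
      by (simp add: n n' map_mat_times_mult(2)[OF f n(1)] map_mat_times_mult(1)[OF n'(1) f])
  next
    case (add a b)
    then show ?case
      by (simp add: n n' mult_add_distrib_mat[OF f n(1) n(1)] add_mult_distrib_mat[OF n'(1) n'(1) f])
  qed (auto intro: mult gen)
qed

section \<open>The wild pair and its homomorphisms\<close>

definition wildX :: "free_algebra mat" where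
  "wildX = mat 4 4 (\<lambda>(i, j). if (i, j) = (1, 0) \<or> (i, j) = (3, 1) then 1 else if (i, j) = (3, 2) then gx else 0)"

definition wildY :: "free_algebra mat" where
  "wildY = mat 4 4 (\<lambda>(i, j). if (i, j) = (2, 0) then 1 else if (i, j) = (3, 1) then gx
    else if (i, j) = (3, 2) then gy else 0)"

lemma less_4: "(i::nat) < 4 \<longleftrightarrow> i = 0 \<or> i = 1 \<or> i = 2 \<or> i = 3"
  by auto

lemma sum_4: "(\<Sum>q<4. f q) = f 0 + f 1 + f 2 + f (3::nat)"
  by (simp add: eval_nat_numeral add.assoc)

lemma wildXY: "wildX \<in> carrier_mat 4 4" "wildY \<in> carrier_mat 4 4" "wildX * wildY = wildY * wildX"
proof -
  show c: "wildX \<in> carrier_mat 4 4" "wildY \<in> carrier_mat 4 4"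
    by (simp_all add: wildX_def wildY_def)
  show "wildX * wildY = wildY * wildX"
  proof (rule eq_matI)
    fix i j assume "i < dim_row (wildY * wildX)" "j < dim_col (wildY * wildX)"
    then have ij: "i < 4" "j < 4" using c by auto
    have "(wildX * wildY) $$ (i, j) = (\<Sum>q<4. wildX $$ (i, q) * wildY $$ (q, j))"
      "(wildY * wildX) $$ (i, j) = (\<Sum>q<4. wildY $$ (i, q) * wildX $$ (q, j))"
      using ij c by (simp_all add: scalar_prod_def atLeast0LessThan)
    then show "(wildX * wildY) $$ (i, j) = (wildY * wildX) $$ (i, j)"
      using ij by (auto simp: sum_4 wildX_def wildY_def less_4)
  qed (use c in auto)
qed

text \<open>What a quiver has to provide: weight zero arrows that link all vertices, and arrows
  acting by exactly \<open>wildX\<close> and exactly \<open>wildY\<close>. Connectedness is put as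
  an invariance principle because it is used to carry the equality of blocks from vertex to
  vertex.\<close>

locale wild_quiver = weighted_quiver Q R pm_scale wa wb ix 4 wildX wildY
  for Q :: "('v, 'e) pre_digraph" and R wa wb ix +
  assumes nonempty: "verts Q \<noteq> {}"
    and connected: "\<And>P u v. (\<And>e. e \<in> arcs Q \<Longrightarrow> wa e = 0 \<Longrightarrow> wb e = 0 \<Longrightarrow> P (tail Q e) \<longleftrightarrow> P (head Q e)) \<Longrightarrow>
      u \<in> verts Q \<Longrightarrow> v \<in> verts Q \<Longrightarrow> P u \<Longrightarrow> P v"
    and x_arc: "\<exists>e\<in>arcs Q. wa e = 1 \<and> wb e = 0" and y_arc: "\<exists>e\<in>arcs Q. wa e = 0 \<and> wb e = 1"
begin

definition "M = (K * 4, rep)"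

lemma M_bimodule: "free_bimodule A pm_scale M"
  unfolding M_def by (rule free_bimodule_rep)

lemma K_pos: "K > 0"
  using nonempty finite_verts by (simp add: card_gt_0_iff)

text \<open>The degrees 0, 1, 1, 2 of e0, e1, e2, e3, for which both \<open>wildX\<close> and
  \<open>wildY\<close> raise the degree by one.\<close>

definition height :: "nat \<Rightarrow> nat" where
  "height i = (if i mod 4 = 0 then 0 else if i mod 4 = 3 then 2 else 1)"

text \<open>The row of e0 at some vertex. As it has the least height, a triangular matrix has only
  its diagonal block in this row.\<close>

definition "base_row = ix (SOME v. v \<in> verts Q) * 4"

lemma base_row: "base_row < K * 4" "height base_row = 0"
  using ix_less[of "SOME v. v \<in> verts Q"] nonempty by (auto simp: base_row_def height_def some_in_eq)

text \<open>The trivial paths kill the blocks between different vertices, the weight zero arrows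
  identify the blocks at all vertices, and what remains is a four by four block matrix
  \<open>g\<close> that intertwines the two substitutions into \<open>wildX\<close> and into
  \<open>wildY\<close>.\<close>

lemma hom_structure:
  assumes N: "fd_module free_alg N" and N': "fd_module free_alg N'" and d: "fst N = d" "fst N' = d"
    and \<Phi>: "\<Phi> \<in> carrier_mat (K * 4 * d) (K * 4 * d)"
    and comm: "\<And>a. a \<in> carrier A \<Longrightarrow> \<Phi> * snd (tensor_mod M N) a = snd (tensor_mod M N') a * \<Phi>"
  shows "\<exists>f\<in>carrier_mat d d. (\<forall>a. f * snd N a = snd N' a * f) \<and>
    (\<forall>i<K * 4. blk d \<Phi> i i = opm f) \<and>
    (\<forall>i<K * 4. \<forall>j<K * 4. i \<noteq> j \<longrightarrow> blk d \<Phi> i j \<noteq> 0 \<longrightarrow> height j < height i)"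
proof -
  let ?F = "blk d \<Phi>" and ?E = "opm (1\<^sub>m d)"
  define \<nu> where "\<nu> a = opm (snd N a)" for a
  define \<nu>' where "\<nu>' a = opm (snd N' a)" for a
  note n = fd_module_type_alg[OF N[unfolded free_alg_def], unfolded d]
    and n' = fd_module_type_alg[OF N'[unfolded free_alg_def], unfolded d]
    and z = fd_module_type_alg_zero[OF N[unfolded free_alg_def], unfolded d]
      fd_module_type_alg_zero[OF N'[unfolded free_alg_def], unfolded d]
  have \<nu>: "\<nu> 0 = 0" "\<nu>' 0 = 0" "\<nu> 1 = ?E" "\<nu>' 1 = ?E"
    by (simp_all add: \<nu>_def \<nu>'_def z n n')
  have FE: "?F i j * ?E = ?F i j" "?E * ?F i j = ?F i j" for i j
    unfolding blk_def by (simp_all add: opm_one_left opm_one_right)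
  have T: "snd (tensor_mod M N) a \<in> carrier_mat (K * 4 * d) (K * 4 * d)"
    "snd (tensor_mod M N') a \<in> carrier_mat (K * 4 * d) (K * 4 * d)" for a
    by (simp_all add: tensor_mod_def Let_def M_def d)
  have eq: "(\<Sum>k<K * 4. ?F i k * \<nu> (rep a $$ (k, j))) = (\<Sum>k<K * 4. \<nu>' (rep a $$ (i, k)) * ?F k j)"
    if a: "a \<in> carrier A" and ij: "i < K * 4" "j < K * 4" for a i j
  proof -
    have "(\<Sum>k<K * 4. ?F i k * \<nu> (rep a $$ (k, j))) = blk d (\<Phi> * snd (tensor_mod M N) a) i j"
      using blk_tensor[OF N[unfolded free_alg_def], of _ M _ a] ij
      by (subst blk_mult[OF \<Phi> T(1)]) (auto simp: M_def d \<nu>_def)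
    also have "\<dots> = (\<Sum>k<K * 4. \<nu>' (rep a $$ (i, k)) * ?F k j)"
      unfolding comm[OF a] using blk_tensor[OF N'[unfolded free_alg_def], of _ M _ a] ij
      by (subst blk_mult[OF T(2) \<Phi>]) (auto simp: M_def d \<nu>'_def)
    finally show ?thesis .
  qed
  \<comment> \<open>Compare the entries \<open>(i, j)\<close> for the trivial path at the vertex of
    column \<open>j\<close>: on the left only \<open>?F i j\<close> survives, and on the right
    nothing, since row \<open>i\<close> lies at another vertex.\<close>
  have offdiag: "?F i j = 0" if ij: "i < K * 4" "j < K * 4" "i div 4 \<noteq> j div 4" for i j
  proof -
    obtain u where u: "u \<in> verts Q" "ix u = j div 4"
      using ix_surj[of "j div 4"] ij by (auto simp: less_mult_imp_div_less)
    have p: "pcls (u, [], u) \<in> carrier A"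
      using u by (intro pcls_carrier) (auto simp: mem_paths awalk_Nil_iff)
    have "\<nu> (rep (pcls (u, [], u)) $$ (k, j)) = (if k = j then ?E else 0)" if "k < K * 4" for k
    proof -
      have "k div 4 = j div 4 \<and> k mod 4 = j mod 4 \<longleftrightarrow> k = j" by (metis div_mult_mod_eq)
      then show ?thesis
        unfolding rep_vert[OF u(1)] blockunit_def using that ij u by (auto simp: \<nu>)
    qed
    then have "(\<Sum>k<K * 4. ?F i k * \<nu> (rep (pcls (u, [], u)) $$ (k, j)))
        = (\<Sum>k<K * 4. if k = j then ?F i k else 0)"
      by (intro sum.cong) (auto simp: FE)
    moreover have "\<nu>' (rep (pcls (u, [], u)) $$ (i, k)) = 0" if "k < K * 4" for k
      unfolding rep_vert[OF u(1)] blockunit_def using that ij u by (auto simp: \<nu>)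
    ultimately show ?thesis using eq[OF p ij(1,2)] ij by simp
  qed
  define \<psi> where "\<psi> v r t = ?F (ix v * 4 + r) (ix v * 4 + t)" for v r t
  have arc: "(\<Sum>q<4. \<psi> (head Q e) r q * \<nu> (xypow (wa e) (wb e) $$ (q, t)))
      = (\<Sum>q<4. \<nu>' (xypow (wa e) (wb e) $$ (r, q)) * \<psi> (tail Q e) q t)"
    if e: "e \<in> arcs Q" and rt: "r < 4" "t < 4" for e r t
  proof -
    let ?u = "tail Q e" and ?v = "head Q e" and ?Z = "xypow (wa e) (wb e)"
    have uv: "?u \<in> verts Q" "?v \<in> verts Q" using e by auto
    have p: "pcls (?u, [e], ?v) \<in> carrier A"
      using e by (intro pcls_carrier) (auto simp: mem_paths arc_implies_awalk)
    have ij: "ix ?v * 4 + r < K * 4" "ix ?u * 4 + t < K * 4"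
      using ix_less[OF uv(1)] ix_less[OF uv(2)] rt by (auto intro: block_index_less)
    let ?i = "ix ?v * 4 + r" and ?j = "ix ?u * 4 + t"
    have "(\<Sum>k<K * 4. ?F ?i k * \<nu> (rep (pcls (?u, [e], ?v)) $$ (k, ?j)))
        = (\<Sum>k<K * 4. ?F ?i (k div 4 * 4 + k mod 4) *
             (if k div 4 = ix ?v then \<nu> (?Z $$ (k mod 4, t)) else 0))"
      unfolding rep_arc[OF e] blockunit_def using ij rt by (intro sum.cong) (auto simp: \<nu>)
    also have "\<dots> = (\<Sum>k<K. \<Sum>q<4. ?F ?i (k * 4 + q) * (if k = ix ?v then \<nu> (?Z $$ (q, t)) else 0))"
      by (rule sum_div_mod)
    also have "\<dots> = (\<Sum>k<K. if k = ix ?v then \<Sum>q<4. ?F ?i (ix ?v * 4 + q) * \<nu> (?Z $$ (q, t)) else 0)"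
      by (intro sum.cong) auto
    also have "\<dots> = (\<Sum>q<4. \<psi> ?v r q * \<nu> (?Z $$ (q, t)))"
      using ix_less[OF uv(2)] by (simp add: \<psi>_def)
    finally have 1: "(\<Sum>k<K * 4. ?F ?i k * \<nu> (rep (pcls (?u, [e], ?v)) $$ (k, ?j)))
      = (\<Sum>q<4. \<psi> ?v r q * \<nu> (?Z $$ (q, t)))" .
    have "(\<Sum>k<K * 4. \<nu>' (rep (pcls (?u, [e], ?v)) $$ (?i, k)) * ?F k ?j)
        = (\<Sum>k<K * 4. (if k div 4 = ix ?u then \<nu>' (?Z $$ (r, k mod 4)) else 0) *
             ?F (k div 4 * 4 + k mod 4) ?j)"
      unfolding rep_arc[OF e] blockunit_def using ij rt by (intro sum.cong) (auto simp: \<nu>)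
    also have "\<dots> = (\<Sum>k<K. \<Sum>q<4. (if k = ix ?u then \<nu>' (?Z $$ (r, q)) else 0) * ?F (k * 4 + q) ?j)"
      by (rule sum_div_mod)
    also have "\<dots> = (\<Sum>k<K. if k = ix ?u then \<Sum>q<4. \<nu>' (?Z $$ (r, q)) * ?F (ix ?u * 4 + q) ?j else 0)"
      by (intro sum.cong) auto
    also have "\<dots> = (\<Sum>q<4. \<nu>' (?Z $$ (r, q)) * \<psi> ?u q t)"
      using ix_less[OF uv(1)] by (simp add: \<psi>_def)
    finally show ?thesis using 1 eq[OF p ij] by simp
  qed
  have \<psi>E: "\<psi> v r t * ?E = \<psi> v r t" "?E * \<psi> v r t = \<psi> v r t" for v r t
    by (simp_all add: \<psi>_def FE)
  define v0 where "v0 = (SOME v. v \<in> verts Q)"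
  have v0: "v0 \<in> verts Q" using nonempty by (simp add: v0_def some_in_eq)
  have same: "\<psi> v r t = \<psi> v0 r t" if v: "v \<in> verts Q" and rt: "r < 4" "t < 4" for v r t
  proof (rule connected[of "\<lambda>v. \<psi> v r t = \<psi> v0 r t" v0])
    fix e assume e: "e \<in> arcs Q" "wa e = 0" "wb e = 0"
    have 1: "xypow 0 0 = 1\<^sub>m 4" using XY by (simp add: xypow_def)
    have "\<psi> (head Q e) r t = \<psi> (tail Q e) r t"
      using arc[OF e(1) rt] rt by (auto simp: e 1 sum_4 less_4 \<nu> \<psi>E)
    then show "\<psi> (tail Q e) r t = \<psi> v0 r t \<longleftrightarrow> \<psi> (head Q e) r t = \<psi> v0 r t" by simp
  qed (use v v0 in auto)
  define g where "g = \<psi> v0"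
  have gE: "g r t * ?E = g r t" "?E * g r t = g r t" for r t by (simp_all add: g_def \<psi>E)
  obtain ex where ex: "ex \<in> arcs Q" "wa ex = 1" "wb ex = 0" using x_arc by auto
  obtain ey where ey: "ey \<in> arcs Q" "wa ey = 0" "wb ey = 1" using y_arc by auto
  have "xypow 1 0 = wildX" "xypow 0 1 = wildY"
    using XY by (simp_all add: xypow_def)
  then have gX: "(\<Sum>q<4. g r q * \<nu> (wildX $$ (q, t))) = (\<Sum>q<4. \<nu>' (wildX $$ (r, q)) * g q t)"
    and gY: "(\<Sum>q<4. g r q * \<nu> (wildY $$ (q, t))) = (\<Sum>q<4. \<nu>' (wildY $$ (r, q)) * g q t)"
    if "r < 4" "t < 4" for r t
    using arc[OF ex(1) that] arc[OF ey(1) that] ex ey that same[of "head Q ex"] same[of "tail Q ex"]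
      same[of "head Q ey"] same[of "tail Q ey"] by (simp_all add: g_def sum_4)
  \<comment> \<open>Column 0 of \<open>wildX\<close> is e1, so entry \<open>(r, 0)\<close> has
    \<open>g r 1\<close> on the left, and nothing on the right when row \<open>r\<close> of
    \<open>wildX\<close> is zero. The other entries are chosen likewise; \<open>(3, 2)\<close> for
    both matrices leaves the commutation of \<open>g 0 0\<close> with the two generators.\<close>
  have ex: "g r 1 = 0" if "r = 0 \<or> r = 2" for r
    using gX[of r 0] that by (auto simp: sum_4 wildX_def \<nu> gE)
  have "g 1 1 = g 0 0"
    using gX[of 1 0] by (simp add: sum_4 wildX_def \<nu> gE)
  moreover have "g 0 3 = 0" "g 2 3 = 0"
    using gX[of 0 1] gX[of 2 1] by (simp_all add: sum_4 wildX_def \<nu> gE)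
  moreover have "g 1 3 = g 0 1" "g 3 3 = g 1 1 + \<nu>' gx * g 2 1" "g 3 3 * \<nu> gx = g 1 2 + \<nu>' gx * g 2 2"
    using gX[of 1 1] gX[of 3 1] gX[of 3 2] by (simp_all add: sum_4 wildX_def \<nu> gE)
  moreover have "g 0 2 = 0" "g 1 2 = 0" "g 2 2 = g 0 0" "g 3 3 * \<nu> gy = \<nu>' gx * g 1 2 + \<nu>' gy * g 2 2"
    using gY[of 0 0] gY[of 1 0] gY[of 2 0] gY[of 3 2] by (simp_all add: sum_4 wildY_def \<nu> gE)
  ultimately have diag: "g 1 1 = g 0 0" "g 2 2 = g 0 0" "g 3 3 = g 0 0"
    and tri: "g 0 1 = 0" "g 0 2 = 0" "g 0 3 = 0" "g 1 2 = 0" "g 1 3 = 0" "g 2 1 = 0" "g 2 3 = 0"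
    and hom: "g 0 0 * \<nu> gx = \<nu>' gx * g 0 0" "g 0 0 * \<nu> gy = \<nu>' gy * g 0 0"
    using ex by simp_all
  define f where "f = mat d d (\<lambda>(p, q). \<Phi> $$ (ix v0 * 4 * d + p, ix v0 * 4 * d + q))"
  have f: "f \<in> carrier_mat d d" "opm f = g 0 0"
    by (simp_all add: f_def g_def \<psi>_def blk_def)
  have f_gen: "f * snd N x = snd N' x * f" if "g 0 0 * \<nu> x = \<nu>' x * g 0 0" for x
  proof -
    have "opm (f * snd N x) = opm (snd N' x * f)"
      using that f n(1)[of x] n'(1)[of x] by (simp add: opm_mult \<nu>_def \<nu>'_def)
    then show ?thesis
      by (rule opm_inject_carrier) (use f n(1)[of x] n'(1)[of x] in auto)
  qed
  have inter: "f * snd N a = snd N' a * f" for a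
    by (rule free_module_intertwiner[OF N N'])
      (use d f(1) f_gen[OF hom(1)] f_gen[OF hom(2)] in simp_all)
  have F: "?F i j = g (i mod 4) (j mod 4)" if ij: "i < K * 4" "j < K * 4" "i div 4 = j div 4" for i j
  proof -
    obtain v where v: "v \<in> verts Q" "ix v = j div 4"
      using ix_surj[of "j div 4"] ij by (auto simp: less_mult_imp_div_less)
    have "ix v * 4 + i mod 4 = i" "ix v * 4 + j mod 4 = j"
      using v(2) ij(3) by (metis div_mult_mod_eq)+
    then have "?F i j = \<psi> v (i mod 4) (j mod 4)" by (simp add: \<psi>_def)
    then show ?thesis using same[OF v(1)] by (simp add: g_def)
  qed
  have gd: "g r r = g 0 0" if "r < 4" for r
    using that diag by (auto simp: less_4)
  have ht: "height j < height i"
    if ij: "i < K * 4" "j < K * 4" "i \<noteq> j" "?F i j \<noteq> 0" for i j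
  proof -
    have dv: "i div 4 = j div 4" using offdiag ij by blast
    then have "i mod 4 \<noteq> j mod 4" using ij(3) by (metis div_mult_mod_eq)
    moreover have "g (i mod 4) (j mod 4) \<noteq> 0" using F ij dv by simp
    moreover have "i mod 4 < 4" "j mod 4 < 4" by simp_all
    ultimately show ?thesis using tri unfolding less_4 height_def by auto
  qed
  show ?thesis
  proof (intro bexI[of _ f] conjI allI impI)
    show "?F i i = opm f" if "i < K * 4" for i
      using F[OF that that] gd[of "i mod 4"] f(2) by simp
  qed (use inter ht f(1) in blast)+
qed

text \<open>A nilpotent idempotent is zero: by \<open>\<Phi> = \<Phi> * \<Phi>\<close> a nonzero
  block factors through arbitrarily many blocks, each of which raises the height, while heights are
  bounded.\<close>

lemma strictly_triangular_idempotent: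
  assumes \<Phi>: "\<Phi> \<in> carrier_mat (K * 4 * d) (K * 4 * d)" "\<Phi> * \<Phi> = \<Phi>"
    and tri: "\<And>i j. i < K * 4 \<Longrightarrow> j < K * 4 \<Longrightarrow> blk d \<Phi> i j \<noteq> 0 \<Longrightarrow> height j < height i"
  shows "\<Phi> = 0\<^sub>m (K * 4 * d) (K * 4 * d)"
proof -
  have high: "height j + m \<le> height i" if "i < K * 4" "j < K * 4" "blk d \<Phi> i j \<noteq> 0" for i j m
    using that
  proof (induction m arbitrary: i j)
    case 0
    then show ?case using tri[of i j] by simp
  next
    case (Suc m)
    have "blk d \<Phi> i j = (\<Sum>k<K * 4. blk d \<Phi> i k * blk d \<Phi> k j)"
      using blk_mult[OF \<Phi>(1) \<Phi>(1) Suc.prems(1,2)] unfolding \<Phi>(2) .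
    then have "(\<Sum>k<K * 4. blk d \<Phi> i k * blk d \<Phi> k j) \<noteq> 0"
      using Suc.prems(3) by simp
    then obtain k where k: "k < K * 4" "blk d \<Phi> i k * blk d \<Phi> k j \<noteq> 0"
      by (rule sum.not_neutral_contains_not_neutral) simp
    then have "blk d \<Phi> i k \<noteq> 0" "blk d \<Phi> k j \<noteq> 0" by auto
    then show ?case using Suc.IH[of k j] tri[of i k] Suc.prems k(1) by simp
  qed
  show ?thesis
  proof (rule blk_eqI[OF \<Phi>(1)])
    fix i j assume ij: "i < K * 4" "j < K * 4"
    have "blk d \<Phi> i j = 0" using high[OF ij, of "Suc (height i)"] by auto
    moreover have "mat d d (\<lambda>(p, q). 0\<^sub>m (K * 4 * d) (K * 4 * d) $$ (i * d + p, j * d + q)) = (0\<^sub>m d d :: complex mat)"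
      using ij by (intro eq_matI) (auto simp: block_index_less)
    ultimately show "blk d \<Phi> i j = blk d (0\<^sub>m (K * 4 * d) (K * 4 * d)) i j"
      by (simp add: blk_def[of _ "0\<^sub>m (K * 4 * d) (K * 4 * d)"])
  qed simp
qed

text \<open>This makes the passage from a homomorphism to its diagonal block \<open>f\<close>
  multiplicative: in the sum for the product only the term \<open>k = base_row\<close>
  survives.\<close>

lemma blk_mult_base:
  assumes "\<Phi> \<in> carrier_mat (K * 4 * d) (K * 4 * d)" "\<Psi> \<in> carrier_mat (K * 4 * d) (K * 4 * d)"
    and tri: "\<And>i j. i < K * 4 \<Longrightarrow> j < K * 4 \<Longrightarrow> i \<noteq> j \<Longrightarrow> blk d \<Phi> i j \<noteq> 0 \<Longrightarrow> height j < height i"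
  shows "blk d (\<Phi> * \<Psi>) base_row base_row = blk d \<Phi> base_row base_row * blk d \<Psi> base_row base_row"
proof -
  have "blk d (\<Phi> * \<Psi>) base_row base_row = (\<Sum>k<K * 4. blk d \<Phi> base_row k * blk d \<Psi> k base_row)"
    using base_row assms by (intro blk_mult) auto
  also have "\<dots> = (\<Sum>k<K * 4. if k = base_row then blk d \<Phi> k k * blk d \<Psi> k k else 0)"
    using tri[OF base_row(1)] base_row(2) by (intro sum.cong refl) fastforce
  finally show ?thesis using base_row by simp
qed

text \<open>The inverse of an isomorphism is a homomorphism in the other direction, so it has a
  diagonal block as well. By multiplicativity the two diagonal blocks are inverse to each
  other.\<close>

lemma reflects_iso:
  assumes N: "fd_module free_alg N" and N': "fd_module free_alg N'"
    and iso: "mod_iso A (tensor_mod M N) (tensor_mod M N')"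
  shows "mod_iso free_alg N N'"
proof -
  define d where "d = fst N"
  let ?n = "K * 4 * d"
  obtain P where P: "P \<in> carrier_mat ?n ?n" "invertible_mat P" and n: "?n = K * 4 * fst N'"
    and Pa: "\<And>a. a \<in> carrier A \<Longrightarrow> P * snd (tensor_mod M N) a = snd (tensor_mod M N') a * P"
    using iso by (auto simp: mod_iso_def M_def d_def tensor_mod_def Let_def)
  have d': "fst N' = d" using n K_pos by simp
  obtain V where PV: "P * V = 1\<^sub>m ?n" and VP: "V * P = 1\<^sub>m (dim_row V)"
    using P by (auto simp: invertible_mat_def inverts_mat_def)
  have V: "V \<in> carrier_mat ?n ?n"
    using arg_cong[OF PV, of dim_col] arg_cong[OF VP, of dim_col] P by auto
  then have VP: "V * P = 1\<^sub>m ?n" using VP by simp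
  have T: "snd (tensor_mod M N) a \<in> carrier_mat ?n ?n" "snd (tensor_mod M N') a \<in> carrier_mat ?n ?n" for a
    by (simp_all add: tensor_mod_def Let_def M_def d_def d'[unfolded d_def])
  have Va: "V * snd (tensor_mod M N') a = snd (tensor_mod M N) a * V" if a: "a \<in> carrier A" for a
  proof -
    let ?T = "snd (tensor_mod M N) a" and ?T' = "snd (tensor_mod M N') a"
    have "opm ?T' * opm (1\<^sub>m ?n) = opm ?T'" "opm (1\<^sub>m ?n) * opm ?T = opm ?T"
      using T[of a] by (simp_all add: opm_one_left opm_one_right)
    moreover have "opm P * opm V = opm (1\<^sub>m ?n)" "opm V * opm P = opm (1\<^sub>m ?n)"
      using P V PV VP by (simp_all flip: opm_mult)
    moreover have "opm P * opm ?T = opm ?T' * opm P"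
      using Pa[OF a] P T[of a] by (simp flip: opm_mult)
    ultimately have "opm V * opm ?T' = opm ?T * opm V"
      by (metis mult.assoc)
    then have "opm (V * ?T') = opm (?T * V)"
      using V T[of a] by (simp add: opm_mult)
    then show ?thesis by (rule opm_inject_carrier) (use V T[of a] in auto)
  qed
  from hom_structure[OF N N' d_def[symmetric] d' P(1) Pa] obtain f where
    f: "f \<in> carrier_mat d d" "\<And>a. f * snd N a = snd N' a * f" "\<forall>i<K * 4. blk d P i i = opm f"
      "\<forall>i<K * 4. \<forall>j<K * 4. i \<noteq> j \<longrightarrow> blk d P i j \<noteq> 0 \<longrightarrow> height j < height i" by blast
  from hom_structure[OF N' N d' d_def[symmetric] V Va] obtain g where
    g: "g \<in> carrier_mat d d" "\<forall>i<K * 4. blk d V i i = opm g"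
      "\<forall>i<K * 4. \<forall>j<K * 4. i \<noteq> j \<longrightarrow> blk d V i j \<noteq> 0 \<longrightarrow> height j < height i" by blast
  have "opm f * opm g = opm (1\<^sub>m d)"
    using blk_mult_base[OF P(1) V] f g base_row by (simp add: PV blk_one)
  then have fg: "f * g = 1\<^sub>m d"
    using f g by (intro opm_inject_carrier[of _ _ d d]) (auto simp: opm_mult)
  have "opm g * opm f = opm (1\<^sub>m d)"
    using blk_mult_base[OF V P(1)] f g base_row by (simp add: VP blk_one)
  then have gf: "g * f = 1\<^sub>m d"
    using f g by (intro opm_inject_carrier[of _ _ d d]) (auto simp: opm_mult)
  have "invertible_mat f"
    using f(1) g(1) fg gf by (auto simp: invertible_mat_def inverts_mat_def intro!: exI[of _ g])
  then show ?thesis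
    using f d' by (auto simp: mod_iso_def d_def)
qed

lemma preserves_indecomposable:
  assumes N: "indecomposable free_alg N"
  shows "indecomposable A (tensor_mod M N)"
proof (rule indecomposableI)
  have fd: "fd_module free_alg N" using N by (simp add: indecomposable_def)
  define d where "d = fst N"
  let ?n = "K * 4 * d"
  have fT: "fst (tensor_mod M N) = ?n" by (simp add: tensor_mod_def Let_def M_def d_def)
  show "fd_module A (tensor_mod M N)"
    by (rule fd_module_tensor[OF M_bimodule fd[unfolded free_alg_def]])
  show "fst (tensor_mod M N) > 0"
    using N K_pos by (simp add: fT d_def indecomposable_def)
  fix P assume "P \<in> carrier_mat (fst (tensor_mod M N)) (fst (tensor_mod M N))"
    and PP: "P * P = P"
    and Pa: "\<And>a. a \<in> carrier A \<Longrightarrow> P * snd (tensor_mod M N) a = snd (tensor_mod M N) a * P"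
  then have P: "P \<in> carrier_mat ?n ?n" by (simp add: fT)
  have T: "snd (tensor_mod M N) a \<in> carrier_mat ?n ?n" for a
    by (simp add: tensor_mod_def Let_def M_def d_def)
  have zero_case: "\<Phi> = 0\<^sub>m ?n ?n"
    if \<Phi>: "\<Phi> \<in> carrier_mat ?n ?n" "\<Phi> * \<Phi> = \<Phi>" and 0: "blk d \<Phi> base_row base_row = 0"
      and comm: "\<And>a. a \<in> carrier A \<Longrightarrow> \<Phi> * snd (tensor_mod M N) a = snd (tensor_mod M N) a * \<Phi>" for \<Phi>
  proof -
    from hom_structure[OF fd fd d_def[symmetric] d_def[symmetric] \<Phi>(1) comm] obtain f where
      f: "\<forall>i<K * 4. blk d \<Phi> i i = opm f"
        "\<forall>i<K * 4. \<forall>j<K * 4. i \<noteq> j \<longrightarrow> blk d \<Phi> i j \<noteq> 0 \<longrightarrow> height j < height i" by blast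
    then have "\<forall>i<K * 4. blk d \<Phi> i i = 0" using 0 base_row by auto
    then show ?thesis
      using f(2) by (intro strictly_triangular_idempotent[OF \<Phi>]) metis
  qed
  from hom_structure[OF fd fd d_def[symmetric] d_def[symmetric] P Pa] obtain f where
    f: "f \<in> carrier_mat d d" "\<And>a. f * snd N a = snd N a * f" "\<forall>i<K * 4. blk d P i i = opm f"
      "\<forall>i<K * 4. \<forall>j<K * 4. i \<noteq> j \<longrightarrow> blk d P i j \<noteq> 0 \<longrightarrow> height j < height i" by blast
  have "opm f * opm f = opm f"
    using blk_mult_base[OF P P] f base_row by (simp add: PP)
  then have "f * f = f"
    using f(1) by (intro opm_inject_carrier[of _ _ d d]) (auto simp: opm_mult)
  then have "f = 0\<^sub>m d d \<or> f = 1\<^sub>m d"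
    using indecomposable_idempotent[OF N, of f] f(1,2) by (simp add: d_def)
  then have "P = 0\<^sub>m ?n ?n \<or> P = 1\<^sub>m ?n"
  proof
    assume "f = 0\<^sub>m d d"
    then have "blk d P base_row base_row = 0" using f(3) base_row by simp
    then show ?thesis using zero_case[OF P PP _ Pa] by simp
  next
    assume f1: "f = 1\<^sub>m d"
    \<comment> \<open>The complementary idempotent has zero diagonal blocks, so the case already
      settled shows that it vanishes.\<close>
    define S where "S = 1\<^sub>m ?n - P"
    define p e where "p = opm P" "e = opm (1\<^sub>m ?n)"
    have S: "S \<in> carrier_mat ?n ?n" "opm S = e - p"
      using P by (simp_all add: S_def p_e_def minus_carrier_mat opm_minus)
    have pe: "p * p = p" "p * e = p" "e * p = p" "e * e = e"
      using P PP by (simp_all add: p_e_def opm_one_left opm_one_right flip: opm_mult)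
    have "opm (S * S) = opm S"
      using S(1) by (simp add: opm_mult S(2) algebra_simps pe)
    then have SS: "S * S = S" by (rule opm_inject_carrier) (use S in auto)
    have Sa: "S * snd (tensor_mod M N) a = snd (tensor_mod M N) a * S" if a: "a \<in> carrier A" for a
    proof -
      let ?t = "opm (snd (tensor_mod M N) a)"
      have "e * ?t = ?t" "?t * e = ?t"
        using T[of a] by (simp_all add: p_e_def opm_one_left opm_one_right)
      moreover have "p * ?t = ?t * p"
        using Pa[OF a] P T[of a] by (simp add: p_e_def flip: opm_mult)
      ultimately have "opm (S * snd (tensor_mod M N) a) = opm (snd (tensor_mod M N) a * S)"
        using S(1) T[of a] by (simp add: opm_mult S(2) algebra_simps)
      then show ?thesis by (rule opm_inject_carrier) (use S T[of a] in auto)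
    qed
    have "blk d S base_row base_row = blk d (1\<^sub>m ?n) base_row base_row - blk d P base_row base_row"
    proof -
      have "mat d d (\<lambda>(p, q). S $$ (base_row * d + p, base_row * d + q))
        = mat d d (\<lambda>(p, q). 1\<^sub>m ?n $$ (base_row * d + p, base_row * d + q))
        - mat d d (\<lambda>(p, q). P $$ (base_row * d + p, base_row * d + q))"
        using P base_row(1) by (intro eq_matI) (auto simp: S_def block_index_less)
      then show ?thesis by (simp add: blk_def opm_minus)
    qed
    then have "blk d S base_row base_row = 0"
      using f(3) f1 base_row by (simp add: blk_one)
    from zero_case[OF S(1) SS this Sa] have "opm P = opm (1\<^sub>m ?n)"
      using S(2) by (simp add: p_e_def)
    then have "P = 1\<^sub>m ?n" by (rule opm_inject_carrier) (use P in auto)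
    then show ?thesis by simp
  qed
  then show "P = 0\<^sub>m (fst (tensor_mod M N)) (fst (tensor_mod M N)) \<or> P = 1\<^sub>m (fst (tensor_mod M N))"
    by (simp add: fT)
qed

lemma wild: "wild A"
  unfolding wild_def using M_bimodule preserves_indecomposable reflects_iso by blast

end

section \<open>The wild algebras\<close>

lemma wild_path_algebra_mod:
  fixes Q :: "('v, 'e) pre_digraph" and wa wb :: "'e \<Rightarrow> nat"
  assumes Q: "quiver_relations Q R"
    and homogeneous: "\<And>u p v u' p' v'. ((u, p, v), (u', p', v')) \<in> R \<Longrightarrow> u = u' \<and> v = v' \<and>
      sum_list (map wa p) = sum_list (map wa p') \<and> sum_list (map wb p) = sum_list (map wb p')"
    and nonempty: "verts Q \<noteq> {}"
    and connected: "\<And>P u v. (\<And>e. e \<in> arcs Q \<Longrightarrow> wa e = 0 \<Longrightarrow> wb e = 0 \<Longrightarrow> P (tail Q e) \<longleftrightarrow> P (head Q e)) \<Longrightarrow>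
      u \<in> verts Q \<Longrightarrow> v \<in> verts Q \<Longrightarrow> P u \<Longrightarrow> P v"
    and arcs: "\<exists>e\<in>arcs Q. wa e = 1 \<and> wb e = 0" "\<exists>e\<in>arcs Q. wa e = 0 \<and> wb e = 1"
  shows "wild (path_algebra_mod Q R)"
proof -
  interpret quiver_relations Q R by (rule Q)
  obtain ix where ix: "bij_betw ix (verts Q) {..<card (verts Q)}"
    using ex_bij_betw_finite_nat[OF finite_verts] by (auto simp: atLeast0LessThan)
  interpret wild_quiver Q R wa wb ix
    by unfold_locales (fact ix wildXY homogeneous nonempty connected arcs)+
  show ?thesis by (rule wild)
qed

section \<open>Cubes with removed vertices\<close>

lemma flip_flip [simp]: "flip c (flip c S) = S"
  by (auto simp: flip_def)

lemma flip_mem: "d \<in> flip c S \<longleftrightarrow> (if d = c then c \<notin> S else d \<in> S)"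
  by (auto simp: flip_def)

lemma flip_in_cube [simp]: "c < k \<Longrightarrow> flip c S \<in> cube_verts k \<longleftrightarrow> S \<in> cube_verts k"
  by (auto simp: cube_verts_def flip_def split: if_splits)

lemma cube_quiver_simps [simp]:
  "verts (cube_quiver k X) = cube_verts k - X"
  "tail (cube_quiver k X) = cube_tail" "head (cube_quiver k X) = cube_head"
  "Edge S c \<in> arcs (cube_quiver k X) \<longleftrightarrow> c < k \<and> S \<in> cube_verts k - X \<and> flip c S \<in> cube_verts k - X"
  "Loop S c \<in> arcs (cube_quiver k X) \<longleftrightarrow> c < k \<and> S \<in> cube_verts k - X \<and> flip c S \<in> X"
  by (auto simp: cube_quiver_def)

lemma quiver_relations_cube: "quiver_relations (cube_quiver k X) (path_equiv (cube_quiver k X))"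
proof
  fix e assume e: "e \<in> arcs (cube_quiver k X)"
  show "tail (cube_quiver k X) e \<in> verts (cube_quiver k X)"
    "head (cube_quiver k X) e \<in> verts (cube_quiver k X)"
    using e by (cases e; simp)+
next
  show "finite (verts (cube_quiver k X))" by (simp add: cube_verts_def)
qed (auto simp: path_equiv_def)

text \<open>A loop stands for the walk to the removed neighbor and back. Whatever its vertex,
  exactly one of these two steps deletes the element \<open>c\<close>, hence the weight 1.\<close>

fun descent :: "nat \<Rightarrow> cube_arrow \<Rightarrow> nat" where
  "descent c (Edge S d) = (if d = c \<and> c \<in> S then 1 else 0)"
| "descent c (Loop S d) = (if d = c then 1 else 0)"

text \<open>The endpoints and the number of arrows of color \<open>c\<close> determine how many of them lead downwards.\<close>

lemma count_color_seq:
  "pre_digraph.cas (cube_quiver k X) u p v \<Longrightarrow>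
    count (mset (color_seq p)) c + of_bool (c \<in> u) = 2 * sum_list (map (descent c) p) + of_bool (c \<in> v)"
proof (induction p arbitrary: u)
  case Nil
  then show ?case by (simp add: pre_digraph.cas.simps color_seq_def)
next
  case (Cons a p)
  then have IH: "count (mset (color_seq p)) c + of_bool (c \<in> cube_head a)
      = 2 * sum_list (map (descent c) p) + of_bool (c \<in> v)" and "u = cube_tail a"
    by (auto simp: pre_digraph.cas.simps)
  then show ?case
    by (cases a) (auto simp: color_seq_def flip_mem split: if_splits)
qed

lemma path_equiv_descent:
  assumes "((u, p, v), (u', p', v')) \<in> path_equiv (cube_quiver k X)"
  shows "sum_list (map (descent c) p) = sum_list (map (descent c) p')"
proof -
  have "pre_digraph.cas (cube_quiver k X) u p v" "pre_digraph.cas (cube_quiver k X) u p' v"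
    and m: "mset (color_seq p) = mset (color_seq p')"
    using assms by (auto simp: path_equiv_def paths_def pre_digraph.awalk_def)
  from count_color_seq[OF this(1), of c] count_color_seq[OF this(2), of c] show ?thesis
    unfolding m by simp
qed

text \<open>Induction on the number of coordinates in which \<open>S\<close> and \<open>T\<close>
  differ. If there are two of them, \<open>sep\<close> allows at least one of the two flips; if
  there is only one, its flip leads to \<open>T\<close> itself, which is not removed.\<close>

lemma cube_connected:
  assumes sep: "\<And>S c d. c < k \<Longrightarrow> d < k \<Longrightarrow> c \<noteq> d \<Longrightarrow> S \<in> cube_verts k - X \<Longrightarrow> flip c S \<in> X \<Longrightarrow> flip d S \<notin> X"
    and step: "\<And>S c. c < k \<Longrightarrow> S \<in> cube_verts k - X \<Longrightarrow> flip c S \<in> cube_verts k - X \<Longrightarrow> P S \<Longrightarrow> P (flip c S)"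
    and S: "S \<in> cube_verts k - X" and T: "T \<in> cube_verts k - X" and "P S"
  shows "P T"
  using S \<open>P S\<close>
proof (induction "card ((S - T) \<union> (T - S))" arbitrary: S rule: less_induct)
  case less
  let ?D = "(S - T) \<union> (T - S)"
  have D: "?D \<subseteq> {..<k}" using less.prems T by (auto simp: cube_verts_def)
  then have fin: "finite ?D" by (rule finite_subset) simp
  have move: "P T" if c: "c \<in> ?D" "flip c S \<notin> X" for c
  proof -
    have "c < k" using c D by auto
    have "(flip c S - T) \<union> (T - flip c S) = ?D - {c}"
      using c by (auto simp: flip_mem split: if_splits)
    then have smaller: "card ((flip c S - T) \<union> (T - flip c S)) < card ?D"
      using c(1) fin by (metis card_Diff1_less)
    have flip: "flip c S \<in> cube_verts k - X" using \<open>c < k\<close> c less.prems by simp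
    show ?thesis
      by (rule less.hyps[OF smaller flip step[OF \<open>c < k\<close> less.prems(1) flip less.prems(2)]])
  qed
  show ?case
  proof (cases "?D = {}")
    case True
    then show ?thesis using less.prems by (metis Diff_eq_empty_iff Un_empty subset_antisym)
  next
    case False
    then obtain c where c: "c \<in> ?D" by auto
    show ?thesis
    proof (cases "?D = {c}")
      case True
      have "flip c S = T"
      proof (rule Set.set_eqI)
        fix x
        have "x \<in> ?D \<longleftrightarrow> x = c" unfolding True by simp
        then show "x \<in> flip c S \<longleftrightarrow> x \<in> T" by (cases "x = c") (auto simp: flip_mem)
      qed
      then show ?thesis using move[OF c] T by auto
    next
      case False
      then obtain d where d: "d \<in> ?D" "d \<noteq> c" using c by auto
      have "flip c S \<notin> X \<or> flip d S \<notin> X"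
        using sep[of c d S] c d D less.prems by auto
      then show ?thesis using move[OF c] move[OF d(1)] by auto
    qed
  qed
qed

lemma wild_cube_algebra:
  assumes k: "k \<ge> 2" and ne: "cube_verts k - X \<noteq> {}"
    and sep: "\<And>S c d. c < k \<Longrightarrow> d < k \<Longrightarrow> c \<noteq> d \<Longrightarrow> S \<in> cube_verts k - X \<Longrightarrow> flip c S \<in> X \<Longrightarrow> flip d S \<notin> X"
  shows "wild (cube_algebra k X)"
proof (rule wild_path_algebra_mod[of _ _ "descent 0" "descent 1"])
  show "quiver_relations (cube_quiver k X) (path_equiv (cube_quiver k X))"
    by (rule quiver_relations_cube)
  show "verts (cube_quiver k X) \<noteq> {}" using ne by simp
next
  fix u p v u' p' v'
  assume r: "((u, p, v), (u', p', v')) \<in> path_equiv (cube_quiver k X)"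
  then show "u = u' \<and> v = v' \<and> sum_list (map (descent 0) p) = sum_list (map (descent 0) p') \<and>
      sum_list (map (descent 1) p) = sum_list (map (descent 1) p')"
    using path_equiv_descent[OF r] by (auto simp: path_equiv_def)
next
  fix P u v
  assume *: "\<And>e. e \<in> arcs (cube_quiver k X) \<Longrightarrow> descent 0 e = 0 \<Longrightarrow> descent 1 e = 0 \<Longrightarrow>
      P (tail (cube_quiver k X) e) \<longleftrightarrow> P (head (cube_quiver k X) e)"
    and uv: "u \<in> verts (cube_quiver k X)" "v \<in> verts (cube_quiver k X)" "P u"
  \<comment> \<open>Arrows that insert an element have weight zero. As they relate \<open>P\<close>
    at their two ends by an equivalence, they also serve for the step in the opposite
    direction.\<close>
  have up: "P S \<longleftrightarrow> P (flip c S)"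
    if "c < k" "S \<in> cube_verts k - X" "flip c S \<in> cube_verts k - X" "c \<notin> S" for S c
  proof -
    have "descent 0 (Edge S c) = 0" "descent 1 (Edge S c) = 0" using that by auto
    then show ?thesis using *[of "Edge S c"] that by simp
  qed
  show "P v"
  proof (rule cube_connected[of k X P u v])
    fix S c
    assume S: "c < k" "S \<in> cube_verts k - X" "flip c S \<in> cube_verts k - X" "P S"
    show "P (flip c S)"
      using up[of c S] up[of c "flip c S"] S by (cases "c \<in> S") (auto simp: flip_mem)
  qed (use uv sep in auto)
next
  obtain S where S: "S \<in> cube_verts k - X" using ne by auto
  \<comment> \<open>At any remaining vertex take the loop of color \<open>c\<close> if the neighbor
    is removed, and otherwise the deleting arrow of the edge of color \<open>c\<close>.\<close>
  have *: "\<exists>e\<in>arcs (cube_quiver k X). descent c e = 1 \<and> (\<forall>d. d \<noteq> c \<longrightarrow> descent d e = 0)" if "c < k" for c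
  proof (cases "flip c S \<in> X")
    case True
    then show ?thesis using S that by (intro bexI[of _ "Loop S c"]) auto
  next
    case False
    then show ?thesis
    proof (cases "c \<in> S")
      case True
      then show ?thesis using S that False by (intro bexI[of _ "Edge S c"]) auto
    next
      case c: False
      show ?thesis using S that False c by (intro bexI[of _ "Edge (flip c S) c"]) (auto simp: flip_mem)
    qed
  qed
  show "\<exists>e\<in>arcs (cube_quiver k X). descent 0 e = 1 \<and> descent 1 e = 0"
    using *[of 0] k by fastforce
  show "\<exists>e\<in>arcs (cube_quiver k X). descent 0 e = 0 \<and> descent 1 e = 1"
    using *[of 1] k by fastforce
qed

lemma wild_A: "k \<ge> 2 \<Longrightarrow> wild (alg_A k)"
  unfolding alg_A_def by (rule wild_cube_algebra) (auto simp: cube_verts_def)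

lemma flip_inject: "flip c r = flip d r \<longleftrightarrow> c = d"
proof
  assume eq: "flip c r = flip d r"
  have "c \<in> flip c r \<longleftrightarrow> c \<in> flip d r" by (simp add: eq)
  then show "c = d" by (auto simp: flip_mem split: if_splits)
qed simp

lemma flip_neq [simp]: "flip c r \<noteq> r" "r \<noteq> flip c r"
  by (auto simp: flip_def)

lemma wild_A': "k \<ge> 2 \<Longrightarrow> r \<in> cube_verts k \<Longrightarrow> wild (alg_A' k r)"
  unfolding alg_A'_def
proof (rule wild_cube_algebra)
  assume k: "k \<ge> 2" "r \<in> cube_verts k"
  then have "flip 0 r \<in> cube_verts k - {r}" by auto
  then show "cube_verts k - {r} \<noteq> {}" by blast
next
  fix S c d assume "c \<noteq> (d::nat)" "flip c S \<in> {r}"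
  then show "flip d S \<notin> {r}"
    using flip_inject[of c S d] by auto
qed

text \<open>Two neighbors of \<open>S\<close> along \<open>c\<close> and \<open>d\<close> agree in
  any third coordinate, whereas opposite vertices differ in every coordinate. So with three colors
  no vertex has two removed neighbors.\<close>

lemma wild_A'': "k \<ge> 3 \<Longrightarrow> r \<in> cube_verts k \<Longrightarrow> wild (alg_A'' k r)"
  unfolding alg_A''_def
proof (rule wild_cube_algebra)
  assume k: "k \<ge> 3" "r \<in> cube_verts k"
  then show "k \<ge> 2" by simp
  have "1 \<in> flip 0 r \<longleftrightarrow> 1 \<in> r" "1 \<in> opposite k r \<longleftrightarrow> 1 \<notin> r"
    using k by (auto simp: flip_mem opposite_def)
  then have "flip 0 r \<noteq> opposite k r" by metis
  then have "flip 0 r \<in> cube_verts k - {r, opposite k r}" using k by auto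
  then show "cube_verts k - {r, opposite k r} \<noteq> {}" by blast
next
  fix S c d assume k: "k \<ge> 3" and cd: "c \<noteq> (d::nat)" and c: "flip c S \<in> {r, opposite k r}"
  have "card {c, d} < k" using k card_2_iff[of "{c, d}"] cd by auto
  then obtain b where b: "b < k" "b \<noteq> c" "b \<noteq> d"
    by (metis (no_types, opaque_lifting) card_lessThan card_mono finite.emptyI finite.insertI insertCI lessThan_iff not_le subsetI)
  have "b \<in> flip c S \<longleftrightarrow> b \<in> S" "b \<in> flip d S \<longleftrightarrow> b \<in> S" "b \<in> opposite k r \<longleftrightarrow> b \<notin> r"
    using b by (auto simp: flip_mem opposite_def)
  moreover have "flip d S \<noteq> flip c S" using cd flip_inject by metis
  ultimately show "flip d S \<notin> {r, opposite k r}" using c by auto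
qed

section \<open>The quiver with two vertices\<close>

fun weight_x :: "arrow2 \<Rightarrow> nat" where
  "weight_x Alpha = 1" | "weight_x Beta = 0" | "weight_x Gamma = 0"
| "weight_x Delta = 1" | "weight_x Epsilon = 1" | "weight_x Phi = 0"

fun weight_y :: "arrow2 \<Rightarrow> nat" where
  "weight_y Alpha = 0" | "weight_y Beta = 1" | "weight_y Gamma = 0"
| "weight_y Delta = 1" | "weight_y Epsilon = 0" | "weight_y Phi = 1"

lemma UNIV_vertex2: "UNIV = {Vv, Vw}"
  using vertex2.exhaust by auto

lemma wild_A''2: "wild alg_A''2"
  unfolding alg_A''2_def
proof (rule wild_path_algebra_mod[of _ _ weight_x weight_y])
  show "quiver_relations quiver2 relations2"
  proof
    have "finite {Vv, Vw}" by simp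
    then show "finite (verts quiver2)" by (simp add: quiver2_def UNIV_vertex2)
  qed (auto simp: quiver2_def relations2_def paths_def pre_digraph.awalk_def pre_digraph.cas.simps)
next
  fix P u v
  assume *: "\<And>e. e \<in> arcs quiver2 \<Longrightarrow> weight_x e = 0 \<Longrightarrow> weight_y e = 0 \<Longrightarrow>
      P (tail quiver2 e) \<longleftrightarrow> P (head quiver2 e)" and "P u"
  then show "P v"
    using *[of Gamma] by (cases u; cases v) (auto simp: quiver2_def)
next
  show "\<exists>e\<in>arcs quiver2. weight_x e = 1 \<and> weight_y e = 0"
    by (rule bexI[of _ Alpha]) (auto simp: quiver2_def)
  show "\<exists>e\<in>arcs quiver2. weight_x e = 0 \<and> weight_y e = 1"
    by (rule bexI[of _ Beta]) (auto simp: quiver2_def)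
qed (auto simp: relations2_def quiver2_def)

section \<open>Endomorphisms of indecomposable modules\<close>

lemma mat_mult_entry:
  assumes "A \<in> carrier_mat n m" "B \<in> carrier_mat m k" "i < n" "j < k"
  shows "(A * B) $$ (i, j) = (\<Sum>l<m. A $$ (i, l) * B $$ (l, j))"
  using assms by (simp add: scalar_prod_def atLeast0LessThan)

lemma opm_smult_one:
  assumes "A \<in> carrier_mat n m"
  shows "opm (c \<cdot>\<^sub>m 1\<^sub>m n) * opm A = opm (c \<cdot>\<^sub>m A)" "opm A * opm (c \<cdot>\<^sub>m 1\<^sub>m m) = opm (c \<cdot>\<^sub>m A)"
proof -
  have "(c \<cdot>\<^sub>m 1\<^sub>m n) * A = c \<cdot>\<^sub>m A" using assms mult_smult_assoc_mat[of "1\<^sub>m n" n n A m c] by simp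
  then show "opm (c \<cdot>\<^sub>m 1\<^sub>m n) * opm A = opm (c \<cdot>\<^sub>m A)"
    using assms by (simp flip: opm_mult)
  have "A * (c \<cdot>\<^sub>m 1\<^sub>m m) = c \<cdot>\<^sub>m A" using assms mult_smult_distrib[of A n m "1\<^sub>m m" m c] by simp
  then show "opm A * opm (c \<cdot>\<^sub>m 1\<^sub>m m) = opm (c \<cdot>\<^sub>m A)"
    using assms by (simp flip: opm_mult)
qed

section \<open>Fitting's lemma\<close>

lemma annihilating_combination:
  fixes S :: "complex mat"
  assumes S: "S \<in> carrier_mat n n"
  shows "\<exists>N c m. m \<le> N \<and> c m \<noteq> 0 \<and>
    (\<forall>r<n. \<forall>s<n. (\<Sum>i\<le>N. c i * (S ^\<^sub>m i) $$ (r, s)) = 0)"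
proof -
  let ?N = "n * n"
  \<comment> \<open>Row \<open>i\<close> lists the entries of the \<open>i\<close>-th power. There
    is one more power than entries, and the last column of zeros makes \<open>B\<close> square and
    singular; a kernel vector of the transpose is a linear dependence between the powers.\<close>
  define B where "B = mat (Suc ?N) (Suc ?N)
    (\<lambda>(i, r). if r < ?N then (S ^\<^sub>m i) $$ (r div n, r mod n) else 0)"
  have B: "B \<in> carrier_mat (Suc ?N) (Suc ?N)" by (simp add: B_def)
  have "B *\<^sub>v unit_vec (Suc ?N) ?N = 0\<^sub>v (Suc ?N)"
    using B by (intro eq_vecI) (simp_all add: B_def)
  moreover have "unit_vec (Suc ?N) ?N \<noteq> (0\<^sub>v (Suc ?N) :: complex vec)"
    by simp
  ultimately have "det B = 0"
    using det_0_iff_vec_prod_zero[OF B] by (metis unit_vec_carrier)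
  then have "det B\<^sup>T = 0" using det_transpose[OF B] by simp
  moreover have "B\<^sup>T \<in> carrier_mat (Suc ?N) (Suc ?N)" using B by simp
  ultimately obtain v where v: "v \<in> carrier_vec (Suc ?N)" "v \<noteq> 0\<^sub>v (Suc ?N)" "B\<^sup>T *\<^sub>v v = 0\<^sub>v (Suc ?N)"
    using det_0_iff_vec_prod_zero by blast
  obtain m where m: "m < Suc ?N" "v $ m \<noteq> 0"
    using v(1,2) by (metis carrier_vecD eq_vecI index_zero_vec)
  have "(\<Sum>i\<le>?N. v $ i * (S ^\<^sub>m i) $$ (r, s)) = 0" if rs: "r < n" "s < n" for r s
  proof -
    have less: "r * n + s < ?N" using rs by (rule block_index_less)
    have "0 = (B\<^sup>T *\<^sub>v v) $ (r * n + s)" using v(3) less by simp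
    also have "\<dots> = (\<Sum>i<Suc ?N. B $$ (i, r * n + s) * v $ i)"
      using B v(1) less by (simp add: scalar_prod_def atLeast0LessThan)
    also have "\<dots> = (\<Sum>i<Suc ?N. v $ i * (S ^\<^sub>m i) $$ (r, s))"
      using less rs by (intro sum.cong) (simp_all add: B_def)
    finally show ?thesis by (simp add: lessThan_Suc_atMost)
  qed
  then show ?thesis
    using m by (intro exI[of _ ?N] exI[of _ "\<lambda>i. v $ i"] exI[of _ m]) auto
qed

lemma opm_pow: "S \<in> carrier_mat n n \<Longrightarrow> opm (S ^\<^sub>m i) * opm (S ^\<^sub>m j) = opm (S ^\<^sub>m (i + j))"
proof (induction j)
  case 0
  then show ?case by (simp add: opm_one_right)
next
  case (Suc j)
  have "opm (S ^\<^sub>m Suc j) = opm (S ^\<^sub>m j) * opm S" "opm (S ^\<^sub>m Suc (i + j)) = opm (S ^\<^sub>m (i + j)) * opm S"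
    using Suc.prems by (simp_all add: opm_mult)
  then show ?case using Suc by (simp flip: mult.assoc)
qed

lemma opm_pow_commute:
  assumes "S \<in> carrier_mat n n" "Y \<in> carrier_mat n n" "opm S * opm Y = opm Y * opm S"
  shows "opm (S ^\<^sub>m i) * opm Y = opm Y * opm (S ^\<^sub>m i)"
proof (induction i)
  case 0
  then show ?case using assms by (simp add: opm_one_left opm_one_right)
next
  case (Suc i)
  have s: "opm (S ^\<^sub>m Suc i) = opm (S ^\<^sub>m i) * opm S" using assms by (simp add: opm_mult)
  show ?case unfolding s by (metis Suc assms(3) mult.assoc)
qed

text \<open>An annihilating polynomial \<open>X^m (c + X h)\<close> with \<open>c \<noteq> 0\<close> yields \<open>K = - h(S) / c\<close>.\<close>

lemma power_regular:
  fixes S :: "complex mat"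
  assumes S: "S \<in> carrier_mat n n"
  obtains m K where "K \<in> carrier_mat n n" "opm (S ^\<^sub>m m) = opm (S ^\<^sub>m Suc m) * opm K"
    "\<And>Y. Y \<in> carrier_mat n n \<Longrightarrow> opm S * opm Y = opm Y * opm S \<Longrightarrow> opm K * opm Y = opm Y * opm K"
proof -
  obtain N c m0 where m0: "m0 \<le> N" "c m0 \<noteq> (0 :: complex)"
    and ann: "\<And>r s. r < n \<Longrightarrow> s < n \<Longrightarrow> (\<Sum>i\<le>N. c i * (S ^\<^sub>m i) $$ (r, s)) = 0"
    using annihilating_combination[OF S] by blast
  define m where "m = (LEAST m. m \<le> N \<and> c m \<noteq> 0)"
  have m: "m \<le> N" "c m \<noteq> 0" using LeastI[of "\<lambda>m. m \<le> N \<and> c m \<noteq> 0" m0] m0 by (auto simp: m_def)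
  have least: "c i = 0" if "i < m" for i
    using not_less_Least[of i "\<lambda>m. m \<le> N \<and> c m \<noteq> 0"] that m by (auto simp: m_def)
  let ?I = "{Suc m..N}" and ?F = "\<lambda>i. (- c i / c m) \<cdot>\<^sub>m S ^\<^sub>m (i - Suc m)"
  define K where "K = mat n n (\<lambda>a. \<Sum>i\<in>?I. ?F i $$ a)"
  have P: "S ^\<^sub>m i \<in> carrier_mat n n" for i using S by simp
  have K: "opm K = (\<Sum>i\<in>?I. opm (?F i))"
    unfolding K_def using P by (intro opm_sum[symmetric]) auto
  have "opm (S ^\<^sub>m Suc m) * opm K = (\<Sum>i\<in>?I. opm ((- c i / c m) \<cdot>\<^sub>m S ^\<^sub>m i))"
  proof -
    have "opm (S ^\<^sub>m Suc m) * opm (?F i) = opm ((- c i / c m) \<cdot>\<^sub>m S ^\<^sub>m i)" if "i \<in> ?I" for i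
    proof -
      have "opm (S ^\<^sub>m Suc m) * opm (?F i)
          = opm (S ^\<^sub>m Suc m) * opm (S ^\<^sub>m (i - Suc m)) * opm ((- c i / c m) \<cdot>\<^sub>m 1\<^sub>m n)"
        by (simp only: mult.assoc opm_smult_one(2)[OF P])
      also have "\<dots> = opm (S ^\<^sub>m i) * opm ((- c i / c m) \<cdot>\<^sub>m 1\<^sub>m n)"
        using that unfolding opm_pow[OF S] by simp
      finally show ?thesis by (simp only: opm_smult_one(2)[OF P])
    qed
    then show ?thesis by (simp add: K sum_distrib_left del: pow_mat.simps)
  qed
  also have "\<dots> = opm (mat n n (\<lambda>a. \<Sum>i\<in>?I. ((- c i / c m) \<cdot>\<^sub>m S ^\<^sub>m i) $$ a))"
    using P by (intro opm_sum) auto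
  also have "mat n n (\<lambda>a. \<Sum>i\<in>?I. ((- c i / c m) \<cdot>\<^sub>m S ^\<^sub>m i) $$ a) = S ^\<^sub>m m"
  proof (rule eq_matI)
    fix r s assume "r < dim_row (S ^\<^sub>m m)" "s < dim_col (S ^\<^sub>m m)"
    then have rs: "r < n" "s < n" using P[of m] by auto
    have "{..N} = {..<m} \<union> insert m ?I" using m by auto
    then have "0 = (\<Sum>i\<in>{..<m} \<union> insert m ?I. c i * (S ^\<^sub>m i) $$ (r, s))"
      using ann[OF rs] by simp
    also have "\<dots> = (\<Sum>i\<in>{..<m}. c i * (S ^\<^sub>m i) $$ (r, s)) + (\<Sum>i\<in>insert m ?I. c i * (S ^\<^sub>m i) $$ (r, s))"
      by (rule sum.union_disjoint) auto
    also have "\<dots> = c m * (S ^\<^sub>m m) $$ (r, s) + (\<Sum>i\<in>?I. c i * (S ^\<^sub>m i) $$ (r, s))"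
      by (simp add: least)
    finally have *: "(\<Sum>i\<in>?I. c i * (S ^\<^sub>m i) $$ (r, s)) = - c m * (S ^\<^sub>m m) $$ (r, s)"
      by (simp add: eq_neg_iff_add_eq_0 add.commute)
    have "(\<Sum>i\<in>?I. ((- c i / c m) \<cdot>\<^sub>m S ^\<^sub>m i) $$ (r, s)) = (\<Sum>i\<in>?I. - (1 / c m) * (c i * (S ^\<^sub>m i) $$ (r, s)))"
      using rs carrier_matD[OF S] by (intro sum.cong) auto
    also have "\<dots> = (S ^\<^sub>m m) $$ (r, s)"
      unfolding sum_distrib_left[symmetric] * using m(2) by simp
    finally show "mat n n (\<lambda>a. \<Sum>i\<in>?I. ((- c i / c m) \<cdot>\<^sub>m S ^\<^sub>m i) $$ a) $$ (r, s) = (S ^\<^sub>m m) $$ (r, s)"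
      using rs by simp
  qed (use S in auto)
  finally have 1: "opm (S ^\<^sub>m m) = opm (S ^\<^sub>m Suc m) * opm K" ..
  have "opm K * opm Y = opm Y * opm K"
    if Y: "Y \<in> carrier_mat n n" "opm S * opm Y = opm Y * opm S" for Y
  proof -
    have "opm (?F i) * opm Y = opm Y * opm (?F i)" for i
    proof -
      let ?s = "opm ((- c i / c m) \<cdot>\<^sub>m 1\<^sub>m n)"
      have s: "?s * opm Y = opm Y * ?s" using Y(1) by (simp add: opm_smult_one)
      have F: "opm (?F i) = ?s * opm (S ^\<^sub>m (i - Suc m))" by (rule opm_smult_one(1)[OF P, symmetric])
      show ?thesis
        unfolding F using opm_pow_commute[OF S Y, of "i - Suc m"] s by (metis mult.assoc)
    qed
    then show ?thesis by (simp add: K sum_distrib_left sum_distrib_right)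
  qed
  with 1 show ?thesis by (intro that[of K m]) (auto simp: K_def)
qed

text \<open>From \<open>S^m = S^(2m) K^m\<close> it follows that \<open>Q = S^m K^m\<close> is
  idempotent with \<open>S^m Q = S^m\<close>. It commutes with the action because \<open>K\<close>
  commutes with all that \<open>S\<close> commutes with. If \<open>Q = 0\<close>, then
  \<open>S\<close> is nilpotent, and if \<open>Q = 1\<close>, then \<open>S\<close> is
  invertible.\<close>

lemma fitting:
  assumes N: "indecomposable A N" and S: "S \<in> carrier_mat (fst N) (fst N)"
    and comm: "\<And>a. a \<in> carrier A \<Longrightarrow> S * snd N a = snd N a * S"
  shows "(\<exists>m. S ^\<^sub>m m = 0\<^sub>m (fst N) (fst N)) \<or> (\<exists>V\<in>carrier_mat (fst N) (fst N). S * V = 1\<^sub>m (fst N))"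
proof -
  define n where "n = fst N"
  note S = S[folded n_def]
  obtain m0 K where K: "K \<in> carrier_mat n n" "opm (S ^\<^sub>m m0) = opm (S ^\<^sub>m Suc m0) * opm K"
    and comK: "\<And>Y. Y \<in> carrier_mat n n \<Longrightarrow> opm S * opm Y = opm Y * opm S \<Longrightarrow> opm K * opm Y = opm Y * opm K"
    by (rule power_regular[OF S]) blast
  \<comment> \<open>One more than the index at hand, so that a factor \<open>S\<close> can be split
    off from \<open>S^m K^m = 1\<close>.\<close>
  define m where "m = Suc m0"
  define s k where "s = opm S" "k = opm K"
  have sk: "k * s = s * k" unfolding s_k_def using comK[OF S] by simp
  have P: "S ^\<^sub>m i \<in> carrier_mat n n" for i using S by simp
  have pK: "K ^\<^sub>m i \<in> carrier_mat n n" for i using K by simp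
  have ks: "opm (K ^\<^sub>m i) * opm (S ^\<^sub>m j) = opm (S ^\<^sub>m j) * opm (K ^\<^sub>m i)" for i j
  proof -
    have "opm S * opm (K ^\<^sub>m i) = opm (K ^\<^sub>m i) * opm S"
      using opm_pow_commute[OF K(1) S] sk by (simp add: s_k_def)
    then show ?thesis using opm_pow_commute[OF S pK] by simp
  qed
  have S1: "S ^\<^sub>m 1 = S" "K ^\<^sub>m 1 = K" using S K(1) by auto
  have step: "opm (S ^\<^sub>m m) = opm (S ^\<^sub>m (m + j)) * opm (K ^\<^sub>m j)" for j
  proof (induction j)
    case 0
    then show ?case using opm_one_right[OF carrier_matD(2)[OF P[of m]]] K(1) by simp
  next
    case (Suc j)
    have m: "opm (S ^\<^sub>m (m + j)) = opm (S ^\<^sub>m (m + Suc j)) * opm K"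
    proof -
      have "opm (S ^\<^sub>m (m + j)) = opm (S ^\<^sub>m Suc j) * opm (S ^\<^sub>m m0)"
        by (simp add: m_def opm_pow[OF S] add.commute del: pow_mat.simps)
      also have "\<dots> = opm (S ^\<^sub>m Suc j) * opm (S ^\<^sub>m Suc m0) * opm K"
        by (simp only: K(2) mult.assoc)
      finally show ?thesis by (simp add: m_def opm_pow[OF S] add.commute del: pow_mat.simps)
    qed
    have "opm (K ^\<^sub>m Suc j) = opm K * opm (K ^\<^sub>m j)"
      using opm_pow[OF K(1), of 1 j] S1 by simp
    then show ?case using Suc.IH m by (simp add: mult.assoc del: pow_mat.simps)
  qed
  define Q where "Q = S ^\<^sub>m m * K ^\<^sub>m m"
  have Q: "Q \<in> carrier_mat n n" "opm Q = opm (S ^\<^sub>m m) * opm (K ^\<^sub>m m)"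
    unfolding Q_def using mult_carrier_mat[OF P pK] opm_mult[of "S ^\<^sub>m m" "K ^\<^sub>m m"]
      carrier_matD(2)[OF P[of m]] carrier_matD(1)[OF pK[of m]] by auto
  have sQ: "opm (S ^\<^sub>m m) = opm (S ^\<^sub>m m) * opm Q"
    unfolding Q(2) mult.assoc[symmetric] opm_pow[OF S] by (rule step)
  have "opm (Q * Q) = opm (S ^\<^sub>m m) * opm (K ^\<^sub>m m) * opm Q"
    using Q by (simp add: opm_mult)
  also have "\<dots> = opm (S ^\<^sub>m m) * opm Q * opm (K ^\<^sub>m m)"
  proof -
    have "opm (K ^\<^sub>m m) * opm Q = opm Q * opm (K ^\<^sub>m m)"
      unfolding Q(2) using ks[of m m] by (metis mult.assoc)
    then show ?thesis by (simp add: mult.assoc)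
  qed
  finally have "opm (Q * Q) = opm Q" using sQ Q(2) by simp
  then have QQ: "Q * Q = Q" by (rule opm_inject_carrier) (use Q in auto)
  have Qa: "Q * snd N a = snd N a * Q" if a: "a \<in> carrier A" for a
  proof -
    have Na: "snd N a \<in> carrier_mat n n"
      using N a by (simp add: indecomposable_def fd_module_iff n_def)
    have s: "opm S * opm (snd N a) = opm (snd N a) * opm S"
      using comm[OF a] S Na by (simp flip: opm_mult)
    have 1: "opm (S ^\<^sub>m m) * opm (snd N a) = opm (snd N a) * opm (S ^\<^sub>m m)"
      by (rule opm_pow_commute[OF S Na s])
    have 2: "opm (K ^\<^sub>m m) * opm (snd N a) = opm (snd N a) * opm (K ^\<^sub>m m)"
      by (rule opm_pow_commute[OF K(1) Na comK[OF Na s]])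
    have "opm Q * opm (snd N a) = opm (snd N a) * opm Q"
      unfolding Q(2) using 1 2 by (metis mult.assoc)
    then have "opm (Q * snd N a) = opm (snd N a * Q)" using Q Na by (simp add: opm_mult)
    then show ?thesis by (rule opm_inject_carrier) (use Q Na in auto)
  qed
  from indecomposable_idempotent[OF N Q(1)[unfolded n_def] QQ Qa]
  have "Q = 0\<^sub>m n n \<or> Q = 1\<^sub>m n" by (simp add: n_def)
  then show ?thesis
  proof
    assume "Q = 0\<^sub>m n n"
    then have "opm (S ^\<^sub>m m) = opm (0\<^sub>m n n)" using sQ by simp
    then have "S ^\<^sub>m m = 0\<^sub>m n n" by (rule opm_inject_carrier[OF _ P]) simp
    then show ?thesis by (auto simp: n_def)
  next
    assume Q1: "Q = 1\<^sub>m n"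
    define V where "V = S ^\<^sub>m m0 * K ^\<^sub>m m"
    have V: "V \<in> carrier_mat n n" unfolding V_def by (rule mult_carrier_mat[OF P pK])
    have "opm (S * V) = opm S * opm (S ^\<^sub>m m0) * opm (K ^\<^sub>m m)"
    proof -
      have "opm V = opm (S ^\<^sub>m m0) * opm (K ^\<^sub>m m)"
        unfolding V_def using carrier_matD(2)[OF P[of m0]] carrier_matD(1)[OF pK[of m]] by (intro opm_mult) simp
      moreover have "opm (S * V) = opm S * opm V" using S V by (intro opm_mult) simp
      ultimately show ?thesis by (simp add: mult.assoc)
    qed
    also have "opm S * opm (S ^\<^sub>m m0) = opm (S ^\<^sub>m m)"
      using opm_pow[OF S, of 1 m0] S1 by (simp add: m_def)
    finally have "opm (S * V) = opm (1\<^sub>m n)" using Q Q1 by simp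
    then have "S * V = 1\<^sub>m n" by (rule opm_inject_carrier) (use S V in auto)
    then show ?thesis using V by (auto simp: n_def)
  qed
qed

text \<open>\<open>B (C B)\<^sup>-\<^sup>1 C\<close> is the projection onto the image of \<open>B C\<close> along its
  kernel, so it commutes with everything that \<open>B C\<close> commutes with.\<close>

lemma indecomposable_frame:
  assumes N: "indecomposable A N" and n: "fst N = n"
    and B: "B \<in> carrier_mat n m" and C: "C \<in> carrier_mat m n" and G: "G \<in> carrier_mat m m"
    and inv: "G * (C * B) = 1\<^sub>m m" "C * B * G = 1\<^sub>m m" and m: "m > 0"
    and comm: "\<And>a. a \<in> carrier A \<Longrightarrow> B * C * snd N a = snd N a * (B * C)"
  shows "m = n" "B * (G * C) = 1\<^sub>m n" "G * C * B = 1\<^sub>m n"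
proof -
  define b c g e where "b = opm B" "c = opm C" "g = opm G" "e = opm (1\<^sub>m m)"
  have gcb: "g * c * b = e" "c * b * g = e"
    using B C G inv by (simp_all add: b_c_g_e_def mult.assoc flip: opm_mult)
  have e: "b * e = b" "e * c = c" "g * e = g" "e * g = g"
    using B C G by (simp_all add: b_c_g_e_def opm_one_left opm_one_right)
  define P where "P = B * (G * C)"
  have P: "P \<in> carrier_mat n n" "opm P = b * g * c"
    using B C G by (auto simp: P_def b_c_g_e_def opm_mult mult.assoc)
  have "opm (P * P) = b * g * (c * b * g) * c"
    using P by (simp add: opm_mult mult.assoc)
  then have "opm (P * P) = opm P" using P by (simp only: gcb) (simp add: e mult.assoc)
  then have PP: "P * P = P" by (rule opm_inject_carrier) (use P in auto)
  have Pa: "P * snd N a = snd N a * P" if a: "a \<in> carrier A" for a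
  proof -
    have Na: "snd N a \<in> carrier_mat n n"
      using N a n by (auto simp: indecomposable_def fd_module_iff)
    define t where "t = opm (snd N a)"
    have bct: "b * c * t = t * (b * c)"
      using arg_cong[OF comm[OF a], of opm] B C Na by (simp add: opm_mult b_c_g_e_def t_def mult.assoc)
    have p1: "opm P = b * c * (b * g * g * c)"
    proof -
      have "b * c * (b * g * g * c) = b * (c * b * g) * g * c" by (simp only: mult.assoc)
      then show ?thesis by (simp only: gcb e P)
    qed
    have p2: "opm P = b * g * g * c * (b * c)"
    proof -
      have "b * g * g * c * (b * c) = b * (g * (g * c * b)) * c" by (simp only: mult.assoc)
      then show ?thesis by (simp only: gcb e P)
    qed
    have pbc: "opm P * (b * c) = b * c" "b * c * opm P = b * c"
    proof -
      have "opm P * (b * c) = b * (g * c * b) * c" by (simp only: P mult.assoc)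
      then show "opm P * (b * c) = b * c" by (simp only: gcb e)
      have "b * c * opm P = b * (c * b * g) * c" by (simp only: P mult.assoc)
      then show "b * c * opm P = b * c" by (simp only: gcb e)
    qed
    \<comment> \<open>\<open>P\<close> is a multiple of \<open>b * c\<close> from either side, and
      \<open>b * c\<close> commutes with \<open>t\<close> and is fixed by \<open>P\<close>. Hence
      both \<open>t P\<close> and \<open>P t\<close> reduce to \<open>P t P\<close>.\<close>
    define x y where "x = b * g * g * c" "y = b * g * g * c"
    have p: "opm P = b * c * x" "opm P = y * (b * c)" using p1 p2 by (simp_all only: x_y_def)
    have "t * opm P = t * (b * c) * x" by (simp only: p(1) mult.assoc)
    also have "\<dots> = opm P * (b * c) * t * x" by (simp only: bct[symmetric] pbc)
    also have "\<dots> = opm P * (b * c * t) * x" by (simp only: mult.assoc)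
    also have "\<dots> = opm P * t * (b * c * x)" by (simp only: bct) (simp only: mult.assoc)
    also have "\<dots> = opm P * t * opm P" by (simp only: p(1)[symmetric])
    finally have 1: "t * opm P = opm P * t * opm P" .
    have "opm P * t = y * (b * c * t)" by (simp only: p(2) mult.assoc)
    also have "\<dots> = y * t * (b * c * opm P)" by (simp only: bct pbc) (simp only: mult.assoc)
    also have "\<dots> = y * (t * (b * c)) * opm P" by (simp only: mult.assoc)
    also have "\<dots> = y * (b * c) * t * opm P" by (simp only: bct[symmetric]) (simp only: mult.assoc)
    also have "\<dots> = opm P * t * opm P" by (simp only: p(2)[symmetric])
    finally have "opm P * t = t * opm P" using 1 by simp
    then have "opm (P * snd N a) = opm (snd N a * P)" using P Na by (simp add: opm_mult t_def)
    then show ?thesis by (rule opm_inject_carrier) (use P Na in auto)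
  qed
  have "P = 0\<^sub>m n n \<or> P = 1\<^sub>m n"
    using indecomposable_idempotent[OF N, unfolded n, OF P(1) PP Pa] .
  \<comment> \<open>The product \<open>C P B G\<close> is the square of \<open>C B G\<close>, an
    identity matrix of positive size.\<close>
  moreover have "P \<noteq> 0\<^sub>m n n"
  proof
    assume "P = 0\<^sub>m n n"
    then have "b * g * c = 0" using P(2) by simp
    moreover have "c * (b * g * c) * b * g = (c * b * g) * (c * b * g)" by (simp only: mult.assoc)
    ultimately have "e * e = 0" by (simp add: gcb)
    then have "opm (1\<^sub>m m) = opm (0\<^sub>m m m)"
      by (simp add: b_c_g_e_def opm_one_left)
    then have "1\<^sub>m m = (0\<^sub>m m m :: complex mat)" by (rule opm_inject_carrier[of _ _ m m]) auto
    then have "1\<^sub>m m $$ (0, 0) = (0\<^sub>m m m :: complex mat) $$ (0, 0)" by simp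
    then show False using m by simp
  qed
  ultimately show 1: "B * (G * C) = 1\<^sub>m n" by (simp add: P_def)
  have 2: "G * C * B = 1\<^sub>m m" using inv B C G by simp
  show "m = n" using two_sided_inverse_square[OF B _ 1 2] C G by auto
  with 2 show "G * C * B = 1\<^sub>m n" by simp
qed

section \<open>Bases from rank one endomorphisms\<close>

lemma triangular_invertible:
  fixes L :: "complex mat"
  assumes L: "L \<in> carrier_mat m m" and tri: "\<And>i j. i < j \<Longrightarrow> j < m \<Longrightarrow> L $$ (i, j) = 0"
    and diag: "\<And>i. i < m \<Longrightarrow> L $$ (i, i) \<noteq> 0"
  obtains G where "G \<in> carrier_mat m m" "G * L = 1\<^sub>m m" "L * G = 1\<^sub>m m"
proof -
  have "det L = prod_list (diag_mat L)" by (rule det_lower_triangular[OF tri L])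
  also have "\<dots> \<noteq> 0" using L diag by (auto simp: prod_list_zero_iff diag_mat_def)
  finally obtain G where "G \<in> carrier_mat m m" "G * L = 1\<^sub>m m" "L * G = 1\<^sub>m m"
    using det_non_zero_imp_unit[OF L] by (auto simp: Units_def ring_mat_def)
  then show ?thesis by (rule that)
qed

text \<open>\<open>D\<close> is a multiple of a vector \<open>v\<close>, its column
  \<open>j0\<close>, times a functional, its row \<open>i0\<close>. The vectors \<open>U k v\<close>
  and the functionals obtained by composing with \<open>W k\<close> have triangular pairings with
  nonzero diagonal, and \<open>comm\<close> makes the sum of the \<open>U k D W k\<close> an
  endomorphism. The projection onto the span of the vectors is then an endomorphism as well, so it
  is the identity and the vectors form a basis.\<close>

lemma indecomposable_basis:
  assumes N: "indecomposable A N" "fst N = n"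
    and D: "D \<in> carrier_mat n n" and ij0: "i0 < n" "j0 < n" "D $$ (i0, j0) \<noteq> 0"
    and rank: "\<And>i j. i < n \<Longrightarrow> j < n \<Longrightarrow> D $$ (i, j0) * D $$ (i0, j) = D $$ (i0, j0) * D $$ (i, j)"
    and U: "\<And>k. U k \<in> carrier_mat n n" and W: "\<And>k. W k \<in> carrier_mat n n" and m: "m > 0"
    and tri: "\<And>k l. k < l \<Longrightarrow> l < m \<Longrightarrow> opm D * opm (W k) * opm (U l) * opm D = 0"
    and diag: "\<And>k. k < m \<Longrightarrow> opm D * opm (W k) * opm (U k) * opm D = opm D"
    and comm: "\<And>\<Theta> a. \<Theta> \<in> carrier_mat n n \<Longrightarrow> opm \<Theta> = (\<Sum>k<m. opm (U k) * opm D * opm (W k)) \<Longrightarrow>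
      a \<in> carrier A \<Longrightarrow> \<Theta> * snd N a = snd N a * \<Theta>"
  shows "m = n" "\<exists>V\<in>carrier_mat n n. mat n m (\<lambda>(i, k). (U k * D) $$ (i, j0)) * V = 1\<^sub>m n \<and>
    V * mat n m (\<lambda>(i, k). (U k * D) $$ (i, j0)) = 1\<^sub>m n"
proof -
  define B where "B = mat n m (\<lambda>(i, k). (U k * D) $$ (i, j0))"
  define C where "C = mat m n (\<lambda>(k, j). (D * W k) $$ (i0, j))"
  have B: "B \<in> carrier_mat n m" and C: "C \<in> carrier_mat m n" by (simp_all add: B_def C_def)
  let ?\<delta> = "D $$ (i0, j0)"
  define \<Theta> where "\<Theta> = mat n n (\<lambda>a. \<Sum>k<m. (U k * D * W k) $$ a)"
  have \<Theta>: "\<Theta> \<in> carrier_mat n n" by (simp add: \<Theta>_def)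
  have UDW: "U k * D * W k \<in> carrier_mat n n" for k using U[of k] W[of k] D by simp
  have "opm \<Theta> = (\<Sum>k<m. opm (U k * D * W k))"
    unfolding \<Theta>_def using UDW by (intro opm_sum[symmetric]) auto
  also have "\<dots> = (\<Sum>k<m. opm (U k) * opm D * opm (W k))"
  proof (rule sum.cong[OF refl])
    fix k
    show "opm (U k * D * W k) = opm (U k) * opm D * opm (W k)"
      using carrier_matD[OF U] carrier_matD[OF W] D by (subst opm_mult, simp)+ simp
  qed
  finally have \<Theta>o: "opm \<Theta> = (\<Sum>k<m. opm (U k) * opm D * opm (W k))" .
  \<comment> \<open>The rank condition says that \<open>?\<delta>\<close> times \<open>D\<close> is
    its column \<open>j0\<close> times its row \<open>i0\<close>; this rewrites the sum of rank one
    maps as a matrix product.\<close>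
  have BC: "B * C = map_mat ((*) ?\<delta>) \<Theta>"
  proof (rule eq_matI)
    fix i j assume "i < dim_row (map_mat ((*) ?\<delta>) \<Theta>)" "j < dim_col (map_mat ((*) ?\<delta>) \<Theta>)"
    then have ij: "i < n" "j < n" by (simp_all add: \<Theta>_def)
    have *: "(U k * D) $$ (i, j0) * (D * W k) $$ (i0, j) = ?\<delta> * (U k * D * W k) $$ (i, j)" for k
    proof -
      have "(U k * D) $$ (i, j0) * (D * W k) $$ (i0, j)
          = (\<Sum>a<n. \<Sum>b<n. (U k $$ (i, a) * D $$ (a, j0)) * (D $$ (i0, b) * W k $$ (b, j)))"
        unfolding mat_mult_entry[OF U D ij(1) ij0(2)] mat_mult_entry[OF D W ij0(1) ij(2)] by (rule sum_product)
      also have "\<dots> = (\<Sum>a<n. \<Sum>b<n. ?\<delta> * (U k $$ (i, a) * D $$ (a, b) * W k $$ (b, j)))"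
      proof (intro sum.cong refl)
        fix a b assume "a \<in> {..<n}" "b \<in> {..<n}"
        then have r: "D $$ (a, j0) * D $$ (i0, b) = ?\<delta> * D $$ (a, b)" using rank by simp
        have "(U k $$ (i, a) * D $$ (a, j0)) * (D $$ (i0, b) * W k $$ (b, j))
            = U k $$ (i, a) * (D $$ (a, j0) * D $$ (i0, b)) * W k $$ (b, j)"
          by (simp only: mult.assoc)
        then show "(U k $$ (i, a) * D $$ (a, j0)) * (D $$ (i0, b) * W k $$ (b, j))
            = ?\<delta> * (U k $$ (i, a) * D $$ (a, b) * W k $$ (b, j))"
          unfolding r by (simp only: ac_simps)
      qed
      also have "\<dots> = ?\<delta> * (\<Sum>b<n. (\<Sum>a<n. U k $$ (i, a) * D $$ (a, b)) * W k $$ (b, j))"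
        by (subst sum.swap) (simp add: sum_distrib_left sum_distrib_right)
      also have "\<dots> = ?\<delta> * (U k * D * W k) $$ (i, j)"
      proof -
        have "(U k * D * W k) $$ (i, j) = (\<Sum>b<n. (U k * D) $$ (i, b) * W k $$ (b, j))"
          by (rule mat_mult_entry[OF mult_carrier_mat[OF U D] W ij])
        also have "\<dots> = (\<Sum>b<n. (\<Sum>a<n. U k $$ (i, a) * D $$ (a, b)) * W k $$ (b, j))"
          by (intro sum.cong refl) (simp add: mat_mult_entry[OF U D ij(1)])
        finally show ?thesis by simp
      qed
      finally show ?thesis .
    qed
    have "(B * C) $$ (i, j) = (\<Sum>k<m. (U k * D) $$ (i, j0) * (D * W k) $$ (i0, j))"
      using ij by (simp add: B_def C_def scalar_prod_def atLeast0LessThan)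
    then show "(B * C) $$ (i, j) = map_mat ((*) ?\<delta>) \<Theta> $$ (i, j)"
      using ij by (simp add: * \<Theta>_def sum_distrib_left)
  qed (use B C in \<open>simp_all add: \<Theta>_def\<close>)
  \<comment> \<open>The pairings are single entries of \<open>D W k U l D\<close>, so the hypotheses
    \<open>tri\<close> and \<open>diag\<close> give 0 above the diagonal and
    \<open>?\<delta>\<close> on it.\<close>
  have CB: "(C * B) $$ (k, l) = (D * W k * (U l * D)) $$ (i0, j0)" if kl: "k < m" "l < m" for k l
  proof -
    have "(C * B) $$ (k, l) = (\<Sum>j<n. (D * W k) $$ (i0, j) * (U l * D) $$ (j, j0))"
      unfolding mat_mult_entry[OF C B kl] using kl by (intro sum.cong) (simp_all add: B_def C_def)
    then show ?thesis
      unfolding mat_mult_entry[OF mult_carrier_mat[OF D W] mult_carrier_mat[OF U D] ij0(1,2)] .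
  qed
  have DWUD: "opm (D * W k * (U l * D)) = opm D * opm (W k) * opm (U l) * opm D" for k l
  proof -
    have "opm (D * W k) = opm D * opm (W k)" "opm (U l * D) = opm (U l) * opm D"
      using U[of l] W[of k] D by (simp_all add: opm_mult)
    moreover have "dim_col (D * W k) = n" "dim_row (U l * D) = n" using U[of l] W[of k] by auto
    ultimately show ?thesis by (subst opm_mult) (simp_all add: mult.assoc)
  qed
  have DWUDc: "D * W k * (U l * D) \<in> carrier_mat n n" for k l
    using mult_carrier_mat[OF mult_carrier_mat[OF D W] mult_carrier_mat[OF U D]] .
  have z: "D * W k * (U l * D) = 0\<^sub>m n n" if "k < l" "l < m" for k l
    by (rule opm_inject_carrier[OF _ DWUDc]) (simp_all add: DWUD tri[OF that])
  have d: "D * W k * (U k * D) = D" if "k < m" for k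
    by (rule opm_inject_carrier[OF _ DWUDc D]) (simp add: DWUD diag[OF that])
  have "(C * B) $$ (k, l) = 0" if "k < l" "l < m" for k l
    unfolding CB[OF order.strict_trans[OF that] that(2)] z[OF that] using ij0 by simp
  moreover have "(C * B) $$ (k, k) \<noteq> 0" if "k < m" for k
    unfolding CB[OF that that] d[OF that] by (rule ij0(3))
  ultimately obtain G where G: "G \<in> carrier_mat m m" "G * (C * B) = 1\<^sub>m m" "C * B * G = 1\<^sub>m m"
    using triangular_invertible[OF mult_carrier_mat[OF C B]] by blast
  have BCa: "B * C * snd N a = snd N a * (B * C)" if a: "a \<in> carrier A" for a
  proof -
    have Na: "snd N a \<in> carrier_mat n n" using N a by (auto simp: indecomposable_def fd_module_iff)
    show ?thesis
      unfolding BC using comm[OF \<Theta> \<Theta>o a] map_mat_times_mult[OF \<Theta> Na] map_mat_times_mult[OF Na \<Theta>] by simp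
  qed
  note frame = indecomposable_frame[OF N B C G m BCa]
  show "m = n" by (rule frame(1))
  have "G * C \<in> carrier_mat n n" using G C frame(1) by auto
  then show "\<exists>V\<in>carrier_mat n n. mat n m (\<lambda>(i, k). (U k * D) $$ (i, j0)) * V = 1\<^sub>m n \<and>
    V * mat n m (\<lambda>(i, k). (U k * D) $$ (i, j0)) = 1\<^sub>m n"
    unfolding B_def[symmetric] using frame(2,3) by (intro bexI[of _ "G * C"]) auto
qed

text \<open>At a nonzero entry \<open>(a, b)\<close> of \<open>L * X * R\<close>, combine column
  \<open>b\<close> of \<open>R\<close> as vector with row \<open>a\<close> of \<open>L\<close> as
  functional. \<open>X\<close> pairs them to that entry, and dividing by it gives
  \<open>D X D = D\<close>. The idempotents \<open>R\<close> and \<open>L\<close> keep the vector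
  and the functional at chosen vertices.\<close>

lemma rank_one_test:
  assumes L: "L \<in> carrier_mat n n" and R: "R \<in> carrier_mat n n" and X: "X \<in> carrier_mat n n"
    and idem: "L * L = L" "R * R = R" and ne: "L * X * R \<noteq> 0\<^sub>m n n"
  obtains D i0 j0 where "D \<in> carrier_mat n n" "i0 < n" "j0 < n" "D $$ (i0, j0) \<noteq> 0"
    "\<And>i j. i < n \<Longrightarrow> j < n \<Longrightarrow> D $$ (i, j0) * D $$ (i0, j) = D $$ (i0, j0) * D $$ (i, j)"
    "R * D = D" "D * L = D" "opm D * opm X * opm D = opm D"
proof -
  have LXR: "L * X * R \<in> carrier_mat n n" using L X R by auto
  obtain a b where ab: "a < n" "b < n" "(L * X * R) $$ (a, b) \<noteq> 0"
    using ne LXR by (metis carrier_matD eq_matI index_zero_mat)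
  let ?\<alpha> = "(L * X * R) $$ (a, b)"
  define D where "D = mat n n (\<lambda>(i, j). R $$ (i, b) * L $$ (a, j) / ?\<alpha>)"
  have D: "D \<in> carrier_mat n n" by (simp add: D_def)
  have RD: "R * D = D"
  proof (rule eq_matI)
    fix i j assume "i < dim_row D" "j < dim_col D"
    then have ij: "i < n" "j < n" using D by auto
    have "(R * R) $$ (i, b) = (\<Sum>k<n. R $$ (i, k) * R $$ (k, b))"
      using R ij ab by (simp add: scalar_prod_def atLeast0LessThan)
    moreover have "(R * D) $$ (i, j) = (\<Sum>k<n. R $$ (i, k) * R $$ (k, b)) * L $$ (a, j) / ?\<alpha>"
      using R ij by (simp add: D_def scalar_prod_def atLeast0LessThan sum_distrib_right sum_divide_distrib mult.assoc)
    ultimately show "(R * D) $$ (i, j) = D $$ (i, j)" using ij by (simp add: idem D_def)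
  qed (use R D in auto)
  have DL: "D * L = D"
  proof (rule eq_matI)
    fix i j assume "i < dim_row D" "j < dim_col D"
    then have ij: "i < n" "j < n" using D by auto
    have "(L * L) $$ (a, j) = (\<Sum>k<n. L $$ (a, k) * L $$ (k, j))"
      using L ij ab by (simp add: scalar_prod_def atLeast0LessThan)
    moreover have "(D * L) $$ (i, j) = R $$ (i, b) * (\<Sum>k<n. L $$ (a, k) * L $$ (k, j)) / ?\<alpha>"
      using L ij by (simp add: D_def scalar_prod_def atLeast0LessThan sum_distrib_left sum_divide_distrib mult.assoc)
    ultimately show "(D * L) $$ (i, j) = D $$ (i, j)" using ij by (simp add: idem D_def)
  qed (use L D in auto)
  have DXD: "D * X * D = D"
  proof (rule eq_matI)
    fix i j assume "i < dim_row D" "j < dim_col D"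
    then have ij: "i < n" "j < n" using D by auto
    have DX: "(D * X) $$ (i, k) = R $$ (i, b) * (L * X) $$ (a, k) / ?\<alpha>" if "k < n" for k
      using L X ij ab that by (simp add: D_def scalar_prod_def atLeast0LessThan sum_distrib_left sum_divide_distrib mult.assoc)
    have "?\<alpha> = (\<Sum>k<n. (L * X) $$ (a, k) * R $$ (k, b))"
      by (rule mat_mult_entry[OF mult_carrier_mat[OF L X] R ab(1,2)])
    moreover have "(D * X * D) $$ (i, j) = (\<Sum>k<n. (D * X) $$ (i, k) * D $$ (k, j))"
      by (rule mat_mult_entry[OF mult_carrier_mat[OF D X] D ij])
    moreover have "\<dots> = (\<Sum>k<n. R $$ (i, b) * L $$ (a, j) / (?\<alpha> * ?\<alpha>) * ((L * X) $$ (a, k) * R $$ (k, b)))"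
    proof (intro sum.cong refl)
      fix k assume "k \<in> {..<n}"
      then have k: "k < n" by simp
      have "D $$ (k, j) = R $$ (k, b) * L $$ (a, j) / ?\<alpha>" using ij k by (simp add: D_def)
      then show "(D * X) $$ (i, k) * D $$ (k, j)
          = R $$ (i, b) * L $$ (a, j) / (?\<alpha> * ?\<alpha>) * ((L * X) $$ (a, k) * R $$ (k, b))"
        unfolding DX[OF k] by simp
    qed
    ultimately have "(D * X * D) $$ (i, j) = R $$ (i, b) * L $$ (a, j) / (?\<alpha> * ?\<alpha>) * ?\<alpha>"
      by (simp only: sum_distrib_left)
    then show "(D * X * D) $$ (i, j) = D $$ (i, j)" using ij ab(3) by (simp add: D_def)
  qed (use D X in auto)
  have "D \<noteq> 0\<^sub>m n n"
  proof
    assume D0: "D = 0\<^sub>m n n"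
    have "R $$ (i, b) * L $$ (a, j) = 0" if "i < n" "j < n" for i j
      using arg_cong[OF D0, of "\<lambda>D. D $$ (i, j)"] that ab(3) by (simp add: D_def)
    then have "(\<forall>i<n. R $$ (i, b) = 0) \<or> (\<forall>j<n. L $$ (a, j) = 0)" by (meson mult_eq_0_iff)
    moreover have "?\<alpha> = (\<Sum>k<n. (L * X) $$ (a, k) * R $$ (k, b))"
      by (rule mat_mult_entry[OF mult_carrier_mat[OF L X] R ab(1,2)])
    moreover have "(L * X) $$ (a, k) = (\<Sum>j<n. L $$ (a, j) * X $$ (j, k))" if "k < n" for k
      using L X ab that by (simp add: scalar_prod_def atLeast0LessThan)
    ultimately have "?\<alpha> = 0" by (elim disjE) simp_all
    then show False using ab(3) by simp
  qed
  then obtain i0 j0 where ij0: "i0 < n" "j0 < n" "D $$ (i0, j0) \<noteq> 0"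
    using D by (metis carrier_matD eq_matI index_zero_mat)
  show ?thesis
  proof (rule that[OF D ij0 _ RD DL])
    show "D $$ (i, j0) * D $$ (i0, j) = D $$ (i0, j0) * D $$ (i, j)" if "i < n" "j < n" for i j
      using that ij0 by (simp add: D_def)
    show "opm D * opm X * opm D = opm D"
      using arg_cong[OF DXD, of opm] D X by (simp add: opm_mult mult.assoc)
  qed
qed

section \<open>The tame algebra\<close>

interpretation cyc: quiver_relations "cube_quiver (Suc 0) {}" "path_equiv (cube_quiver (Suc 0) {})"
  by (rule quiver_relations_cube)

lemma cube_verts_1: "cube_verts (Suc 0) = {{}, {0}}"
  by (auto simp: cube_verts_def lessThan_Suc)

lemma cube_arcs_1: "e \<in> arcs (cube_quiver (Suc 0) {}) \<longleftrightarrow> e = Edge {} 0 \<or> e = Edge {0} 0"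
  by (cases e) (auto simp: cube_verts_1 flip_def)

definition up :: "(nat set, cube_arrow) path" where "up = ({}, [Edge {} 0], {0})"
definition down :: "(nat set, cube_arrow) path" where "down = ({0}, [Edge {0} 0], {})"

lemma cyc_paths:
  "({}, [], {}) \<in> paths (cube_quiver (Suc 0) {})" "({0}, [], {0}) \<in> paths (cube_quiver (Suc 0) {})"
  "up \<in> paths (cube_quiver (Suc 0) {})" "down \<in> paths (cube_quiver (Suc 0) {})"
  by (simp_all add: up_def down_def paths_def pre_digraph.awalk_def pre_digraph.cas.simps cube_verts_1
      flip_def)

text \<open>
  A module is determined by the action \<open>vmat\<close> of the vertex \<open>{}\<close> and the sum \<open>zmat\<close> of the actions of
  the two arrows.
\<close>

type_synonym cyc_module = "(((nat set, cube_arrow) path \<Rightarrow>\<^sub>0 complex) set, complex) matrix_rep"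

definition vmat :: "cyc_module \<Rightarrow> complex mat" where
  "vmat N = snd N (cyc.pcls ({}, [], {}))"

definition zmat :: "cyc_module \<Rightarrow> complex mat" where
  "zmat N = snd N (cyc.pcls up) + snd N (cyc.pcls down)"

lemma fd_moduleD:
  assumes "fd_module A M"
  shows "a \<in> carrier A \<Longrightarrow> snd M a \<in> carrier_mat (fst M) (fst M)"
    and "a \<in> carrier A \<Longrightarrow> b \<in> carrier A \<Longrightarrow> snd M (a \<otimes>\<^bsub>A\<^esub> b) = snd M a * snd M b"
    and "a \<in> carrier A \<Longrightarrow> b \<in> carrier A \<Longrightarrow> snd M (a \<oplus>\<^bsub>A\<^esub> b) = snd M a + snd M b"
    and "snd M \<one>\<^bsub>A\<^esub> = 1\<^sub>m (fst M)"
  using assms by (simp_all add: fd_module_iff)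

text \<open>The relation \<open>z * e + e * z = z\<close> says that \<open>z\<close> exchanges the
  image and the kernel of \<open>e\<close>. Hence the two arrows are recovered from their sum by
  restricting it to the one or the other.\<close>

lemma cyc_module:
  fixes N :: cyc_module
  assumes N: "fd_module cyc.A N" and n: "fst N = n"
  defines "e \<equiv> opm (vmat N)" and "z \<equiv> opm (zmat N)" and "I \<equiv> opm (1\<^sub>m n)"
  shows "vmat N \<in> carrier_mat n n" "zmat N \<in> carrier_mat n n"
    and "e * e = e" "z * e + e * z = z"
    and "opm (snd N (cyc.pcls ({0}, [], {0}))) = I - e"
    and "opm (snd N (cyc.pcls up)) = z * e" "opm (snd N (cyc.pcls down)) = z * (I - e)"
proof -
  define e1 p q where "e1 = opm (snd N (cyc.pcls ({0}, [], {0})))"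
    and "p = opm (snd N (cyc.pcls up))" and "q = opm (snd N (cyc.pcls down))"
  have c: "snd N (cyc.pcls x) \<in> carrier_mat n n" if "x \<in> paths (cube_quiver (Suc 0) {})" for x
    using N cyc.pcls_carrier[OF that] n by (simp add: fd_module_iff)
  show v: "vmat N \<in> carrier_mat n n" "zmat N \<in> carrier_mat n n"
    using c cyc_paths by (simp_all add: vmat_def zmat_def)
  have mult: "opm (snd N (cyc.pcls (v, l', w))) * opm (snd N (cyc.pcls (u, l, v)))
      = opm (snd N (cyc.pcls (u, l @ l', w)))"
    if p: "(u, l, v) \<in> paths (cube_quiver (Suc 0) {})" "(v, l', w) \<in> paths (cube_quiver (Suc 0) {})" for u v w l l'
  proof -
    have "snd N (cyc.pcls (v, l', w)) * snd N (cyc.pcls (u, l, v)) = snd N (cyc.pcls (u, l @ l', w))"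
      unfolding cyc.pcls_mult[OF p, symmetric]
      by (rule fd_moduleD(2)[OF N cyc.pcls_carrier[OF p(2)] cyc.pcls_carrier[OF p(1)], symmetric])
    then show ?thesis using c[OF p(1)] c[OF p(2)] by (simp flip: opm_mult)
  qed
  show ee: "e * e = e"
    using mult[OF cyc_paths(1,1)] by (simp add: e_def vmat_def)
  have rel: "p * e = p" "e1 * p = p" "q * e1 = q" "e * q = q"
    using mult[OF cyc_paths(1) cyc_paths(3)[unfolded up_def]] mult[OF cyc_paths(3)[unfolded up_def] cyc_paths(2)]
      mult[OF cyc_paths(2) cyc_paths(4)[unfolded down_def]] mult[OF cyc_paths(4)[unfolded down_def] cyc_paths(1)]
    by (simp_all add: e_def e1_def p_def q_def vmat_def up_def down_def)
  have "\<one>\<^bsub>cyc.A\<^esub> = cyc.pcls ({}, [], {}) \<oplus>\<^bsub>cyc.A\<^esub> cyc.pcls ({0}, [], {0})"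
    using cyc_paths(1,2)
    by (simp add: cyc.quot_simps cyc.single_carrier cube_verts_1)
  then have "1\<^sub>m n = vmat N + snd N (cyc.pcls ({0}, [], {0}))"
    using fd_moduleD(3)[OF N cyc.pcls_carrier[OF cyc_paths(1)] cyc.pcls_carrier[OF cyc_paths(2)]]
      fd_moduleD(4)[OF N] unfolding vmat_def n by argo
  then have "I = e + e1"
    using v c[OF cyc_paths(2)] by (simp add: I_def e_def e1_def opm_add)
  then have e1: "e1 = I - e" by simp
  then show "opm (snd N (cyc.pcls ({0}, [], {0}))) = I - e" by (simp add: e1_def)
  have I: "I * e = e" "e * I = e" "q * I = q" "I * p = p"
    using v by (simp_all add: I_def e_def q_def p_def opm_one_left opm_one_right
        carrier_matD[OF c[OF cyc_paths(3)]] carrier_matD[OF c[OF cyc_paths(4)]])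
  have "q * (I - e) = q" "(I - e) * p = p" using rel e1 by simp_all
  then have qe: "q * e = 0" "e * p = 0" by (simp_all add: right_diff_distrib left_diff_distrib I)
  have z: "z = p + q"
    by (simp add: z_def zmat_def p_def q_def opm_add carrier_matD[OF c[OF cyc_paths(3)]]
        carrier_matD[OF c[OF cyc_paths(4)]])
  show "z * e + e * z = z" by (simp add: z distrib_left distrib_right rel qe)
  show "opm (snd N (cyc.pcls up)) = z * e" by (simp add: z distrib_right rel qe flip: p_def)
  have "p * I = p" by (simp add: I_def p_def opm_one_right carrier_matD[OF c[OF cyc_paths(3)]])
  then show "opm (snd N (cyc.pcls down)) = z * (I - e)"
    by (simp add: z distrib_right right_diff_distrib rel qe I flip: q_def)
qed

lemma cyc_intertwiner:
  assumes N: "fd_module cyc.A N" "fst N = n" and N': "fd_module cyc.A N'" "fst N' = n"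
    and P: "P \<in> carrier_mat n n"
    and v: "opm P * opm (vmat N) = opm (vmat N') * opm P"
    and z: "opm P * opm (zmat N) = opm (zmat N') * opm P"
    and a: "a \<in> carrier cyc.A"
  shows "P * snd N a = snd N' a * P"
proof (rule cyc.intertwiner[OF N(1) N'(1) _ _ _ a])
  note M = cyc_module[OF N] and M' = cyc_module[OF N']
  have c: "snd N (cyc.pcls x) \<in> carrier_mat n n" "snd N' (cyc.pcls x) \<in> carrier_mat n n"
    if "x \<in> paths (cube_quiver (Suc 0) {})" for x
    using N N' cyc.pcls_carrier[OF that] by (simp_all add: fd_module_iff)
  have lift: "P * snd N (cyc.pcls x) = snd N' (cyc.pcls x) * P"
    if "x \<in> paths (cube_quiver (Suc 0) {})" "opm P * opm (snd N (cyc.pcls x)) = opm (snd N' (cyc.pcls x)) * opm P" for x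
    using that(2) c[OF that(1)] P by (intro opm_inject_carrier[of _ _ n n]) (auto simp: opm_mult)
  have one: "opm P * opm (1\<^sub>m n) = opm (1\<^sub>m n) * opm P"
    using P by (simp add: opm_one_left opm_one_right)
  then have v1: "opm P * (opm (1\<^sub>m n) - opm (vmat N)) = (opm (1\<^sub>m n) - opm (vmat N')) * opm P"
    using v by (simp add: left_diff_distrib right_diff_distrib)
  show "P \<in> carrier_mat (fst N') (fst N)" using P N N' by simp
  show "P * snd N (cyc.pcls (w, [], w)) = snd N' (cyc.pcls (w, [], w)) * P"
    if "w \<in> verts (cube_quiver (Suc 0) {})" for w
  proof -
    have "w = {} \<or> w = {0}" using that by (simp add: cube_verts_1)
    then show ?thesis
      using lift[OF cyc_paths(1)] lift[OF cyc_paths(2)] v v1 M(5) M'(5) by (auto simp: vmat_def)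
  qed
  have "opm P * (opm (zmat N) * opm (vmat N)) = opm (zmat N') * opm (vmat N') * opm P"
    using v z by (metis mult.assoc)
  then have u: "P * snd N (cyc.pcls up) = snd N' (cyc.pcls up) * P"
    using lift[OF cyc_paths(3)] M(6) M'(6) by simp
  have "opm P * (opm (zmat N) * (opm (1\<^sub>m n) - opm (vmat N)))
      = opm (zmat N') * (opm (1\<^sub>m n) - opm (vmat N')) * opm P"
    using v1 z by (metis mult.assoc)
  then have d: "P * snd N (cyc.pcls down) = snd N' (cyc.pcls down) * P"
    using lift[OF cyc_paths(4)] M(7) M'(7) by simp
  show "P * snd N (cyc.pcls (tail (cube_quiver (Suc 0) {}) e, [e], head (cube_quiver (Suc 0) {}) e))
      = snd N' (cyc.pcls (tail (cube_quiver (Suc 0) {}) e, [e], head (cube_quiver (Suc 0) {}) e)) * P"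
    if "e \<in> arcs (cube_quiver (Suc 0) {})" for e
    using that[unfolded cube_arcs_1] u d by (auto simp: up_def down_def flip_def)
qed

text \<open>If both modules have the matrices \<open>J\<close> and \<open>E\<close> in the bases
  \<open>B\<close> and \<open>B'\<close>, the change of basis \<open>B' * V\<close> is an
  isomorphism. This reduces the classification to normal forms.\<close>

lemma cyc_mod_iso:
  assumes N: "fd_module cyc.A N" "fst N = n" and N': "fd_module cyc.A N'" "fst N' = n"
    and c: "B \<in> carrier_mat n n" "V \<in> carrier_mat n n" "B' \<in> carrier_mat n n" "V' \<in> carrier_mat n n"
      "J \<in> carrier_mat n n" "E \<in> carrier_mat n n"
    and inv: "B * V = 1\<^sub>m n" "V * B = 1\<^sub>m n" "B' * V' = 1\<^sub>m n" "V' * B' = 1\<^sub>m n"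
    and J: "zmat N * B = B * J" "vmat N * B = B * E" "zmat N' * B' = B' * J" "vmat N' * B' = B' * E"
  shows "mod_iso cyc.A N N'"
proof -
  note M = cyc_module(1,2)[OF N] and M' = cyc_module(1,2)[OF N']
  define b v b' v' where "b = opm B" "v = opm V" "b' = opm B'" "v' = opm V'"
  define I where "I = opm (1\<^sub>m n)"
  have i: "b * v = I" "v * b = I" "b' * v' = I" "v' * b' = I"
    using c inv by (simp_all add: b_v_b'_v'_def I_def flip: opm_mult)
  have I: "x * I = x \<and> I * x = x" if "x \<in> opm ` carrier_mat n n" for x
    using that by (auto simp: I_def opm_one_left opm_one_right)
  have transport: "b' * v * x = x' * (b' * v)"
    if "x * b = b * y" "x' * b' = b' * y" "x \<in> opm ` carrier_mat n n" "y \<in> opm ` carrier_mat n n" for x x' y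
  proof -
    have "b' * v * x = b' * v * (x * b) * v" using that(3) I i by (metis mult.assoc)
    also have "\<dots> = b' * (v * b) * y * v" by (simp only: that(1) mult.assoc)
    also have "\<dots> = b' * y * v" using that(4) I i by (metis mult.assoc)
    finally show ?thesis by (simp only: that(2)[symmetric] mult.assoc)
  qed
  have j: "opm (zmat N) * b = b * opm J" "opm (vmat N) * b = b * opm E"
    "opm (zmat N') * b' = b' * opm J" "opm (vmat N') * b' = b' * opm E"
    using c J M M' by (simp_all add: b_v_b'_v'_def flip: opm_mult)
  define P where "P = B' * V"
  have P: "P \<in> carrier_mat n n" "opm P = b' * v" using c by (simp_all add: P_def b_v_b'_v'_def opm_mult)
  have "P * snd N a = snd N' a * P" if "a \<in> carrier cyc.A" for a
  proof (rule cyc_intertwiner[OF N N' P(1) _ _ that])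
    show "opm P * opm (vmat N) = opm (vmat N') * opm P"
      unfolding P(2) using c M by (intro transport[OF j(2,4)]) auto
    show "opm P * opm (zmat N) = opm (zmat N') * opm P"
      unfolding P(2) using c M by (intro transport[OF j(1,3)]) auto
  qed
  moreover have "invertible_mat P"
  proof -
    have "opm (P * (B * V')) = opm (1\<^sub>m n)"
    proof -
      have "opm (P * (B * V')) = b' * (v * b) * v'"
        using P c by (simp add: opm_mult mult.assoc b_v_b'_v'_def)
      then show ?thesis using I[of b'] c i by (simp add: b_v_b'_v'_def I_def)
    qed
    then have 1: "P * (B * V') = 1\<^sub>m n" by (rule opm_inject_carrier) (use P c in auto)
    have 2: "(B * V') * P = 1\<^sub>m n"
      by (rule mat_mult_left_right_inverse[OF P(1) _ 1]) (use c in auto)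
    show ?thesis
      unfolding invertible_mat_def inverts_mat_def
      using 1 2 P(1) c by (auto intro!: exI[of _ "B * V'"])
  qed
  ultimately show ?thesis
    using P N N' by (auto simp: mod_iso_def)
qed

section \<open>Nilpotent modules\<close>

definition shift_mat :: "nat \<Rightarrow> complex mat" where
  "shift_mat n = mat n n (\<lambda>(l, k). if l = Suc k then 1 else 0)"

text \<open>A string under \<open>z\<close> alternates between the two vertices; \<open>u\<close>
  tells whether its even members lie at \<open>{}\<close>.\<close>

definition alt_mat :: "nat \<Rightarrow> bool \<Rightarrow> complex mat" where
  "alt_mat n u = mat n n (\<lambda>(l, k). if l = k \<and> (even k \<longleftrightarrow> u) then 1 else 0)"

definition uniserial :: "cyc_module \<Rightarrow> bool \<Rightarrow> bool" where
  "uniserial N u \<longleftrightarrow> (\<exists>B\<in>carrier_mat (fst N) (fst N). \<exists>V\<in>carrier_mat (fst N) (fst N).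
    B * V = 1\<^sub>m (fst N) \<and> V * B = 1\<^sub>m (fst N) \<and>
    zmat N * B = B * shift_mat (fst N) \<and> vmat N * B = B * alt_mat (fst N) u)"

lemma uniserial_unique:
  assumes "fd_module cyc.A N" "fd_module cyc.A N'" "fst N = fst N'" "uniserial N u" "uniserial N' u"
  shows "mod_iso cyc.A N N'"
proof -
  obtain B V where 1: "B \<in> carrier_mat (fst N) (fst N)" "V \<in> carrier_mat (fst N) (fst N)"
    "B * V = 1\<^sub>m (fst N)" "V * B = 1\<^sub>m (fst N)"
    "zmat N * B = B * shift_mat (fst N)" "vmat N * B = B * alt_mat (fst N) u"
    using assms(4) unfolding uniserial_def by blast
  obtain B' V' where 2: "B' \<in> carrier_mat (fst N) (fst N)" "V' \<in> carrier_mat (fst N) (fst N)"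
    "B' * V' = 1\<^sub>m (fst N)" "V' * B' = 1\<^sub>m (fst N)"
    "zmat N' * B' = B' * shift_mat (fst N)" "vmat N' * B' = B' * alt_mat (fst N) u"
    using assms(5) unfolding uniserial_def assms(3)[symmetric] by blast
  have 3: "shift_mat (fst N) \<in> carrier_mat (fst N) (fst N)" "alt_mat (fst N) u \<in> carrier_mat (fst N) (fst N)"
    by (simp_all add: shift_mat_def alt_mat_def)
  show ?thesis
    by (rule cyc_mod_iso[OF assms(1) refl assms(2) assms(3)[symmetric] 1(1,2) 2(1,2) 3 1(3,4) 2(3,4) 1(5,6) 2(5,6)])
qed

lemma least_power:
  assumes S: "S \<in> carrier_mat n n" and n: "n > 0" and nil: "S ^\<^sub>m m0 = 0\<^sub>m n n"
  obtains m where "m > 0" "S ^\<^sub>m (m - 1) \<noteq> 0\<^sub>m n n" "\<And>i. m \<le> i \<Longrightarrow> opm (S ^\<^sub>m i) = 0"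
proof -
  define m where "m = (LEAST m. S ^\<^sub>m m = 0\<^sub>m n n)"
  have m: "S ^\<^sub>m m = 0\<^sub>m n n" unfolding m_def using nil by (rule LeastI)
  have "1\<^sub>m n $$ (0, 0) \<noteq> (0\<^sub>m n n :: complex mat) $$ (0, 0)" using n by simp
  then have "S ^\<^sub>m 0 \<noteq> 0\<^sub>m n n" using S by (metis carrier_matD(1) pow_mat.simps(1))
  with m have m0: "m > 0" by (metis gr0I)
  have ne: "S ^\<^sub>m (m - 1) \<noteq> 0\<^sub>m n n"
    using not_less_Least[of "m - 1" "\<lambda>m. S ^\<^sub>m m = 0\<^sub>m n n"] m0 unfolding m_def[symmetric] by simp
  have zero: "opm (S ^\<^sub>m i) = 0" if "m \<le> i" for i
  proof -
    have "opm (S ^\<^sub>m i) = opm (S ^\<^sub>m m) * opm (S ^\<^sub>m (i - m))"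
      unfolding opm_pow[OF S] using that by simp
    then show ?thesis by (simp add: m)
  qed
  show ?thesis by (rule that[OF m0 ne zero])
qed

lemma indecomposable_fd: "indecomposable A N \<Longrightarrow> fd_module A N" "indecomposable A N \<Longrightarrow> fst N > 0"
  by (simp_all add: indecomposable_def)

text \<open>With \<open>m\<close> the nilpotency index, the basis is the string of the
  \<open>z^k v\<close> for \<open>k < m\<close>. The test map \<open>D\<close> has to lead from the
  vertex where the string ends back to the one where it starts; then its transfer commutes with the
  vertices too.\<close>

lemma nilpotent_uniserial:
  assumes N: "indecomposable cyc.A N" and nil: "zmat N ^\<^sub>m m0 = 0\<^sub>m (fst N) (fst N)"
  shows "\<exists>u. uniserial N u"
proof -
  define n where "n = fst N"
  note fd = indecomposable_fd(1)[OF N]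
  note M = cyc_module[OF fd n_def[symmetric]]
  define z e I where zeI: "z = opm (zmat N)" "e = opm (vmat N)" "I = opm (1\<^sub>m n)"
  have M': "e * e = e" "z * e + e * z = z" using M(3,4) by (simp_all add: zeI)
  let ?Z = "zmat N"
  have Z: "?Z \<in> carrier_mat n n" by (rule M(2))
  have P: "?Z ^\<^sub>m k \<in> carrier_mat n n" for k using Z by simp
  obtain m where m: "m > 0" "?Z ^\<^sub>m (m - 1) \<noteq> 0\<^sub>m n n" "\<And>i. m \<le> i \<Longrightarrow> opm (?Z ^\<^sub>m i) = 0"
    using least_power[OF Z _ nil[folded n_def]] indecomposable_fd(2)[OF N, folded n_def] by blast
  define zp where "zp k = opm (?Z ^\<^sub>m k)" for k
  have zp: "zp i * zp j = zp (i + j)" for i j unfolding zp_def by (rule opm_pow[OF Z])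
  have zp1: "zp (Suc 0) = z" "zp 0 = I" using Z by (simp_all add: zp_def zeI)
  have zp_zero: "zp i = 0" if "m \<le> i" for i unfolding zp_def by (rule m(3)[OF that])
  have zpI: "I * zp k = zp k" "zp k * I = zp k" for k
    using carrier_matD[OF Z] by (simp_all add: zp_def zeI opm_one_left opm_one_right)
  have eI: "I * e = e" "e * I = e" "I * I = I" "I * z = z" "z * I = z"
    using M Z by (simp_all add: zeI opm_one_left opm_one_right)
  \<comment> \<open>Indexing the two vertices by parity turns \<open>z\<close> into a shift:
    \<open>z^k\<close> maps the image of \<open>Em i\<close> into that of
    \<open>Em (i + k)\<close>.\<close>
  define Em where "Em k = (if even k then vmat N else 1\<^sub>m n - vmat N)" for k :: nat
  define pe where "pe k = opm (Em k)" for k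
  have Em: "Em k \<in> carrier_mat n n" for k using M(1) by (simp add: Em_def minus_carrier_mat)
  have pe_def': "pe k = (if even k then e else I - e)" for k
    using M(1) by (simp add: pe_def Em_def zeI opm_minus)
  have pe_mult: "pe i * pe j = (if even i = even j then pe i else 0)" for i j
    by (simp add: pe_def' algebra_simps eI M')
  have ze: "e * z = z - z * e" using M'(2) by (metis add_diff_cancel_left')
  have zpe1: "z * pe i = pe (Suc i) * z" for i
    by (simp add: pe_def' ze right_diff_distrib left_diff_distrib eI)
  have zpe: "zp k * pe i = pe (i + k) * zp k" for i k
  proof (induction k arbitrary: i)
    case 0
    show ?case by (simp add: zp1 pe_def' algebra_simps eI)
  next
    case (Suc k)
    have s: "zp (Suc k) = zp k * z" using zp[of k "Suc 0"] by (simp add: zp1)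
    have "zp (Suc k) * pe i = zp k * pe (Suc i) * z" by (simp add: s zpe1 mult.assoc)
    also have "zp k * pe (Suc i) = pe (i + Suc k) * zp k"
      using Suc[of "Suc i"] by simp
    finally show ?case by (simp add: s mult.assoc)
  qed
  \<comment> \<open>The highest nonzero power of \<open>z\<close> is nonzero on at least one of the
    two vertices, and the string starts there.\<close>
  have "pe 0 + pe 1 = I" by (simp add: pe_def')
  then have "zp (m - 1) * pe 0 + zp (m - 1) * pe 1 = zp (m - 1)"
    by (simp add: zpI flip: distrib_left)
  moreover have "zp (m - 1) \<noteq> 0"
  proof
    assume "zp (m - 1) = 0"
    then have "opm (?Z ^\<^sub>m (m - 1)) = opm (0\<^sub>m n n)" by (simp add: zp_def)
    then have "?Z ^\<^sub>m (m - 1) = 0\<^sub>m n n" by (rule opm_inject_carrier[OF _ P]) simp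
    then show False using m(2) by simp
  qed
  ultimately obtain u where u: "zp (m - 1) * pe u \<noteq> 0"
    by (metis add.right_neutral)
  \<comment> \<open>The parity of the vertex that the string reaches after \<open>m - 1\<close>
    steps.\<close>
  define l where "l = u + (m - 1)"
  have "pe l * zp (m - 1) * pe u = zp (m - 1) * pe u"
    by (simp add: l_def mult.assoc pe_mult flip: zpe)
  moreover have "opm (Em l * ?Z ^\<^sub>m (m - 1) * Em u) = pe l * zp (m - 1) * pe u"
  proof -
    have "opm (Em l * ?Z ^\<^sub>m (m - 1)) = pe l * zp (m - 1)"
      unfolding pe_def zp_def using carrier_matD(2)[OF Em] carrier_matD[OF Z] by (intro opm_mult) simp
    moreover have "dim_col (Em l * ?Z ^\<^sub>m (m - 1)) = dim_row (Em u)"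
      using carrier_matD(1)[OF Em] carrier_matD[OF Z] by simp
    ultimately show ?thesis by (simp only: opm_mult pe_def)
  qed
  ultimately have ne: "Em l * ?Z ^\<^sub>m (m - 1) * Em u \<noteq> 0\<^sub>m n n"
    using u by auto
  have idem: "Em k * Em k = Em k" for k
  proof (rule opm_inject_carrier)
    show "opm (Em k * Em k) = opm (Em k)"
      using pe_mult[of k k] carrier_matD[OF Em] by (simp add: opm_mult pe_def)
  qed (use Em in auto)
  obtain D i0 j0 where D: "D \<in> carrier_mat n n" and ij0: "i0 < n" "j0 < n" "D $$ (i0, j0) \<noteq> 0"
    and rank: "\<And>i j. i < n \<Longrightarrow> j < n \<Longrightarrow> D $$ (i, j0) * D $$ (i0, j) = D $$ (i0, j0) * D $$ (i, j)"
    and DE: "Em u * D = D" "D * Em l = D" and DXD: "opm D * opm (?Z ^\<^sub>m (m - 1)) * opm D = opm D"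
    by (rule rank_one_test[OF Em Em P idem idem ne]) blast
  define d where "d = opm D"
  have d: "pe u * d = d" "d * pe l = d" "d * zp (m - 1) * d = d"
    using DE DXD D carrier_matD[OF Em] by (simp_all add: d_def pe_def zp_def flip: opm_mult)
  have parity: "pe i = pe j" if "even i = even j" for i j using that by (simp add: pe_def')
  have ped: "pe i * d = (if even i = even u then d else 0)" for i
  proof -
    have "pe i * d = pe i * pe u * d" by (simp only: mult.assoc d(1))
    then show ?thesis using pe_mult[of i u] parity[of i u] d(1) by auto
  qed
  have dpe: "d * pe i = (if even l = even i then d else 0)" for i
  proof -
    have "d * pe i = d * (pe l * pe i)" by (simp only: d(2) flip: mult.assoc)
    then show ?thesis using pe_mult[of l i] d(2) by auto
  qed
  define U W where "U k = ?Z ^\<^sub>m k" and "W k = ?Z ^\<^sub>m (m - 1 - k)" for k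
  have UW: "U k \<in> carrier_mat n n" "W k \<in> carrier_mat n n" for k using P by (simp_all add: U_def W_def)
  have tri: "opm D * opm (W k) * opm (U j) * opm D = 0" if "k < j" "j < m" for k j
  proof -
    have "zp (m - 1 - k) * zp j = 0" unfolding zp by (rule zp_zero) (use that in simp)
    then have "d * (zp (m - 1 - k) * zp j) * d = 0" by simp
    then show ?thesis by (simp only: U_def W_def d_def zp_def mult.assoc)
  qed
  have diag: "opm D * opm (W k) * opm (U k) * opm D = opm D" if "k < m" for k
  proof -
    have "zp (m - 1 - k) * zp k = zp (m - 1)" unfolding zp using that by simp
    then have "d * (zp (m - 1 - k) * zp k) * d = d" using d by simp
    then show ?thesis by (simp only: U_def W_def d_def zp_def mult.assoc)
  qed
  have comm: "\<Theta> * snd N a = snd N a * \<Theta>"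
    if \<Theta>: "\<Theta> \<in> carrier_mat n n" and sum: "opm \<Theta> = (\<Sum>k<m. opm (U k) * opm D * opm (W k))"
      and a: "a \<in> carrier cyc.A" for \<Theta> a
  proof (rule cyc_intertwiner[OF fd n_def[symmetric] fd n_def[symmetric] \<Theta> _ _ a])
    have s: "opm \<Theta> = (\<Sum>k<m. zp k * d * zp (m - 1 - k))"
      unfolding sum by (simp add: U_def W_def zp_def d_def)
    have "e * (zp k * d * zp (m - 1 - k)) = zp k * d * zp (m - 1 - k) * e" if "k < m" for k
    proof -
      let ?j = "m - 1 - k"
      have 1: "e * zp k = zp k * pe k" using zpe[of k k] by (simp add: pe_def')
      have 2: "pe ?j * zp ?j = zp ?j * e" using zpe[of ?j 0] by (simp add: pe_def')
      \<comment> \<open>As \<open>l = u + (m - 1)\<close> and \<open>?j = m - 1 - k\<close>, the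
        numbers \<open>l\<close> and \<open>?j\<close> have the same parity exactly when
        \<open>u\<close> and \<open>k\<close> do.\<close>
      have "even l = even ?j \<longleftrightarrow> even k = even u" using that by (auto simp: l_def)
      then have 3: "pe k * d = d * pe ?j" by (simp add: ped dpe)
      have "e * (zp k * d * zp ?j) = e * zp k * d * zp ?j" by (simp only: mult.assoc)
      also have "\<dots> = zp k * (pe k * d) * zp ?j" by (simp only: 1 mult.assoc)
      also have "\<dots> = zp k * d * (pe ?j * zp ?j)" by (simp only: 3 mult.assoc)
      finally show ?thesis by (simp only: 2 mult.assoc)
    qed
    then show "opm \<Theta> * opm (vmat N) = opm (vmat N) * opm \<Theta>"
      unfolding s zeI(2)[symmetric] sum_distrib_left sum_distrib_right
      by (intro sum.cong) simp_all
    \<comment> \<open>Multiplying the \<open>k\<close>-th summand by \<open>z\<close> gives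
      \<open>f (Suc k)\<close> on the left and \<open>f k\<close> on the right. The difference of
      the sums telescopes to \<open>f m - f 0\<close>, where both terms contain
      \<open>z^m = 0\<close>.\<close>
    define f where "f k = zp k * d * zp (m - k)" for k
    have "z * (zp k * d * zp (m - 1 - k)) = f (Suc k)" for k
      using zp[of "Suc 0" k] by (simp add: zp1 f_def flip: mult.assoc)
    moreover have "zp k * d * zp (m - 1 - k) * z = f k" if "k < m" for k
      using zp[of "m - 1 - k" "Suc 0"] that by (simp add: zp1 f_def mult.assoc Suc_diff_Suc)
    moreover have "(\<Sum>k<m. f (Suc k) - f k) = f m - f 0" by (rule sum_lessThan_telescope)
    moreover have "f m = 0" "f 0 = 0" by (simp_all add: f_def zp_zero)
    ultimately show "opm \<Theta> * opm (zmat N) = opm (zmat N) * opm \<Theta>"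
      unfolding s zeI(1)[symmetric] sum_distrib_left sum_distrib_right by (simp add: sum_subtractf)
  qed
  have basis: "m = n" "\<exists>V\<in>carrier_mat n n. mat n m (\<lambda>(i, k). (U k * D) $$ (i, j0)) * V = 1\<^sub>m n \<and>
    V * mat n m (\<lambda>(i, k). (U k * D) $$ (i, j0)) = 1\<^sub>m n"
    by (rule indecomposable_basis[OF N n_def[symmetric] D ij0 rank UW m(1) tri diag comm]; assumption)+
  define B where "B = mat n n (\<lambda>(i, k). (U k * D) $$ (i, j0))"
  obtain V where V: "V \<in> carrier_mat n n" "B * V = 1\<^sub>m n" "V * B = 1\<^sub>m n"
    using basis by (auto simp: B_def)
  have B: "B \<in> carrier_mat n n" by (simp add: B_def)
  have UD: "U k * D \<in> carrier_mat n n" for k by (rule mult_carrier_mat[OF UW(1) D])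
  have oUD: "opm (U k * D) = zp k * d" for k
    unfolding zp_def d_def U_def using carrier_matD[OF Z] carrier_matD(1)[OF D] by (intro opm_mult) simp
  have XB: "(X * B) $$ (i, k) = (X * (U k * D)) $$ (i, j0)"
    if "X \<in> carrier_mat n n" "i < n" "k < n" for X i k
    unfolding mat_mult_entry[OF that(1) B that(2,3)] mat_mult_entry[OF that(1) UD that(2) ij0(2)]
    using that by (simp add: B_def)
  have zB: "?Z * B = B * shift_mat n"
  proof (rule eq_matI)
    fix i k assume "i < dim_row (B * shift_mat n)" "k < dim_col (B * shift_mat n)"
    then have ik: "i < n" "k < n" by (simp_all add: B_def shift_mat_def)
    have "(B * shift_mat n) $$ (i, k) = (\<Sum>l<n. B $$ (i, l) * shift_mat n $$ (l, k))"
      by (rule mat_mult_entry[OF B _ ik]) (simp add: shift_mat_def)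
    also have "\<dots> = (\<Sum>l<n. if l = Suc k then B $$ (i, l) else 0)"
      using ik by (intro sum.cong refl) (simp add: shift_mat_def)
    also have "\<dots> = (if Suc k < n then (U (Suc k) * D) $$ (i, j0) else 0)"
      using ik by (simp add: B_def)
    also have "\<dots> = (U (Suc k) * D) $$ (i, j0)"
    \<comment> \<open>The last column of the shift is zero, which matches \<open>z^n = 0\<close>
      because the string has length \<open>m = n\<close>.\<close>
    proof (cases "Suc k < n")
      case False
      then have "opm (U (Suc k) * D) = opm (0\<^sub>m n n)" using basis(1) by (simp add: oUD zp_zero)
      then have "U (Suc k) * D = 0\<^sub>m n n" by (rule opm_inject_carrier[OF _ UD]) simp
      then show ?thesis using ik ij0 by simp
    qed simp
    also have "U (Suc k) * D = ?Z * (U k * D)"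
    proof (rule opm_inject_carrier[OF _ UD])
      show "opm (U (Suc k) * D) = opm (?Z * (U k * D))"
        unfolding oUD using zp[of "Suc 0" k] carrier_matD[OF UD] carrier_matD[OF Z]
        by (simp only: opm_mult oUD zp1 flip: zeI mult.assoc) simp
    qed (rule mult_carrier_mat[OF Z UD])
    also have "(?Z * (U k * D)) $$ (i, j0) = (?Z * B) $$ (i, k)"
      using XB[OF Z ik] by simp
    finally show "(?Z * B) $$ (i, k) = (B * shift_mat n) $$ (i, k)" by simp
  qed (use Z B in \<open>auto simp: shift_mat_def\<close>)
  have eB: "vmat N * B = B * alt_mat n (even u)"
  proof (rule eq_matI)
    fix i k assume "i < dim_row (B * alt_mat n (even u))" "k < dim_col (B * alt_mat n (even u))"
    then have ik: "i < n" "k < n" by (simp_all add: B_def alt_mat_def)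
    have "(B * alt_mat n (even u)) $$ (i, k) = (\<Sum>l<n. B $$ (i, l) * alt_mat n (even u) $$ (l, k))"
      by (rule mat_mult_entry[OF B _ ik]) (simp add: alt_mat_def)
    also have "\<dots> = (\<Sum>l<n. if l = k then if even k = even u then B $$ (i, l) else 0 else 0)"
      using ik by (intro sum.cong refl) (simp add: alt_mat_def)
    also have "\<dots> = (if even k = even u then (U k * D) $$ (i, j0) else 0)"
      using ik by (simp add: B_def)
    also have "\<dots> = (vmat N * (U k * D)) $$ (i, j0)"
    proof -
      have "opm (vmat N * (U k * D)) = e * (zp k * d)"
        using carrier_matD[OF UD] carrier_matD[OF M(1)] by (simp add: opm_mult oUD zeI)
      also have "\<dots> = zp k * (pe k * d)"
      proof -
        have "e * zp k = zp k * pe k" using zpe[of k k] by (simp add: pe_def')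
        then show ?thesis by (simp only: mult.assoc[symmetric])
      qed
      also have "\<dots> = (if even k = even u then opm (U k * D) else 0)" by (simp add: ped oUD)
      finally have "vmat N * (U k * D) = (if even k = even u then U k * D else 0\<^sub>m n n)"
        by (intro opm_inject_carrier[of _ _ n n]) (use UD mult_carrier_mat[OF M(1) UD] in auto)
      then show ?thesis using ik ij0 by simp
    qed
    finally show "(vmat N * B) $$ (i, k) = (B * alt_mat n (even u)) $$ (i, k)"
      using XB[OF M(1) ik] by simp
  qed (use M(1) B in \<open>auto simp: alt_mat_def\<close>)
  show ?thesis
    unfolding uniserial_def n_def[symmetric] using V B zB eB by blast
qed

section \<open>Invertible modules\<close>

lemma sum_double: "(\<Sum>k<2 * r. f k) = (\<Sum>k<r. f k) + (\<Sum>k<r. f (r + k))" for f :: "nat \<Rightarrow> 'a::comm_monoid_add"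
proof -
  have "(\<Sum>i<2. g i) = g 0 + g 1" for g :: "nat \<Rightarrow> 'a"
    by (simp add: numeral_2_eq_2)
  then show ?thesis
    using sum_div_mod[where h = "\<lambda>i q. f (i * r + q)" and d = r and n = 2] by simp
qed

definition jordan_v :: "nat \<Rightarrow> complex mat" where
  "jordan_v r = mat (2 * r) (2 * r) (\<lambda>(i, j). if i = j \<and> i < r then 1 else 0)"

text \<open>The matrix of \<open>z\<close> in the basis \<open>s^k v\<close>, followed by
  \<open>z s^k v\<close>, where \<open>s = z^2 - l\<close>: the first half goes identically to the
  second, and the second returns to the first by the Jordan block of
  \<open>z^2 = l + s\<close>.\<close>

definition jordan_z :: "nat \<Rightarrow> complex \<Rightarrow> complex mat" where
  "jordan_z r l = mat (2 * r) (2 * r) (\<lambda>(i, j).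
    if j < r then if i = r + j then 1 else 0
    else if i < r then if i = j - r then l else if i = Suc (j - r) then 1 else 0 else 0)"

text \<open>The square of \<open>z\<close> commutes with \<open>e\<close> and \<open>z\<close>;
  subtracting an eigenvalue \<open>l\<close> gives an endomorphism that is not invertible, hence
  nilpotent. A string under it at the vertex \<open>{}\<close> and the image of this string under
  \<open>z\<close> at the other vertex form the basis.\<close>

lemma invertible_normal_form:
  assumes N: "indecomposable cyc.A N" and n: "fst N = n"
    and V0: "V0 \<in> carrier_mat n n" "zmat N * zmat N * V0 = 1\<^sub>m n"
  shows "\<exists>r l. n = 2 * r \<and> (\<exists>B\<in>carrier_mat n n. \<exists>V\<in>carrier_mat n n. B * V = 1\<^sub>m n \<and> V * B = 1\<^sub>m n \<and>
    zmat N * B = B * jordan_z r l \<and> vmat N * B = B * jordan_v r)"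
proof -
  note fd = indecomposable_fd(1)[OF N]
  note M = cyc_module[OF fd n]
  have n0: "n > 0" using indecomposable_fd(2)[OF N] n by simp
  let ?Z = "zmat N"
  define T where "T = ?Z * ?Z"
  note Z = M(2)
  have T: "T \<in> carrier_mat n n" unfolding T_def by (rule mult_carrier_mat[OF Z Z])
  define z e I where zeI: "z = opm ?Z" "e = opm (vmat N)" "I = opm (1\<^sub>m n)"
  have M': "e * e = e" "z * e + e * z = z" using M(3,4) by (simp_all add: zeI)
  have I: "opm X * I = opm X" "I * opm X = opm X" if "X \<in> carrier_mat n n" for X
    using that by (simp_all add: zeI opm_one_left opm_one_right)
  have zI: "I * z = z" "z * I = z" "I * e = e" "e * I = e"
    using M(1,2) by (simp_all add: I zeI(1,2))
  have ez: "e * z = z - z * e" using M'(2) by (metis add_diff_cancel_left')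
  \<comment> \<open>The inverse of \<open>z\<close>, as \<open>z * z * V0\<close> is the
    identity.\<close>
  define Z' where "Z' = ?Z * V0"
  define z' where "z' = opm Z'"
  have Z': "Z' \<in> carrier_mat n n" unfolding Z'_def by (rule mult_carrier_mat[OF Z V0(1)])
  have "?Z * Z' = 1\<^sub>m n" unfolding Z'_def using V0(2) assoc_mult_mat[OF Z Z V0(1)] by simp
  moreover from mat_mult_left_right_inverse[OF Z Z' this] have "Z' * ?Z = 1\<^sub>m n" .
  ultimately have zz': "z * z' = I" "z' * z = I"
    using Z Z' by (simp_all add: zeI z'_def flip: opm_mult)
  have z'I: "z' * I = z'" "I * z' = z'" using Z' by (simp_all add: I z'_def)
  have z'e: "z' * e = z' - e * z'"
  proof -
    have "z' * e = z' * (e * z) * z'" by (simp add: mult.assoc zz' zI)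
    also have "\<dots> = z' * z * z' - z' * z * (e * z')"
      by (simp only: ez right_diff_distrib left_diff_distrib mult.assoc)
    also have "\<dots> = z' - I * e * z'" by (simp only: zz' z'I mult.assoc)
    finally show ?thesis by (simp add: zI)
  qed
  obtain l where "l \<in> spectrum T" using spectrum_non_empty[OF T n0] by auto
  then obtain v where "eigenvector T v l" by (auto simp: spectrum_def eigenvalue_def)
  define S where "S = char_matrix T l"
  have v: "v \<in> carrier_vec n" "v \<noteq> 0\<^sub>v n" "S *\<^sub>v v = 0\<^sub>v n"
    using \<open>eigenvector T v l\<close> eigenvector_char_matrix[OF T] by (auto simp: S_def)
  have S: "S \<in> carrier_mat n n" using T by (simp add: S_def char_matrix_def)
  define L where "L = opm (l \<cdot>\<^sub>m 1\<^sub>m n)"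
  define s t where "s = opm S" "t = opm T"
  have t: "t = z * z" using Z by (simp add: s_t_def T_def zeI opm_mult)
  have s: "s + L = t"
  proof -
    have "S + l \<cdot>\<^sub>m 1\<^sub>m n = T" using T by (intro eq_matI) (auto simp: S_def char_matrix_def)
    then show ?thesis using S by (simp add: s_t_def L_def flip: opm_add)
  qed
  have L: "L * opm X = opm X * L" if "X \<in> carrier_mat n n" for X
    using that by (simp add: L_def opm_smult_one)
  have te: "t * e = e * t" "t * z = z * t"
    using M'(2) unfolding t by (simp_all add: mult.assoc) (metis distrib_left distrib_right add.commute add_left_cancel mult.assoc)
  have s': "s = t - L" using s by (simp add: eq_diff_eq)
  have se: "s * e = e * s" "s * z = z * s"
    using te L[OF M(1)] L[OF Z] unfolding s' by (simp_all add: zeI(1,2) left_diff_distrib right_diff_distrib)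
  have sz': "s * z' = z' * s"
  proof -
    have "s * z' = z' * z * s * z'" by (simp add: zz' s_t_def I[OF S])
    also have "\<dots> = z' * (z * s) * z'" by (simp only: mult.assoc)
    also have "\<dots> = z' * s * (z * z')" by (simp only: se(2)[symmetric] mult.assoc)
    also have "\<dots> = z' * s" by (simp add: zz' s_t_def I[OF S] mult.assoc)
    finally show ?thesis .
  qed
  have "S * snd N a = snd N a * S" if "a \<in> carrier cyc.A" for a
    by (rule cyc_intertwiner[OF fd n fd n S _ _ that]) (use se in \<open>simp_all add: s_t_def zeI\<close>)
  \<comment> \<open>\<open>S\<close> kills an eigenvector, so the invertible alternative is
    excluded.\<close>
  from fitting[OF N S[folded n] this, unfolded n] obtain m0 where nil: "S ^\<^sub>m m0 = 0\<^sub>m n n"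
  proof
    assume "\<exists>V\<in>carrier_mat n n. S * V = 1\<^sub>m n"
    then obtain V where V: "V \<in> carrier_mat n n" "S * V = 1\<^sub>m n" by auto
    have "v = (V * S) *\<^sub>v v" using mat_mult_left_right_inverse[OF S V] v by simp
    also have "\<dots> = V *\<^sub>v (S *\<^sub>v v)" by (rule assoc_mult_mat_vec[OF V(1) S v(1)])
    also have "\<dots> = 0\<^sub>v n" unfolding v(3) using V(1) by (intro eq_vecI) auto
    finally show ?thesis using v(2) by simp
  qed auto
  obtain r where r: "r > 0" "S ^\<^sub>m (r - 1) \<noteq> 0\<^sub>m n n" "\<And>i. r \<le> i \<Longrightarrow> opm (S ^\<^sub>m i) = 0"
    using least_power[OF S n0 nil] by blast
  have P: "S ^\<^sub>m k \<in> carrier_mat n n" for k using S by simp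
  define sp where "sp k = opm (S ^\<^sub>m k)" for k
  have sp: "sp i * sp j = sp (i + j)" for i j unfolding sp_def by (rule opm_pow[OF S])
  have sp1: "sp (Suc 0) = s" "sp 0 = I" using S by (simp_all add: sp_def s_t_def zeI)
  have sp_zero: "sp i = 0" if "r \<le> i" for i unfolding sp_def by (rule r(3)[OF that])
  have spI: "sp k * I = sp k" "I * sp k = sp k" for k unfolding sp_def by (rule I[OF P])+
  have spe: "sp k * e = e * sp k" "sp k * z = z * sp k" "sp k * z' = z' * sp k" for k
    unfolding sp_def zeI z'_def
    by (rule opm_pow_commute[OF S]; use M(1) Z Z' se sz' in \<open>simp add: s_t_def zeI z'_def\<close>)+
  have ne0: "sp (r - 1) \<noteq> 0"
  proof
    assume "sp (r - 1) = 0"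
    then have "opm (S ^\<^sub>m (r - 1)) = opm (0\<^sub>m n n)" by (simp add: sp_def)
    then have "S ^\<^sub>m (r - 1) = 0\<^sub>m n n" by (rule opm_inject_carrier[OF _ P]) simp
    then show False using r(2) by simp
  qed
  \<comment> \<open>The string has to start at \<open>{}\<close>. Since the invertible
    \<open>z\<close> exchanges the two vertices and commutes with \<open>s\<close>, a power of
    \<open>s\<close> that vanishes at \<open>{}\<close> vanishes at both.\<close>
  have ne1: "sp (r - 1) * e \<noteq> 0"
  proof
    assume 0: "sp (r - 1) * e = 0"
    have "sp (r - 1) = sp (r - 1) * (z * e + e * z) * z'"
      unfolding M'(2) by (simp only: mult.assoc zz' spI)
    also have "\<dots> = (z * (sp (r - 1) * e) + sp (r - 1) * e * z) * z'"
      by (simp only: distrib_left spe(2)[symmetric] mult.assoc[symmetric])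
    finally have "sp (r - 1) = 0" unfolding 0 by simp
    then show False using ne0 by simp
  qed
  have idem: "vmat N * vmat N = vmat N"
    using M(1,3) by (intro opm_inject_carrier[of _ _ n n]) (simp_all add: opm_mult)
  have "vmat N * S ^\<^sub>m (r - 1) * vmat N \<noteq> 0\<^sub>m n n"
  proof
    assume "vmat N * S ^\<^sub>m (r - 1) * vmat N = 0\<^sub>m n n"
    then have "opm (vmat N * S ^\<^sub>m (r - 1) * vmat N) = 0" by simp
    moreover have "opm (vmat N * S ^\<^sub>m (r - 1) * vmat N) = e * sp (r - 1) * e"
    proof -
      have "opm (vmat N * S ^\<^sub>m (r - 1)) = e * sp (r - 1)"
        unfolding zeI sp_def using carrier_matD[OF M(1)] carrier_matD[OF S] by (intro opm_mult) simp
      moreover have "dim_col (vmat N * S ^\<^sub>m (r - 1)) = dim_row (vmat N)"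
        using carrier_matD[OF M(1)] carrier_matD[OF S] by simp
      ultimately show ?thesis by (simp only: opm_mult zeI)
    qed
    moreover have "e * sp (r - 1) * e = sp (r - 1) * e"
      by (simp only: spe(1)[symmetric] mult.assoc M')
    ultimately show False using ne1 by simp
  qed
  from rank_one_test[OF M(1) M(1) P idem idem this]
  obtain D i0 j0 where D: "D \<in> carrier_mat n n" and ij0: "i0 < n" "j0 < n" "D $$ (i0, j0) \<noteq> 0"
    and rank: "\<And>i j. i < n \<Longrightarrow> j < n \<Longrightarrow> D $$ (i, j0) * D $$ (i0, j) = D $$ (i0, j0) * D $$ (i, j)"
    and DE: "vmat N * D = D" "D * vmat N = D" and DXD: "opm D * opm (S ^\<^sub>m (r - 1)) * opm D = opm D"
    by blast
  define d where "d = opm D"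
  have d: "e * d = d" "d * e = d"
    using DE D M(1) by (simp_all add: d_def zeI flip: opm_mult)
  have dd: "d * sp (r - 1) * d = d" using DXD unfolding d_def sp_def .
  \<comment> \<open>The vectors with index at least \<open>r\<close> are moved to the other vertex
    by \<open>z\<close>, so the matching functionals first bring them back by the inverse of
    \<open>z\<close>.\<close>
  define U where "U k = (if k < r then S ^\<^sub>m k else ?Z * S ^\<^sub>m (k - r))" for k
  define W where "W k = (if k < r then S ^\<^sub>m (r - 1 - k) else S ^\<^sub>m (r - 1 - (k - r)) * Z')" for k
  have UW: "U k \<in> carrier_mat n n" "W k \<in> carrier_mat n n" for k
    unfolding U_def W_def using P mult_carrier_mat[OF Z P] mult_carrier_mat[OF P Z'] by simp_all
  have oU: "opm (U k) = (if k < r then sp k else z * sp (k - r))" for k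
    unfolding U_def sp_def zeI using carrier_matD[OF Z] carrier_matD[OF S] by (simp add: opm_mult)
  have oW: "opm (W k) = (if k < r then sp (r - 1 - k) else sp (r - 1 - (k - r)) * z')" for k
    unfolding W_def sp_def z'_def using carrier_matD[OF Z'] carrier_matD[OF S] by (simp add: opm_mult)
  have core: "d * sp (r - 1 - a) * sp b * d = (if a = b then d else 0)" if "a \<le> b" "b < r" for a b
  proof -
    have "d * sp (r - 1 - a) * sp b * d = d * sp (r - 1 - a + b) * d"
      by (simp only: mult.assoc flip: sp)
    moreover have "r - 1 - a + b = r - 1" if "a = b" using that \<open>b < r\<close> by simp
    moreover have "sp (r - 1 - a + b) = 0" if "a \<noteq> b" by (rule sp_zero) (use that \<open>a \<le> b\<close> \<open>b < r\<close> in simp)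
    ultimately show ?thesis using dd by simp
  qed
  have eze: "e * z * e = 0" by (simp add: ez left_diff_distrib mult.assoc M')
  \<comment> \<open>The vector and the functional of \<open>d\<close> both sit at \<open>{}\<close>,
    while a single \<open>z\<close> between them leads to the other vertex.\<close>
  have cross: "d * sp a * (z * sp b) * d = 0" for a b
  proof -
    have "d * sp a * (z * sp b) * d = d * e * sp a * (z * sp b) * (e * d)" by (simp only: d)
    also have "\<dots> = d * (e * sp a) * z * (sp b * e) * d" by (simp only: mult.assoc)
    also have "\<dots> = d * sp a * (e * z * e) * sp b * d" by (simp only: spe(1) mult.assoc) (simp only: spe(1)[symmetric] mult.assoc[symmetric])
    finally show ?thesis by (simp add: eze)
  qed
  have round: "d * (sp a * z') * (z * sp b) * d = d * sp a * sp b * d" for a b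
  proof -
    have "d * (sp a * z') * (z * sp b) * d = d * sp a * (z' * z) * sp b * d" by (simp only: mult.assoc)
    also have "\<dots> = d * (sp a * I) * sp b * d" by (simp only: zz' mult.assoc)
    finally show ?thesis by (simp only: spI)
  qed
  have tri: "opm D * opm (W k) * opm (U j) * opm D = 0" if kj: "k < j" "j < 2 * r" for k j
  proof -
    \<comment> \<open>Both indices in the first half, one in each half, or both in the second;
      \<open>k < j\<close> rules out the fourth combination.\<close>
    consider "k < r" "j < r" | "k < r" "r \<le> j" | "r \<le> k" "r \<le> j" using kj by linarith
    then show ?thesis
    proof cases
      case 1
      then show ?thesis using core[of k j] kj by (simp add: oU oW flip: d_def)
    next
      case 2
      then show ?thesis using cross[of "r - 1 - k" "j - r"] by (simp add: oU oW flip: d_def)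
    next
      case 3
      moreover have "k - r < j - r" "j - r < r" using 3 kj by linarith+
      ultimately show ?thesis using core[of "k - r" "j - r"] round[of "r - 1 - (k - r)" "j - r"]
        by (simp add: oU oW flip: d_def)
    qed
  qed
  have diag: "opm D * opm (W k) * opm (U k) * opm D = opm D" if k: "k < 2 * r" for k
  proof (cases "k < r")
    case True
    then show ?thesis using core[of k k] by (simp add: oU oW flip: d_def)
  next
    case False
    then show ?thesis using core[of "k - r" "k - r"] round[of "r - 1 - (k - r)" "k - r"] k
      by (simp add: oU oW flip: d_def)
  qed
  have comm: "\<Theta> * snd N a = snd N a * \<Theta>"
    if \<Theta>: "\<Theta> \<in> carrier_mat n n" and sum: "opm \<Theta> = (\<Sum>k<2 * r. opm (U k) * opm D * opm (W k))"
      and a: "a \<in> carrier cyc.A" for \<Theta> a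
  proof (rule cyc_intertwiner[OF fd n fd n \<Theta> _ _ a])
    \<comment> \<open>\<open>\<theta>\<close> is the transfer at \<open>{}\<close>, and
      \<open>z * \<theta> * z'\<close> is its copy at \<open>{0}\<close>. By telescoping
      \<open>\<theta>\<close> commutes with \<open>s\<close>, hence with \<open>t = z^2\<close>, and
      then \<open>\<Theta> z\<close> and \<open>z \<Theta>\<close> both equal
      \<open>z \<theta> + \<theta> z\<close>.\<close>
    define \<theta> where "\<theta> = (\<Sum>k<r. sp k * d * sp (r - 1 - k))"
    have \<Theta>s: "opm \<Theta> = \<theta> + z * \<theta> * z'"
      unfolding sum sum_double \<theta>_def
      by (simp add: oU oW sum_distrib_left sum_distrib_right mult.assoc flip: d_def)
    define f where "f k = sp k * d * sp (r - k)" for k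
    have "s * (sp k * d * sp (r - 1 - k)) = f (Suc k)" for k
      using sp[of "Suc 0" k] by (simp add: sp1 f_def flip: mult.assoc)
    moreover have "sp k * d * sp (r - 1 - k) * s = f k" if "k < r" for k
      using sp[of "r - 1 - k" "Suc 0"] that by (simp add: sp1 f_def mult.assoc Suc_diff_Suc)
    moreover have "(\<Sum>k<r. f (Suc k) - f k) = f r - f 0" by (rule sum_lessThan_telescope)
    moreover have "f r = 0" "f 0 = 0" by (simp_all add: f_def sp_zero)
    ultimately have "s * \<theta> = \<theta> * s"
      unfolding \<theta>_def sum_distrib_left sum_distrib_right by (simp add: sum_subtractf)
    moreover have "L * \<theta> = \<theta> * L"
    proof -
      have "L * sp k = sp k * L" "L * d = d * L" for k
        unfolding sp_def d_def by (rule L[OF P], rule L[OF D])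
      then have "L * (sp k * d * sp j) = sp k * d * sp j * L" for k j by (metis mult.assoc)
      then show ?thesis unfolding \<theta>_def sum_distrib_left sum_distrib_right by simp
    qed
    ultimately have t\<theta>: "t * \<theta> = \<theta> * t" unfolding s[symmetric] by (simp add: distrib_left distrib_right)
    have \<theta>I: "\<theta> * I = \<theta>" unfolding \<theta>_def by (simp add: sum_distrib_right mult.assoc spI)
    have e\<theta>: "e * \<theta> = \<theta>" "\<theta> * e = \<theta>"
    proof -
      have "e * (sp k * d * sp j) = sp k * d * sp j" "sp k * d * sp j * e = sp k * d * sp j" for k j
      proof -
        have "e * (sp k * d * sp j) = (e * sp k) * d * sp j" by (simp only: mult.assoc)
        also have "\<dots> = sp k * (e * d) * sp j" by (simp only: spe(1)[symmetric] mult.assoc)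
        finally show "e * (sp k * d * sp j) = sp k * d * sp j" by (simp only: d)
        have "sp k * d * sp j * e = sp k * d * (sp j * e)" by (simp only: mult.assoc)
        also have "\<dots> = sp k * (d * e) * sp j" by (simp only: spe(1) mult.assoc)
        finally show "sp k * d * sp j * e = sp k * d * sp j" by (simp only: d)
      qed
      then show "e * \<theta> = \<theta>" "\<theta> * e = \<theta>"
        unfolding \<theta>_def sum_distrib_left sum_distrib_right by simp_all
    qed
    have "e * (z * \<theta> * z') = 0"
    proof -
      have "e * (z * \<theta> * z') = (e * z) * \<theta> * z'" by (simp only: mult.assoc)
      also have "\<dots> = z * (\<theta> - e * \<theta>) * z'" by (simp only: ez left_diff_distrib right_diff_distrib mult.assoc)
      finally show ?thesis by (simp add: e\<theta>)
    qed
    moreover have "z * \<theta> * z' * e = 0"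
    proof -
      have "z * \<theta> * z' * e = z * \<theta> * (z' * e)" by (simp only: mult.assoc)
      also have "\<dots> = z * (\<theta> - \<theta> * e) * z'" by (simp only: z'e left_diff_distrib right_diff_distrib mult.assoc)
      finally show ?thesis by (simp add: e\<theta>)
    qed
    ultimately show "opm \<Theta> * opm (vmat N) = opm (vmat N) * opm \<Theta>"
      unfolding \<Theta>s zeI(2)[symmetric] by (simp add: distrib_left distrib_right e\<theta>)
    have "z * (z * \<theta> * z') = t * \<theta> * z'" by (simp only: t mult.assoc)
    also have "\<dots> = \<theta> * (z * (z * z'))" by (simp only: t\<theta>) (simp only: t mult.assoc)
    finally have 1: "z * (z * \<theta> * z') = \<theta> * z" by (simp only: zz' zI)
    have "z * \<theta> * z' * z = z * (\<theta> * (z' * z))" by (simp only: mult.assoc)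
    then have 2: "z * \<theta> * z' * z = z * \<theta>" by (simp only: zz' \<theta>I)
    show "opm \<Theta> * opm ?Z = opm ?Z * opm \<Theta>"
      unfolding \<Theta>s zeI(1)[symmetric] distrib_left distrib_right 1 2 by (rule add.commute)
  qed
  have r2: "0 < 2 * r" using r(1) by simp
  have basis: "2 * r = n" "\<exists>V\<in>carrier_mat n n. mat n (2 * r) (\<lambda>(i, k). (U k * D) $$ (i, j0)) * V = 1\<^sub>m n \<and>
    V * mat n (2 * r) (\<lambda>(i, k). (U k * D) $$ (i, j0)) = 1\<^sub>m n"
    by (rule indecomposable_basis[OF N n D ij0 rank UW r2 tri diag comm]; assumption)+
  define B where "B = mat n n (\<lambda>(i, k). (U k * D) $$ (i, j0))"
  obtain V where V: "V \<in> carrier_mat n n" "B * V = 1\<^sub>m n" "V * B = 1\<^sub>m n"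
    using basis(2) unfolding basis(1) B_def by blast
  have B: "B \<in> carrier_mat n n" by (simp add: B_def)
  have UD: "U k * D \<in> carrier_mat n n" for k by (rule mult_carrier_mat[OF UW(1) D])
  have oUD: "opm (U k * D) = opm (U k) * d" for k
    unfolding d_def using carrier_matD[OF UW(1)] carrier_matD(1)[OF D] by (intro opm_mult) simp
  have XB: "(X * B) $$ (i, k) = (X * (U k * D)) $$ (i, j0)"
    if "X \<in> carrier_mat n n" "i < n" "k < n" for X i k
    unfolding mat_mult_entry[OF that(1) B that(2,3)] mat_mult_entry[OF that(1) UD that(2) ij0(2)]
    using that by (simp add: B_def)
  have Bk: "B $$ (i, k) = (U k * D) $$ (i, j0)" if "i < n" "k < n" for i k
    using that by (simp add: B_def)
  have BJ: "(B * J) $$ (i, k) = (\<Sum>q<r. B $$ (i, q) * J $$ (q, k)) + (\<Sum>q<r. B $$ (i, r + q) * J $$ (r + q, k))"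
    if "J \<in> carrier_mat n n" "i < n" "k < n" for J i k
    unfolding mat_mult_entry[OF B that] basis(1)[symmetric] by (rule sum_double)
  have Jc: "jordan_z r l \<in> carrier_mat n n" "jordan_v r \<in> carrier_mat n n"
    by (simp_all add: jordan_z_def jordan_v_def basis(1))
  have zB: "?Z * B = B * jordan_z r l"
  proof (rule eq_matI)
    fix i k assume "i < dim_row (B * jordan_z r l)" "k < dim_col (B * jordan_z r l)"
    then have ik: "i < n" "k < n" using B Jc by auto
    have op: "opm (?Z * (U k * D)) = z * (opm (U k) * d)"
      using carrier_matD[OF UD] carrier_matD[OF Z] by (simp add: opm_mult oUD zeI)
    have ZUD: "?Z * (U k * D) \<in> carrier_mat n n" by (rule mult_carrier_mat[OF Z UD])
    show "(?Z * B) $$ (i, k) = (B * jordan_z r l) $$ (i, k)"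
    proof (cases "k < r")
      case True
      have "(B * jordan_z r l) $$ (i, k) = (\<Sum>q<r. if q = k then B $$ (i, r + q) else 0)"
        unfolding BJ[OF Jc(1) ik] using True ik basis(1)
        by (simp add: jordan_z_def if_distrib[of "\<lambda>x. _ * x"] cong: if_cong)
      also have "\<dots> = B $$ (i, r + k)" using True by simp
      also have "\<dots> = (U (r + k) * D) $$ (i, j0)"
        using ik True basis(1) by (intro Bk) auto
      also have "U (r + k) * D = ?Z * (U k * D)"
        by (rule opm_inject_carrier[OF _ UD ZUD]) (use True in \<open>simp add: op oUD oU mult.assoc\<close>)
      finally show ?thesis using XB[OF Z ik] by simp
    next
      case False
      let ?k = "k - r"
      have k: "?k < r" using False ik basis(1) by linarith
      have "(B * jordan_z r l) $$ (i, k) = (\<Sum>q<r. (if q = ?k then B $$ (i, q) * l else 0) + (if q = Suc ?k then B $$ (i, q) else 0))"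
      proof -
        have "(\<Sum>q<r. B $$ (i, q) * jordan_z r l $$ (q, k))
            = (\<Sum>q<r. (if q = ?k then B $$ (i, q) * l else 0) + (if q = Suc ?k then B $$ (i, q) else 0))"
          using False ik basis(1) by (intro sum.cong refl) (simp add: jordan_z_def)
        moreover have "(\<Sum>q<r. B $$ (i, r + q) * jordan_z r l $$ (r + q, k)) = 0"
          using False ik basis(1) by (intro sum.neutral) (simp add: jordan_z_def)
        ultimately show ?thesis unfolding BJ[OF Jc(1) ik] by simp
      qed
      also have "\<dots> = B $$ (i, ?k) * l + (if Suc ?k < r then B $$ (i, Suc ?k) else 0)"
        using k by (simp add: sum.distrib)
      \<comment> \<open>Applying \<open>z\<close> to \<open>z s^q v\<close> with
        \<open>q = k - r\<close> gives \<open>l s^q v + s^(q+1) v\<close>. For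
        \<open>q = r - 1\<close> the second term vanishes, which is the case distinction on
        \<open>Suc ?k < r\<close>.\<close>
      also have "\<dots> = (l \<cdot>\<^sub>m (U ?k * D) + (if Suc ?k < r then U (Suc ?k) * D else 0\<^sub>m n n)) $$ (i, j0)"
        using k ik basis(1) ij0 carrier_matD[OF UD] by (simp add: Bk)
      also have "l \<cdot>\<^sub>m (U ?k * D) + (if Suc ?k < r then U (Suc ?k) * D else 0\<^sub>m n n) = ?Z * (U k * D)"
      proof (rule opm_inject_carrier[OF _ _ ZUD])
        have A: "(if Suc ?k < r then U (Suc ?k) * D else 0\<^sub>m n n) \<in> carrier_mat n n" using UD by simp
        show "l \<cdot>\<^sub>m (U ?k * D) + (if Suc ?k < r then U (Suc ?k) * D else 0\<^sub>m n n) \<in> carrier_mat n n"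
          using UD A by simp
        have "opm (if Suc ?k < r then U (Suc ?k) * D else 0\<^sub>m n n) = s * sp ?k * d"
          using sp[of "Suc 0" ?k] sp_zero[of "Suc ?k"] k by (simp add: oUD oU sp1)
        moreover have "opm (l \<cdot>\<^sub>m (U ?k * D)) = L * sp ?k * d"
          using k unfolding L_def opm_smult_one(1)[OF UD, symmetric] by (simp add: oUD oU mult.assoc)
        moreover have "opm (?Z * (U k * D)) = t * sp ?k * d"
          using False by (simp add: op oU t mult.assoc)
        moreover have "opm (l \<cdot>\<^sub>m (U ?k * D) + (if Suc ?k < r then U (Suc ?k) * D else 0\<^sub>m n n))
            = opm (l \<cdot>\<^sub>m (U ?k * D)) + opm (if Suc ?k < r then U (Suc ?k) * D else 0\<^sub>m n n)"
          using carrier_matD[OF UD] carrier_matD[OF A] by (intro opm_add) auto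
        ultimately show "opm (l \<cdot>\<^sub>m (U ?k * D) + (if Suc ?k < r then U (Suc ?k) * D else 0\<^sub>m n n)) = opm (?Z * (U k * D))"
          by (simp add: s[symmetric] distrib_right add.commute)
      qed
      finally show ?thesis using XB[OF Z ik] by simp
    qed
  qed (use Z B Jc in auto)
  have eB: "vmat N * B = B * jordan_v r"
  proof (rule eq_matI)
    fix i k assume "i < dim_row (B * jordan_v r)" "k < dim_col (B * jordan_v r)"
    then have ik: "i < n" "k < n" using B Jc by auto
    have op: "opm (vmat N * (U k * D)) = e * (opm (U k) * d)"
      using carrier_matD[OF UD] carrier_matD[OF M(1)] by (simp add: opm_mult oUD zeI)
    have eUD: "vmat N * (U k * D) = (if k < r then U k * D else 0\<^sub>m n n)"
    proof (rule opm_inject_carrier[OF _ mult_carrier_mat[OF M(1) UD]])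
      have "e * (sp k * d) = sp k * d"
      proof -
        have "e * (sp k * d) = sp k * (e * d)" by (simp only: spe(1)[symmetric] mult.assoc[symmetric])
        then show ?thesis by (simp only: d)
      qed
      moreover have "e * (z * sp (k - r) * d) = 0"
      proof -
        have "e * (z * sp (k - r) * d) = e * z * (sp (k - r) * e) * d"
          by (simp only: d mult.assoc)
        also have "\<dots> = e * z * e * sp (k - r) * d" by (simp only: spe(1) mult.assoc)
        finally show ?thesis by (simp add: eze)
      qed
      ultimately show "opm (vmat N * (U k * D)) = opm (if k < r then U k * D else 0\<^sub>m n n)"
        by (simp add: op oUD oU)
    qed (use UD in auto)
    have "(B * jordan_v r) $$ (i, k) = (\<Sum>q<r. if q = k then B $$ (i, q) else 0)"
      unfolding BJ[OF Jc(2) ik] using ik basis(1)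
      by (simp add: jordan_v_def if_distrib[of "\<lambda>x. _ * x"] cong: if_cong)
    also have "\<dots> = (vmat N * (U k * D)) $$ (i, j0)"
      using ik ij0 by (simp add: eUD Bk)
    finally show "(vmat N * B) $$ (i, k) = (B * jordan_v r) $$ (i, k)"
      using XB[OF M(1) ik] by simp
  qed (use M(1) B Jc in auto)
  show ?thesis
    using basis(1) B V zB eB by (intro exI[of _ r] exI[of _ l] conjI bexI[of _ B] bexI[of _ V]) auto
qed

section \<open>The one-parameter family\<close>

lemma fd_point_module: "fd_module (type_alg Polynomial.smult) (point_module l)"
proof -
  have "mat 1 1 (\<lambda>_. a) * mat 1 1 (\<lambda>_. b) = mat 1 1 (\<lambda>_. a * b :: complex)" for a b
    by (rule eq_matI) (auto simp: scalar_prod_def)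
  then show ?thesis
    by (auto simp: fd_module_iff point_module_def type_alg_def intro!: eq_matI)
qed

lemma tensor_point_module:
  assumes "snd M a \<in> carrier_mat (fst M) (fst M)"
  shows "snd (tensor_mod M (point_module l)) a = map_mat (\<lambda>p. poly p l) (snd M a)"
  using assms by (intro eq_matI) (auto simp: tensor_mod_def point_module_def Let_def)

text \<open>The block construction used for wildness, now over the polynomial ring: the arrow that
  inserts 0 acts by the identity and the opposite arrow by a Jordan block whose eigenvalue is the
  variable. Specializing the variable to \<open>l\<close> gives the normal form.\<close>

lemma one_parameter_family:
  obtains M where "free_bimodule cyc.A Polynomial.smult M" "fst M = 2 * r"
    "\<And>l. vmat (tensor_mod M (point_module l)) = jordan_v r"
    "\<And>l. zmat (tensor_mod M (point_module l)) = jordan_z r l"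
proof -
  let ?Q = "cube_quiver (Suc 0) {}"
  define X :: "complex poly mat" where
    "X = mat r r (\<lambda>(i, j). if i = j then [:0, 1:] else if i = Suc j then 1 else 0)"
  define ix :: "nat set \<Rightarrow> nat" where "ix v = (if v = {} then 0 else 1)" for v
  have card: "card (verts ?Q) = 2" by (simp add: cube_verts_1)
  interpret W: weighted_quiver ?Q "path_equiv ?Q" Polynomial.smult "descent 0" "\<lambda>_. 0" ix r X "1\<^sub>m r"
  proof unfold_locales
    show "bij_betw ix (verts ?Q) {..<card (verts ?Q)}"
      unfolding card by (auto simp: bij_betw_def inj_on_def cube_verts_1 ix_def)
    show "X \<in> carrier_mat r r" "1\<^sub>m r \<in> carrier_mat r r" "X * 1\<^sub>m r = 1\<^sub>m r * X"
      by (simp_all add: X_def)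
    fix u p v u' p' v'
    assume r: "((u, p, v), (u', p', v')) \<in> path_equiv ?Q"
    then show "u = u' \<and> v = v' \<and> sum_list (map (descent 0) p) = sum_list (map (descent 0) p') \<and>
        sum_list (map (\<lambda>_. 0) p) = sum_list (map (\<lambda>_. 0::nat) p')"
      using path_equiv_descent[OF r] by (auto simp: path_equiv_def)
  qed
  define M where "M = (card (verts ?Q) * r, W.rep)"
  have fM: "fst M = 2 * r" and sM: "snd M = W.rep" by (simp_all only: M_def card fst_conv snd_conv)
  have bim: "free_bimodule cyc.A Polynomial.smult M"
    unfolding M_def by (rule W.free_bimodule_rep)
  have c: "W.rep (cyc.pcls x) \<in> carrier_mat (2 * r) (2 * r)" if "x \<in> paths ?Q" for x
    using bim cyc.pcls_carrier[OF that] unfolding free_bimodule_iff fM sM by blast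
  have T: "snd (tensor_mod M (point_module l)) (cyc.pcls x) = map_mat (\<lambda>p. poly p l) (W.rep (cyc.pcls x))"
    if "x \<in> paths ?Q" for x l
    using c[OF that] tensor_point_module[of M] unfolding fM sM by blast
  have rv: "W.rep (cyc.pcls ({}, [], {})) = W.blockunit {} {} (1\<^sub>m r)"
    by (rule W.rep_vert) (simp add: cube_verts_1)
  have X: "X ^\<^sub>m Suc 0 * 1\<^sub>m r ^\<^sub>m 0 = X" "X ^\<^sub>m 0 * 1\<^sub>m r ^\<^sub>m 0 = 1\<^sub>m r"
    by (simp_all add: X_def)
  have ru: "W.rep (cyc.pcls up) = W.blockunit {0} {} (1\<^sub>m r)"
    using W.rep_arc[of "Edge {} 0"] X by (simp add: up_def cube_arcs_1 flip_def W.xypow_def cube_verts_1)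
  have rd: "W.rep (cyc.pcls down) = W.blockunit {} {0} X"
    using W.rep_arc[of "Edge {0} 0"] X by (simp add: down_def cube_arcs_1 flip_def W.xypow_def cube_verts_1)
  have div: "i div r = (if i < r then 0 else 1)" "i mod r = (if i < r then i else i - r)" if "i < 2 * r" for i
    using that by (auto simp: le_div_geq le_mod_geq)
  show ?thesis
  proof (rule that[OF bim])
    show "fst M = 2 * r" by (rule fM)
    fix l
    show "vmat (tensor_mod M (point_module l)) = jordan_v r"
      unfolding vmat_def T[OF cyc_paths(1)] rv
      unfolding jordan_v_def W.blockunit_def card
      by (intro eq_matI) (auto simp: div ix_def)
    show "zmat (tensor_mod M (point_module l)) = jordan_z r l"
      unfolding zmat_def T[OF cyc_paths(3)] T[OF cyc_paths(4)] ru rd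
      unfolding jordan_z_def W.blockunit_def card
      by (intro eq_matI) (auto simp: div ix_def X_def)
  qed
qed

section \<open>Tameness for one color\<close>

lemma square_pow:
  assumes Z: "Z \<in> carrier_mat n n"
  shows "opm ((Z * Z) ^\<^sub>m m) = opm (Z ^\<^sub>m (2 * m))"
proof (induction m)
  case 0
  then show ?case using Z by simp
next
  case (Suc m)
  have "opm ((Z * Z) ^\<^sub>m Suc m) = opm ((Z * Z) ^\<^sub>m m) * opm (Z * Z)"
    using carrier_matD[OF Z] by (simp add: opm_mult)
  also have "\<dots> = opm (Z ^\<^sub>m (2 * m)) * opm (Z ^\<^sub>m 2)"
    using Z by (simp add: Suc numeral_2_eq_2)
  finally show ?case by (simp add: opm_pow[OF Z])
qed

lemma tame_A1: "tame (alg_A 1)"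
  unfolding tame_def
proof
  fix d
  have A: "alg_A 1 = cyc.A" by (simp add: alg_A_def)
  \<comment> \<open>An invertible indecomposable module has even dimension \<open>2 * r\<close>, so
    for odd \<open>d\<close> the invertible case does not arise and rounding down does no
    harm.\<close>
  obtain M where M: "free_bimodule cyc.A Polynomial.smult M" "fst M = 2 * (d div 2)"
    "\<And>l. vmat (tensor_mod M (point_module l)) = jordan_v (d div 2)"
    "\<And>l. zmat (tensor_mod M (point_module l)) = jordan_z (d div 2) l"
    using one_parameter_family by blast
  let ?P = "\<lambda>u N. indecomposable cyc.A N \<and> fst N = d \<and> uniserial N u"
  \<comment> \<open>One representative for each Boolean \<open>u\<close> that occurs in dimension
    \<open>d\<close>, hence at most two. Choosing among existing indecomposables avoids constructing
    the string modules.\<close>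
  define E where "E = (\<lambda>u. SOME N. ?P u N) ` {u. \<exists>N. ?P u N}"
  have P: "?P u (SOME N. ?P u N)" if "\<exists>N. ?P u N" for u using that by (rule someI_ex)
  have "(\<exists>N'\<in>E. mod_iso cyc.A N N') \<or> (\<exists>l. mod_iso cyc.A N (tensor_mod M (point_module l)))"
    if N: "indecomposable cyc.A N" "fst N = d" for N
  proof -
    note fd = indecomposable_fd(1)[OF N(1)]
    note Mod = cyc_module[OF fd N(2)]
    define T where "T = zmat N * zmat N"
    have T: "T \<in> carrier_mat d d" unfolding T_def by (rule mult_carrier_mat[OF Mod(2) Mod(2)])
    have t: "opm T = opm (zmat N) * opm (zmat N)" using Mod(2) by (simp add: T_def opm_mult)
    have "opm T * opm (vmat N) = opm (vmat N) * opm T"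
    proof -
      let ?z = "opm (zmat N)" and ?e = "opm (vmat N)"
      \<comment> \<open>The bracket equals \<open>?z\<close> and thus commutes with it; after
        expansion the mixed terms cancel and the square of \<open>?z\<close> commutes with
        \<open>?e\<close>.\<close>
      have "?z * (?z * ?e + ?e * ?z) = (?z * ?e + ?e * ?z) * ?z" unfolding Mod(4) ..
      then show ?thesis by (simp add: t distrib_left distrib_right mult.assoc)
    qed
    then have "T * snd N a = snd N a * T" if "a \<in> carrier cyc.A" for a
      by (intro cyc_intertwiner[OF fd N(2) fd N(2) T _ _ that]) (simp_all add: t mult.assoc)
    from fitting[OF N(1) T[folded N(2)] this, unfolded N(2)] show ?thesis
    proof
      assume "\<exists>m. T ^\<^sub>m m = 0\<^sub>m d d"
      then obtain m where "T ^\<^sub>m m = 0\<^sub>m d d" by auto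
      then have "opm (zmat N ^\<^sub>m (2 * m)) = opm (0\<^sub>m d d)"
        using square_pow[OF Mod(2), of m] by (simp add: T_def)
      then have "zmat N ^\<^sub>m (2 * m) = 0\<^sub>m d d"
        using opm_inject_carrier[of _ _ d d] Mod(2) by simp
      then obtain u where u: "uniserial N u"
        using nilpotent_uniserial[OF N(1), of "2 * m"] N(2) by auto
      then have ex: "\<exists>N. ?P u N" using N by blast
      let ?N = "SOME N. ?P u N"
      have "mod_iso cyc.A N ?N"
        using P[OF ex] u N(2) by (intro uniserial_unique[OF fd]) (auto intro: indecomposable_fd)
      moreover have "?N \<in> E" using ex by (auto simp: E_def)
      ultimately show ?thesis by blast
    next
      assume "\<exists>V\<in>carrier_mat d d. T * V = 1\<^sub>m d"
      then obtain V0 where "V0 \<in> carrier_mat d d" "zmat N * zmat N * V0 = 1\<^sub>m d" by (auto simp: T_def)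
      from invertible_normal_form[OF N this] obtain r l B V where
        r: "d = 2 * r" and B: "B \<in> carrier_mat d d" "V \<in> carrier_mat d d" "B * V = 1\<^sub>m d" "V * B = 1\<^sub>m d"
        "zmat N * B = B * jordan_z r l" "vmat N * B = B * jordan_v r" by blast
      let ?N = "tensor_mod M (point_module l)"
      have J: "jordan_z r l \<in> carrier_mat d d" "jordan_v r \<in> carrier_mat d d"
        by (simp_all add: jordan_z_def jordan_v_def r)
      have fdT: "fd_module cyc.A ?N" by (rule fd_module_tensor[OF M(1) fd_point_module])
      have nT: "fst ?N = d" using M(2) r by (simp add: tensor_mod_def point_module_def Let_def)
      have MJ: "zmat ?N = jordan_z r l" "vmat ?N = jordan_v r" using M(3,4) r by simp_all
      have "mod_iso cyc.A N ?N"
      proof (rule cyc_mod_iso[OF fd N(2) fdT nT B(1,2) _ _ J B(3,4) _ _ B(5,6)])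
        show "1\<^sub>m d \<in> carrier_mat d d" "1\<^sub>m d \<in> carrier_mat d d" by simp_all
        show "1\<^sub>m d * 1\<^sub>m d = (1\<^sub>m d :: complex mat)" "1\<^sub>m d * 1\<^sub>m d = (1\<^sub>m d :: complex mat)" by simp_all
        show "zmat ?N * 1\<^sub>m d = 1\<^sub>m d * jordan_z r l" "vmat ?N * 1\<^sub>m d = 1\<^sub>m d * jordan_v r"
          using J by (simp_all add: MJ)
      qed
      then show ?thesis by blast
    qed
  qed
  moreover have "finite E" by (simp add: E_def)
  moreover have "\<forall>N\<in>E. fd_module cyc.A N"
    using P by (auto simp: E_def intro: indecomposable_fd)
  ultimately show "\<exists>E F. finite E \<and> finite F \<and> (\<forall>N\<in>E. fd_module (alg_A 1) N) \<and>
      (\<forall>M\<in>F. free_bimodule (alg_A 1) Polynomial.smult M) \<and>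
      (\<forall>N. indecomposable (alg_A 1) N \<and> fst N = d \<longrightarrow>
        (\<exists>N'\<in>E. mod_iso (alg_A 1) N N') \<or>
        (\<exists>M\<in>F. \<exists>l. mod_iso (alg_A 1) N (tensor_mod M (point_module l))))"
    unfolding A using M(1) by (intro exI[of _ E] exI[of _ "{M}"]) auto
qed

theorem proposition4p2:
  shows "(\<forall>k \<ge> 2. wild (alg_A k))
       \<and> (\<forall>k \<ge> 2. \<forall>r \<in> cube_verts k. wild (alg_A' k r))
       \<and> wild alg_A''2
       \<and> (\<forall>k \<ge> 3. \<forall>r \<in> cube_verts k. wild (alg_A'' k r))
       \<and> tame (alg_A 1)"
  using wild_A wild_A' wild_A''2 wild_A'' tame_A1 by blast

end
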